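(* Catalan matroids $C_n$ are non-extremal matroids. Moreover, the coordinate vector $p_{[C_n]}\in\Omega_{n,2n}$ of the Catalan matroid $C_n$ lies in the interior of the convex hull of the coordinate vectors of direct sums of uniform matroids.
   Context: $U_{k,m}$ is the uniform matroid of rank $k$ on $m$ elements. For $S\subseteq[m]=\{1,\dots,m\}$, $\mathrm{SM}_m(S)$ is the matroid on $[m]$ whose bases are the sets $T\subseteq[m]$ with $|T|=|S|$ such that for every $i$ the $i$-th smallest element of $T$ is at most the $i$-th smallest element of $S$. A Schubert matroid on $[m]$ is a matroid on $[m]$ isomorphic to some $\mathrm{SM}_m(S)$. The $n$-th Catalan matroid is $C_n=\mathrm{SM}_{2n}(\{2,4,\dots,2n\})$, of rank $n$ on $[2n]$. For a matroid $M$ on $[m]$, its matroid polytope is $\mathcal P(M)=\mathrm{conv}\{e_B : B \text{ a basis of } M\}\subset\mathbb R^m$, where $e_B=\sum_{b\in B}e_b$; $\mathbf 1_X:\mathbb R^m\to\mathbb Z$ denotes the indicator function of $X\subseteq\mathbb R^m$. By a known theorem (Derksen–Fink), every matroid $M$ of rank $k$ on $[m]$ has a unique expansion $\mathbf 1_{\mathcal P(M)}=\sum_S c_S\,\mathbf 1_{\mathcal P(S)}$ with integers $c_S$, the sum running over Schubert matroids $S$ of rank $k$ on $[m]$. The vector $p_M=(c_S)_S$ is the coordinate vector of $M$; the convex hull of all $p_M$, $M$ of rank $k$ on $[m]$, is the labeled polytope $\overline\Omega_{k,m}$. Identifying isomorphic matroids and taking the natural projection (summing the $c_S$ over each isomorphism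 class of Schubert matroids) gives the coordinate vector $p_{[M]}$ of the isomorphism class $[M]$, and the unlabeled polytope $\Omega_{k,m}$, the convex hull of all $p_{[M]}$. A matroid $M$ of rank $k$ on $m$ elements is extremal if $p_{[M]}$ is a vertex of $\Omega_{k,m}$.
   Formalization: Proved for n ≥ 2 (C_1 is extremal), with "interior" read as relative interior and "direct sums of uniform matroids" restricted to direct sums of matroids U_{j,2j}; for all direct sums the claim fails, since C_n has no loops and so lies on a proper face. *)

theory Defs
  imports "HOL-Analysis.Analysis" "HOL-Analysis.Finite_Function_Topology"
begin

text \<open>
  A matroid is represented by its set of bases. The ground set is a separate argument, because
  the bases do not determine the loops.
\<close>

definition is_matroid :: "'a set \<Rightarrow> 'a set set \<Rightarrow> bool" where
  "is_matroid E M \<longleftrightarrow> finite E \<and> M \<noteq> {} \<and> (\<forall>B\<in>M. B \<subseteq> E) \<and>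
     (\<forall>B\<in>M. \<forall>B'\<in>M. \<forall>x\<in>B - B'. \<exists>y\<in>B' - B. insert y (B - {x}) \<in> M)"

definition matroids :: "nat \<Rightarrow> nat \<Rightarrow> nat set set set" where
  "matroids k m = {M. is_matroid {1..m} M \<and> (\<forall>B\<in>M. card B = k)}"

definition isomorphic_on :: "'a set \<Rightarrow> 'a set set \<Rightarrow> 'a set set \<Rightarrow> bool" where
  "isomorphic_on E M N \<longleftrightarrow> (\<exists>f. bij_betw f E E \<and> N = (\<lambda>B. f ` B) ` M)"

definition iso_class :: "nat \<Rightarrow> nat set set \<Rightarrow> nat set set set" where
  "iso_class m M = {N. isomorphic_on {1..m} M N}"

definition uniform :: "'a set \<Rightarrow> nat \<Rightarrow> 'a set set" where
  "uniform E k = {B. B \<subseteq> E \<and> card B = k}"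

text \<open>The ground sets of the summands are meant to be pairwise disjoint.\<close>

definition direct_sum :: "'i set \<Rightarrow> ('i \<Rightarrow> 'a set set) \<Rightarrow> 'a set set" where
  "direct_sum I M = {\<Union>i\<in>I. B i | B. \<forall>i\<in>I. B i \<in> M i}"

definition SM :: "nat \<Rightarrow> nat set \<Rightarrow> nat set set" where
  "SM m S = {T. T \<subseteq> {1..m} \<and> card T = card S \<and>
     (\<forall>i<card S. sorted_list_of_set T ! i \<le> sorted_list_of_set S ! i)}"

definition schubert_matroids :: "nat \<Rightarrow> nat \<Rightarrow> nat set set set" where
  "schubert_matroids k m =
     {M \<in> matroids k m. \<exists>S\<subseteq>{1..m}. isomorphic_on {1..m} (SM m S) M}"

definition catalan_matroid :: "nat \<Rightarrow> nat set set" where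
  "catalan_matroid n = SM (2 * n) ((\<lambda>i. 2 * i) ` {1..n})"

text \<open>
  A space \<open>\<real>\<^sup>I\<close> with finite index set \<open>I\<close> is regarded as the subspace of \<open>_ \<Rightarrow>\<^sub>0 real\<close> of the
  vectors supported on \<open>I\<close>, so that \<open>Poly_Mapping.single i 1\<close> is the unit vector \<open>e\<^sub>i\<close>. The
  polytope of a matroid on \<open>{1..m}\<close> lies in the subspace for \<open>{1..m}\<close>; indicator functions
  of such polytopes vanish outside of it, so a linear relation between them holds on this subspace
  iff it holds everywhere.
\<close>

definition matroid_polytope :: "nat set set \<Rightarrow> (nat \<Rightarrow>\<^sub>0 real) set" where
  "matroid_polytope M = convex hull ((\<lambda>B. \<Sum>b\<in>B. Poly_Mapping.single b 1) ` M)"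

text \<open>
  For a matroid of rank \<open>k\<close> on \<open>{1..m}\<close>, existence and uniqueness of the following family of
  integers is a theorem of Derksen and Fink.
\<close>

definition schubert_coords :: "nat \<Rightarrow> nat \<Rightarrow> nat set set \<Rightarrow> (nat set set \<Rightarrow>\<^sub>0 int)" where
  "schubert_coords k m M =
     (THE c. Poly_Mapping.keys c \<subseteq> schubert_matroids k m \<and>
        (\<forall>x. (indicator (matroid_polytope M) x :: int) =
          (\<Sum>S\<in>schubert_matroids k m.
             Poly_Mapping.lookup c S * indicator (matroid_polytope S) x)))"

text \<open>
  The coordinate vector \<open>p\<^bsub>[M]\<^esub>\<close>: its coordinates are indexed by the isomorphism classes of
  Schubert matroids, and summands for isomorphic Schubert matroids add up.
\<close>

definition coord_vector :: "nat \<Rightarrow> nat \<Rightarrow> nat set set \<Rightarrow> (nat set set set \<Rightarrow>\<^sub>0 real)" where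
  "coord_vector k m M =
     (\<Sum>S\<in>schubert_matroids k m.
        Poly_Mapping.single (iso_class m S)
          (of_int (Poly_Mapping.lookup (schubert_coords k m M) S)))"

definition unlabeled_polytope :: "nat \<Rightarrow> nat \<Rightarrow> (nat set set set \<Rightarrow>\<^sub>0 real) set" where
  "unlabeled_polytope k m = convex hull (coord_vector k m ` matroids k m)"

definition extremal :: "nat \<Rightarrow> nat \<Rightarrow> nat set set \<Rightarrow> bool" where
  "extremal k m M \<longleftrightarrow> coord_vector k m M extreme_point_of unlabeled_polytope k m"

text \<open>
  The direct sums of uniform matroids \<open>U\<^bsub>j,2j\<^esub>\<close> on the ground set \<open>{1..2n}\<close>; their rank is \<open>n\<close>.
  The coordinate vectors of all direct sums of uniform matroids of rank \<open>n\<close> on \<open>{1..2n}\<close> span a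
  simplex, and for \<open>n \<ge> 2\<close> the Catalan matroid lies on its boundary, in the relative interior of
  the face belonging to the direct sums below.
\<close>

definition balanced_uniform_sums :: "nat \<Rightarrow> nat set set set" where
  "balanced_uniform_sums n =
     {direct_sum P (\<lambda>A. uniform A (r A)) | P r.
        partition_on {1..2 * n} P \<and> (\<forall>A\<in>P. card A = 2 * r A)}"

end

theory Submission
  imports Defs "HOL-Combinatorics.Multiset_Permutations" "HOL-Library.Nat_Bijection"
begin

text \<open>
  Write \<open>y(A) = x(A) - |A|/2\<close>. Group the ground set into \<open>n\<close> pairs. For an ordering of the pairs,
  the points \<open>x\<close> of the hypersimplex all of whose partial sums of \<open>y\<close> are nonnegative form the
  polytope of a relabeled Catalan matroid. By the combinatorial lemma of Sparre Andersen and Spitzer,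
  the orderings with nonnegative partial sums and total 0 are equinumerous with the permutations of
  the pairs all of whose cycles have sum 0. The latter condition describes the polytope of a
  direct sum of matroids \<open>U\<^bsub>j,2j\<^esub>\<close>, one for each cycle. So the indicator functions of \<open>n!\<close>
  relabeled Catalan matroids add up to those of direct sums of uniform matroids, and since
  the coordinates depend linearly on the indicator function, \<open>C\<^sub>n\<close> is a convex combination of the
  direct sums. Varying the pairing, every direct sum occurs with positive weight.
\<close>

section \<open>Linear relations between indicator functions\<close>

text \<open>Pairs suffice as building blocks because the basis {2, 4, ..., 2n} bounds prefix counts
  effectively at even positions only. \<open>schubert_coords\<close> is a definite description, so
  it can be computed with only where an expansion exists and is unique. Uniqueness is the linear
  independence of the indicator functions of Schubert polytopes, and this is what the Euler
  characteristic is for: comparing minima of a linear functional isolates a single coefficient.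
  Existence is immediate for the relabeled Catalan matroids, which are Schubert matroids; the
  polytope of a direct sum is cut out by one equation per block, and these equations are removed one
  at a time by an alternating sum over insertions and mergings of blocks. Polytopes are given by
  vertices, but the counting compares inequalities at a point; the passage needs integrality, which
  holds because the constraints concern a chain of sets. Direct sums fit in since equations on
  disjoint blocks amount to equations on prefix unions. Non-extremality finally uses that U_{n,2n}
  has positive weight while its coordinate vector differs from that of C_n.\<close>

text \<open>
  The Euler characteristic is a linear functional on indicator functions of compact convex sets.
  On the line it is obtained by comparing a function at \<open>s\<close> and just below \<open>s\<close>; in general by
  slicing along one coordinate after the other.
\<close>

lemma sum_left_endpoints_eq_0:
  fixes a b :: "'i \<Rightarrow> real" and c :: "'i \<Rightarrow> int"
  assumes I: "finite I" and ab: "\<And>i. i \<in> I \<Longrightarrow> a i \<le> b i"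
    and zero: "\<And>t. (\<Sum>i\<in>I. c i * indicator {a i..b i} t) = 0"
  shows "(\<Sum>i | i \<in> I \<and> a i = s. c i) = 0"
proof -
  define F where "F = {v \<in> a ` I \<union> b ` I. v < s}"
  have F: "finite F" using I by (simp add: F_def)
  obtain t where t: "t < s" "\<And>v. v \<in> F \<Longrightarrow> v < t"
  proof (cases "F = {}")
    case True
    then show thesis using that[of "s - 1"] by simp
  next
    case False
    then have "Max F < s" using F Max_in[of F] by (auto simp: F_def)
    then show thesis
      using that[of "(Max F + s) / 2"] Max_ge[OF F] by (force simp: field_simps)
  qed
  have *: "indicator {a i..b i} s - indicator {a i..b i} t = (if a i = s then 1 else (0::int))" if "i \<in> I" for i
  proof -
    have "a i < s \<longrightarrow> a i < t" "b i < s \<longrightarrow> b i < t"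
      using t(2) that by (auto simp: F_def)
    then show ?thesis using ab[OF that] t(1) by (auto simp: indicator_def not_less)
  qed
  have "(\<Sum>i | i \<in> I \<and> a i = s. c i) = (\<Sum>i\<in>I. c i * (if a i = s then 1 else 0))"
    using I by (simp add: sum.If_cases Int_def if_distrib cong: if_cong)
  also have "\<dots> = (\<Sum>i\<in>I. c i * indicator {a i..b i} s - c i * indicator {a i..b i} t)"
    by (rule sum.cong) (simp_all flip: * right_diff_distrib)
  also have "\<dots> = 0" by (simp add: sum_subtractf zero)
  finally show ?thesis .
qed

text \<open>The image of \<open>K i\<close> under \<open>l\<close> is a compact interval, and the
  slice at \<open>t\<close> is nonempty iff \<open>t\<close> lies in it. The hypothesis is therefore
  a relation between indicator functions of intervals, to which
  \<open>sum_left_endpoints_eq_0\<close> applies.\<close>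

lemma sum_min_eq_0_if_slices:
  fixes K :: "'i \<Rightarrow> 'a::real_normed_vector set" and c :: "'i \<Rightarrow> int"
  assumes I: "finite I" and K: "\<And>i. i \<in> I \<Longrightarrow> compact (K i) \<and> convex (K i)"
    and l: "bounded_linear (l :: 'a \<Rightarrow> real)"
    and slice: "\<And>t. (\<Sum>i | i \<in> I \<and> K i \<inter> {x. l x = t} \<noteq> {}. c i) = 0"
  shows "(\<Sum>i | i \<in> I \<and> K i \<noteq> {} \<and> Inf (l ` K i) = s. c i) = 0"
proof -
  define J where "J = {i \<in> I. K i \<noteq> {}}"
  define a where "a i = Inf (l ` K i)" for i
  define b where "b i = Sup (l ` K i)" for i
  have J: "finite J" using I by (simp add: J_def)
  have img: "l ` K i = {a i..b i}" if "i \<in> J" for i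
  proof -
    have K': "compact (K i)" "convex (K i)" using K that by (auto simp: J_def)
    have "compact (l ` K i)"
      by (intro compact_continuous_image linear_continuous_on l K')
    moreover have "convex (l ` K i)"
      by (intro convex_linear_image bounded_linear.linear l K')
    ultimately obtain p q where "l ` K i = {p..q}"
      by (metis connected_compact_interval_1 convex_connected box_real(2))
    then show ?thesis using that by (cases "p \<le> q") (auto simp: a_def b_def J_def)
  qed
  have "(\<Sum>i | i \<in> J \<and> a i = s. c i) = 0"
  proof (rule sum_left_endpoints_eq_0[OF J, where b = b])
    show "a i \<le> b i" if "i \<in> J" for i
      using img[OF that] that by (force simp: J_def)
    fix t
    have *: "indicator {a i..b i} t = (if K i \<inter> {x. l x = t} \<noteq> {} then 1 else (0::int))" if "i \<in> J" for i
      using img[OF that, symmetric] by (auto simp: indicator_def)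
    have "(\<Sum>i\<in>J. c i * indicator {a i..b i} t) = (\<Sum>i\<in>J. c i * (if K i \<inter> {x. l x = t} \<noteq> {} then 1 else 0))"
      by (simp add: *)
    also have "\<dots> = (\<Sum>i | i \<in> J \<and> K i \<inter> {x. l x = t} \<noteq> {}. c i)"
      using J by (simp add: sum.If_cases Int_def if_distrib cong: if_cong)
    also have "\<dots> = 0"
      unfolding slice[of t, symmetric] by (rule sum.cong) (auto simp: J_def)
    finally show "(\<Sum>i\<in>J. c i * indicator {a i..b i} t) = 0" .
  qed
  then show ?thesis by (simp add: J_def a_def conj_assoc)
qed

lemma level_set_closed_convex:
  fixes u :: "'a::real_normed_vector \<Rightarrow> real"
  assumes u: "bounded_linear u"
  shows "closed {x. u x = t} \<and> convex {x. u x = t}"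
proof
  show "closed {x. u x = t}"
    by (intro closed_Collect_eq linear_continuous_on u continuous_on_const)
  interpret linear u by (rule bounded_linear.linear[OF u])
  show "convex {x. u x = t}"
    by (auto simp: convex_alt add scale diff algebra_simps)
qed

text \<open>Induction on the separating functionals: slices along \<open>l\<close> are separated by
  the remaining ones, so their coefficients cancel, hence the coefficients cancel for each value of
  the minimum of \<open>l\<close>. For empty \<open>L\<close> all nonempty \<open>K i\<close> are
  the same point. Separation is asked for on the sets only, because the later ambient space is
  infinite-dimensional.\<close>

lemma sum_nonempty_eq_0:
  fixes K :: "'i \<Rightarrow> 'a::real_normed_vector set" and c :: "'i \<Rightarrow> int"
  assumes L: "finite L" and I: "finite I"
    and K: "\<And>i. i \<in> I \<Longrightarrow> compact (K i) \<and> convex (K i)"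
    and lin: "\<And>l. l \<in> L \<Longrightarrow> bounded_linear (l :: 'a \<Rightarrow> real)"
    and sep: "\<And>i j x y. i \<in> I \<Longrightarrow> j \<in> I \<Longrightarrow> x \<in> K i \<Longrightarrow> y \<in> K j \<Longrightarrow> (\<And>l. l \<in> L \<Longrightarrow> l x = l y) \<Longrightarrow> x = y"
    and zero: "\<And>x. (\<Sum>i\<in>I. c i * indicator (K i) x) = 0"
  shows "(\<Sum>i | i \<in> I \<and> K i \<noteq> {}. c i) = 0"
  using L K lin sep zero
proof (induction L arbitrary: K rule: finite_induct)
  case empty
  show ?case
  proof (cases "\<exists>i\<in>I. K i \<noteq> {}")
    case False
    then show ?thesis by (intro sum.neutral) auto
  next
    case True
    then obtain j x where j: "j \<in> I" "x \<in> K j" by auto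
    have "K i \<noteq> {} \<longleftrightarrow> x \<in> K i" if "i \<in> I" for i
      using empty.prems(3)[of j i x] that j by auto
    then have "(\<Sum>i | i \<in> I \<and> K i \<noteq> {}. c i) = (\<Sum>i | i \<in> I \<and> x \<in> K i. c i)"
      by (intro sum.cong) auto
    also have "\<dots> = (\<Sum>i\<in>I. c i * indicator (K i) x)"
      using I by (simp add: indicator_def sum.If_cases Int_def if_distrib cong: if_cong)
    also have "\<dots> = 0" by (rule empty.prems)
    finally show ?thesis .
  qed
next
  case (insert l L)
  have l: "bounded_linear l" using insert.prems by simp
  have slice: "(\<Sum>i | i \<in> I \<and> K i \<inter> {x. l x = t} \<noteq> {}. c i) = 0" for t
  proof (rule insert.IH)
    show "compact (K i \<inter> {x. l x = t}) \<and> convex (K i \<inter> {x. l x = t})" if "i \<in> I" for i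
      using insert.prems(1)[OF that] level_set_closed_convex[OF l] by (auto intro: compact_Int_closed convex_Int)
    show "bounded_linear l'" if "l' \<in> L" for l' using insert.prems(2) that by simp
    show "x = y" if "i \<in> I" "j \<in> I" "x \<in> K i \<inter> {x. l x = t}" "y \<in> K j \<inter> {x. l x = t}"
      "\<And>l. l \<in> L \<Longrightarrow> l x = l y" for i j x y
      by (rule insert.prems(3)[of i j x y]) (use that in auto)
    fix x
    have "(\<Sum>i\<in>I. c i * indicator (K i \<inter> {x. l x = t}) x) = (\<Sum>i\<in>I. c i * indicator (K i) x) * indicator {x. l x = t} x"
      by (simp add: sum_distrib_right indicator_inter_arith mult.assoc)
    then show "(\<Sum>i\<in>I. c i * indicator (K i \<inter> {x. l x = t}) x) = 0"
      by (simp add: insert.prems(4))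
  qed
  define J where "J = {i \<in> I. K i \<noteq> {}}"
  have J: "finite J" using I by (simp add: J_def)
  have "sum c J = (\<Sum>s\<in>(\<lambda>i. Inf (l ` K i)) ` J. \<Sum>i | i \<in> J \<and> Inf (l ` K i) = s. c i)"
    using J by (rule sum.image_gen)
  also have "\<dots> = 0"
  proof (rule sum.neutral, rule ballI)
    fix s
    have "(\<Sum>i | i \<in> I \<and> K i \<noteq> {} \<and> Inf (l ` K i) = s. c i) = 0"
      by (rule sum_min_eq_0_if_slices[OF I _ l slice]) (use insert.prems(1) in auto)
    then show "(\<Sum>i | i \<in> J \<and> Inf (l ` K i) = s. c i) = 0" by (simp add: J_def conj_assoc)
  qed
  finally show ?case by (simp add: J_def)
qed

text \<open>Hyperplane slices inherit the relation, so \<open>sum_nonempty_eq_0\<close> provides the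
  hypothesis of \<open>sum_min_eq_0_if_slices\<close> for an arbitrary \<open>u\<close>. A suitable
  \<open>u\<close> later singles out one coefficient.\<close>

lemma sum_min_eq_0:
  fixes K :: "'i \<Rightarrow> 'a::real_normed_vector set" and c :: "'i \<Rightarrow> int"
  assumes L: "finite L" and I: "finite I"
    and K: "\<And>i. i \<in> I \<Longrightarrow> compact (K i) \<and> convex (K i)"
    and lin: "\<And>l. l \<in> L \<Longrightarrow> bounded_linear (l :: 'a \<Rightarrow> real)"
    and sep: "\<And>i j x y. i \<in> I \<Longrightarrow> j \<in> I \<Longrightarrow> x \<in> K i \<Longrightarrow> y \<in> K j \<Longrightarrow> (\<And>l. l \<in> L \<Longrightarrow> l x = l y) \<Longrightarrow> x = y"
    and zero: "\<And>x. (\<Sum>i\<in>I. c i * indicator (K i) x) = 0"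
    and u: "bounded_linear (u :: 'a \<Rightarrow> real)"
  shows "(\<Sum>i | i \<in> I \<and> K i \<noteq> {} \<and> Inf (u ` K i) = s. c i) = 0"
proof (rule sum_min_eq_0_if_slices[OF I K u])
  fix t
  show "(\<Sum>i | i \<in> I \<and> K i \<inter> {x. u x = t} \<noteq> {}. c i) = 0"
  proof (rule sum_nonempty_eq_0[OF L I])
    show "compact (K i \<inter> {x. u x = t}) \<and> convex (K i \<inter> {x. u x = t})" if "i \<in> I" for i
      using K[OF that] level_set_closed_convex[OF u] by (auto intro: compact_Int_closed convex_Int)
    show "x = y" if "i \<in> I" "j \<in> I" "x \<in> K i \<inter> {x. u x = t}" "y \<in> K j \<inter> {x. u x = t}"
      "\<And>l. l \<in> L \<Longrightarrow> l x = l y" for i j x y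
      using sep[of i j x y] that by auto
    fix x
    have "(\<Sum>i\<in>I. c i * indicator (K i \<inter> {x. u x = t}) x) = (\<Sum>i\<in>I. c i * indicator (K i) x) * indicator {x. u x = t} x"
      by (simp add: sum_distrib_right indicator_inter_arith mult.assoc)
    then show "(\<Sum>i\<in>I. c i * indicator (K i \<inter> {x. u x = t}) x) = 0"
      by (simp add: zero)
  qed (rule lin)
qed

section \<open>Coordinates in spaces of finitely supported functions\<close>

lemma lookup_scaleR [simp]:
  "Poly_Mapping.lookup (r *\<^sub>R x) i = r *\<^sub>R Poly_Mapping.lookup x i"
  by (cases "r = 0") (simp_all add: scaleR_poly_mapping_def)

lemma scaleR_single: "r *\<^sub>R Poly_Mapping.single i s = Poly_Mapping.single i (r *\<^sub>R s)"
  by (rule poly_mapping_eqI) (simp add: lookup_single when_def)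

lemma norm_lookup_le: "norm (Poly_Mapping.lookup x i) \<le> norm x"
proof -
  have "norm x = (\<Sum>n\<in>Poly_Mapping.keys x. norm (Poly_Mapping.lookup x n))"
    by (simp add: norm_poly_mapping_def dist_poly_mapping_def)
  then show ?thesis
    by (cases "i \<in> Poly_Mapping.keys x")
       (auto simp: in_keys_iff sum_nonneg intro!: member_le_sum)
qed

lemma bounded_linear_lookup: "bounded_linear (\<lambda>x. Poly_Mapping.lookup x i)"
  by (rule bounded_linear_intro[where K = 1]) (simp_all add: lookup_add norm_lookup_le)

lemma lookup_sum: "Poly_Mapping.lookup (sum f A) i = (\<Sum>a\<in>A. Poly_Mapping.lookup (f a) i)"
  by (induction A rule: infinite_finite_induct) (simp_all add: lookup_add)

text \<open>Continuity of the functional is the point: it leads to coordinates on a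
  finite-dimensional span that are continuous on the whole space.\<close>

lemma ex_separating_functional:
  fixes V :: "('i \<Rightarrow>\<^sub>0 real) set"
  assumes "finite V" "a \<notin> span V"
  shows "\<exists>\<phi> :: ('i \<Rightarrow>\<^sub>0 real) \<Rightarrow> real. bounded_linear \<phi> \<and> (\<forall>v\<in>V. \<phi> v = 0) \<and> \<phi> a = 1"
  using assms
proof (induction V arbitrary: a rule: finite_induct)
  case empty
  then have "a \<noteq> 0" by (simp add: span_zero)
  then obtain i where "Poly_Mapping.lookup a i \<noteq> 0"
    by (metis poly_mapping_eqI lookup_zero)
  then show ?case
    by (intro exI[of _ "\<lambda>x. Poly_Mapping.lookup x i / Poly_Mapping.lookup a i"])
       (auto intro: bounded_linear_compose[OF bounded_linear_divide bounded_linear_lookup])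
next
  case (insert b V)
  show ?case
  proof (cases "b \<in> span V")
    case True
    then have "a \<notin> span V" using insert.prems by (simp add: span_redundant)
    then obtain \<phi> :: "('i \<Rightarrow>\<^sub>0 real) \<Rightarrow> real"
      where \<phi>: "bounded_linear \<phi>" "\<forall>v\<in>V. \<phi> v = 0" "\<phi> a = 1"
      using insert.IH by blast
    have "\<phi> b = 0"
      using linear_eq_on[OF bounded_linear.linear[OF \<phi>(1)] linear_zero True] \<phi>(2) by simp
    then show ?thesis using \<phi> by blast
  next
    case False
    then obtain \<phi> :: "('i \<Rightarrow>\<^sub>0 real) \<Rightarrow> real"
      where \<phi>: "bounded_linear \<phi>" "\<forall>v\<in>V. \<phi> v = 0" "\<phi> b = 1"
      using insert.IH by blast
    \<comment> \<open>Removing the \<open>b\<close>-component of \<open>a\<close> reduces to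
      \<open>V\<close>; the functional \<open>\<psi>\<close> found there is then corrected by a
      multiple of \<open>\<phi>\<close> so that it also vanishes at \<open>b\<close>.\<close>
    have "a - \<phi> a *\<^sub>R b \<notin> span V"
      using insert.prems by (auto simp: span_insert)
    then obtain \<psi> :: "('i \<Rightarrow>\<^sub>0 real) \<Rightarrow> real"
      where \<psi>: "bounded_linear \<psi>" "\<forall>v\<in>V. \<psi> v = 0" "\<psi> (a - \<phi> a *\<^sub>R b) = 1"
      using insert.IH by blast
    interpret \<psi>: bounded_linear \<psi> by (rule \<psi>)
    have "\<psi> a - \<psi> b * \<phi> a = 1"
      using \<psi>(3) by (simp add: \<psi>.diff \<psi>.scale mult.commute)
    then show ?thesis
      using \<phi> \<psi> by (intro exI[of _ "\<lambda>x. \<psi> x - \<psi> b * \<phi> x"])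
        (auto intro!: bounded_linear_sub bounded_linear_const_mult)
  qed
qed

text \<open>\<open>V\<close> may be linearly dependent: one representation is selected, linearly and
  continuously, by giving a vector in the span of the earlier ones the functional 0.\<close>

lemma ex_coordinate_functionals:
  fixes V :: "('i \<Rightarrow>\<^sub>0 real) set"
  assumes "finite V"
  shows "\<exists>g :: ('i \<Rightarrow>\<^sub>0 real) \<Rightarrow> ('i \<Rightarrow>\<^sub>0 real) \<Rightarrow> real.
    (\<forall>v. bounded_linear (g v)) \<and> (\<forall>x\<in>span V. x = (\<Sum>v\<in>V. g v x *\<^sub>R v))"
  using assms
proof (induction V rule: finite_induct)
  case empty
  then show ?case by (intro exI[of _ "\<lambda>_ _. 0"]) auto
next
  case (insert a V)
  then obtain g :: "('i \<Rightarrow>\<^sub>0 real) \<Rightarrow> ('i \<Rightarrow>\<^sub>0 real) \<Rightarrow> real"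
    where g: "\<forall>v. bounded_linear (g v)" "\<forall>x\<in>span V. x = (\<Sum>v\<in>V. g v x *\<^sub>R v)"
    by blast
  have g0: "g v 0 = 0" for v using g(1) by (simp add: linear_simps)
  obtain \<phi> :: "('i \<Rightarrow>\<^sub>0 real) \<Rightarrow> real"
    where \<phi>: "bounded_linear \<phi>" "\<And>x. x \<in> span (insert a V) \<Longrightarrow> x - \<phi> x *\<^sub>R a \<in> span V"
  proof (cases "a \<in> span V")
    case True
    then show thesis by (intro that[of "\<lambda>_. 0"]) (auto simp: span_redundant)
  next
    case False
    then obtain \<phi> :: "('i \<Rightarrow>\<^sub>0 real) \<Rightarrow> real"
      where \<phi>: "bounded_linear \<phi>" "\<forall>v\<in>V. \<phi> v = 0" "\<phi> a = 1"
      using ex_separating_functional insert.hyps by blast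
    interpret \<phi>: bounded_linear \<phi> by (rule \<phi>)
    show thesis
    proof (rule that[OF \<phi>(1)])
      fix x assume "x \<in> span (insert a V)"
      then obtain k where k: "x - k *\<^sub>R a \<in> span V" by (auto simp: span_insert)
      have "\<phi> (x - k *\<^sub>R a) = 0"
        using linear_eq_on[OF \<phi>.linear linear_zero k] \<phi>(2) by simp
      then have "\<phi> x = k" by (simp add: \<phi>.diff \<phi>.scale \<phi>(3))
      then show "x - \<phi> x *\<^sub>R a \<in> span V" using k by simp
    qed
  qed
  define h where "h v x = (if v = a then \<phi> x else g v (x - \<phi> x *\<^sub>R a))" for v x
  have "bounded_linear (h v)" for v
  proof (cases "v = a")
    case True
    then have "h v = \<phi>" by (auto simp: h_def)
    then show ?thesis using \<phi>(1) by simp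
  next
    case False
    then have h: "h v = (\<lambda>x. g v (x - \<phi> x *\<^sub>R a))" by (auto simp: h_def)
    have "bounded_linear (\<lambda>x. x - \<phi> x *\<^sub>R a)"
      by (intro bounded_linear_sub bounded_linear_ident
          bounded_linear_compose[OF bounded_linear_scaleR_left \<phi>(1)])
    from bounded_linear_compose[OF spec[OF g(1), of v] this] show ?thesis
      unfolding h .
  qed
  moreover have "x = (\<Sum>v\<in>insert a V. h v x *\<^sub>R v)" if "x \<in> span (insert a V)" for x
  proof -
    have "x - \<phi> x *\<^sub>R a = (\<Sum>v\<in>V. g v (x - \<phi> x *\<^sub>R a) *\<^sub>R v)"
      using g(2) \<phi>(2)[OF that] by blast
    also have "\<dots> = (\<Sum>v\<in>V. h v x *\<^sub>R v)"
      using insert.hyps by (intro sum.cong) (auto simp: h_def)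
    finally show ?thesis
      using insert.hyps by (simp add: h_def algebra_simps)
  qed
  ultimately show ?case by blast
qed

text \<open>A point \<open>y\<close> of the affine hull near \<open>x\<close> is reached by changing
  the weights along the differences \<open>z - z0\<close>, with changes depending continuously on
  \<open>y\<close>; the weight of \<open>z0\<close> compensates for them. Positive weights stay
  positive under small changes, also if \<open>Z\<close> is affinely dependent.\<close>

lemma rel_interior_convex_hull_if_pos:
  fixes Z :: "('i \<Rightarrow>\<^sub>0 real) set"
  assumes Z: "finite Z" and pos: "\<And>z. z \<in> Z \<Longrightarrow> 0 < \<mu> z" and one: "sum \<mu> Z = 1"
  shows "(\<Sum>z\<in>Z. \<mu> z *\<^sub>R z) \<in> rel_interior (convex hull Z)"
proof -
  define x where "x = (\<Sum>z\<in>Z. \<mu> z *\<^sub>R z)"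
  obtain z0 where z0: "z0 \<in> Z" using one by (metis ex_in_conv sum.empty zero_neq_one)
  define Y where "Y = Z - {z0}"
  have Y: "finite Y" "Z = insert z0 Y" "z0 \<notin> Y" using Z z0 by (auto simp: Y_def)
  define V where "V = (\<lambda>z. z - z0) ` Y"
  have V: "finite V" using Y by (simp add: V_def)
  have hull: "affine hull Z = {z0 + v | v. v \<in> span V}"
  proof -
    have "V = {x - z0 |x. x \<in> Z - {z0}}" by (auto simp: V_def Y_def)
    then show ?thesis using affine_hull_span[OF z0] by simp
  qed
  obtain g :: "('i \<Rightarrow>\<^sub>0 real) \<Rightarrow> ('i \<Rightarrow>\<^sub>0 real) \<Rightarrow> real"
    where g: "\<And>v. bounded_linear (g v)" "\<And>x. x \<in> span V \<Longrightarrow> x = (\<Sum>v\<in>V. g v x *\<^sub>R v)"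
    using ex_coordinate_functionals[OF V] by blast
  define G where "G y z = g (z - z0) (y - x)" for y z
  define \<nu> where "\<nu> y z = (if z = z0 then \<mu> z0 - (\<Sum>z\<in>Y. G y z) else \<mu> z + G y z)" for y z
  have cont: "continuous_on UNIV (\<lambda>y. G y z)" for z
    unfolding G_def using g(1)[of "z - z0"]
    by (intro bounded_linear.continuous_on[of "g (z - z0)"] continuous_intros)
  have cont': "continuous_on UNIV (\<lambda>y. \<nu> y z)" for z
    unfolding \<nu>_def by (cases "z = z0") (auto intro!: continuous_intros cont)
  define T where "T = (\<Inter>z\<in>Z. {y. 0 < \<nu> y z})"
  have "open T"
    unfolding T_def using Z cont' by (auto intro!: open_INT open_Collect_less)
  have "G x z = 0" for z
    using g(1)[of "z - z0"] by (simp add: G_def linear_simps)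
  then have xT: "x \<in> T" using pos z0 by (auto simp: T_def \<nu>_def Y)
  have xhull: "x \<in> affine hull Z"
    unfolding affine_hull_finite[OF Z] using one by (auto simp: x_def)
  have "affine hull Z \<inter> T \<subseteq> convex hull Z"
  proof
    fix y assume y: "y \<in> affine hull Z \<inter> T"
    have "y - x \<in> span V"
    proof -
      obtain v w where "y = z0 + v" "v \<in> span V" "x = z0 + w" "w \<in> span V"
        using y xhull hull by auto
      then show ?thesis by (simp add: span_diff)
    qed
    then have "y - x = (\<Sum>v\<in>V. g v (y - x) *\<^sub>R v)" by (rule g(2))
    also have "\<dots> = (\<Sum>z\<in>Y. G y z *\<^sub>R (z - z0))"
      unfolding V_def by (subst sum.reindex) (auto simp: inj_on_def G_def)
    finally have 1: "y = x + (\<Sum>z\<in>Y. G y z *\<^sub>R (z - z0))" by (simp add: algebra_simps)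
    have 2: "(\<Sum>z\<in>Y. \<nu> y z *\<^sub>R z) = (\<Sum>z\<in>Y. \<mu> z *\<^sub>R z) + (\<Sum>z\<in>Y. G y z *\<^sub>R z)"
      unfolding sum.distrib[symmetric] using Y(3)
      by (intro sum.cong) (auto simp: \<nu>_def scaleR_add_left)
    have "(\<Sum>z\<in>Z. \<nu> y z *\<^sub>R z) = \<nu> y z0 *\<^sub>R z0 + (\<Sum>z\<in>Y. \<nu> y z *\<^sub>R z)"
      using Y by simp
    also have "\<dots> = \<mu> z0 *\<^sub>R z0 - sum (G y) Y *\<^sub>R z0 + ((\<Sum>z\<in>Y. \<mu> z *\<^sub>R z) + (\<Sum>z\<in>Y. G y z *\<^sub>R z))"
      unfolding 2 by (simp add: \<nu>_def[of _ z0] scaleR_left_diff_distrib)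
    also have "\<dots> = x + (\<Sum>z\<in>Y. G y z *\<^sub>R (z - z0))"
      using Y by (simp add: x_def scaleR_diff_right sum_subtractf scaleR_sum_left)
    finally have "y = (\<Sum>z\<in>Z. \<nu> y z *\<^sub>R z)" using 1 by simp
    moreover have "sum (\<nu> y) Z = 1"
    proof -
      have "sum (\<nu> y) Y = sum \<mu> Y + sum (G y) Y"
        unfolding sum.distrib[symmetric] using Y(3) by (intro sum.cong) (auto simp: \<nu>_def)
      then show ?thesis using one Y by (simp add: \<nu>_def[of _ z0])
    qed
    moreover have "0 \<le> \<nu> y z" if "z \<in> Z" for z
      using y that by (auto simp: T_def less_imp_le)
    ultimately have "y = (\<Sum>z\<in>Z. \<nu> y z *\<^sub>R z) \<and> sum (\<nu> y) Z = 1 \<and> (\<forall>z\<in>Z. 0 \<le> \<nu> y z)"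
      by blast
    then show "y \<in> convex hull Z"
      unfolding convex_hull_finite[OF Z] by (intro CollectI exI[of _ "\<nu> y"]) auto
  qed
  moreover have "openin (top_of_set (affine hull Z)) (affine hull Z \<inter> T)"
    using \<open>open T\<close> by blast
  ultimately have "x \<in> rel_interior (convex hull Z)"
    unfolding rel_interior_def affine_hull_convex_hull using xT xhull by blast
  then show ?thesis unfolding x_def .
qed

section \<open>Orderings with nonnegative partial sums\<close>

fun prefix_nonneg :: "real \<Rightarrow> real list \<Rightarrow> bool" where
  "prefix_nonneg s [] \<longleftrightarrow> 0 \<le> s"
| "prefix_nonneg s (q # qs) \<longleftrightarrow> 0 \<le> s \<and> prefix_nonneg (s + q) qs"

lemma prefix_nonneg_append:
  "prefix_nonneg s (ps @ qs) \<longleftrightarrow> prefix_nonneg s ps \<and> prefix_nonneg (s + sum_list ps) qs"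
  by (induction ps arbitrary: s) (auto simp: add.assoc elim: prefix_nonneg.elims)

fun insertions :: "'a set \<Rightarrow> 'a set list \<Rightarrow> 'a set list list" where
  "insertions A [] = [[A]]"
| "insertions A (Q # Qs) = (A # Q # Qs) # map ((#) Q) (insertions A Qs)"

fun mergings :: "'a set \<Rightarrow> 'a set list \<Rightarrow> 'a set list list" where
  "mergings A [] = []"
| "mergings A (Q # Qs) = ((A \<union> Q) # Qs) # map ((#) Q) (mergings A Qs)"

text \<open>
  If \<open>w A \<ge> 0\<close>, inserting \<open>A\<close> before a block contributes the same as merging it with that block,
  which leaves the insertion at the end; if \<open>w A < 0\<close>, the same holds with \<open>A\<close> after the block.
  For \<open>s = 0\<close> the right-hand side forces \<open>w A = 0\<close>, so an equation is traded for inequalities.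
\<close>

lemma insertions_minus_mergings:
  fixes w :: "'a set \<Rightarrow> real"
  assumes "\<And>Q. Q \<in> set Qs \<Longrightarrow> w (A \<union> Q) = w A + w Q"
    and "s + w A + sum_list (map w Qs) = 0"
  shows "(\<Sum>Rs\<leftarrow>insertions A Qs. of_bool (prefix_nonneg s (map w Rs))) -
      (\<Sum>Rs\<leftarrow>mergings A Qs. of_bool (prefix_nonneg s (map w Rs))) =
    (of_bool (prefix_nonneg (if 0 \<le> w A then s else s + w A) (map w Qs)) :: int)"
  using assms
proof (induction Qs arbitrary: s)
  case Nil
  then show ?case by auto
next
  case (Cons Q Qs)
  define N where "N = (\<lambda>t Rs. of_bool (prefix_nonneg t (map w Rs)) :: int)"
  have N: "N t (R # Rs) = of_bool (0 \<le> t) * N (t + w R) Rs" for t R Rs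
    by (simp add: N_def)
  have IH: "(\<Sum>Rs\<leftarrow>insertions A Qs. N (s + w Q) Rs) - (\<Sum>Rs\<leftarrow>mergings A Qs. N (s + w Q) Rs) =
      N (if 0 \<le> w A then s + w Q else s + w Q + w A) Qs"
    unfolding N_def by (rule Cons.IH) (use Cons.prems in \<open>auto simp: algebra_simps\<close>)
  have "(\<Sum>Rs\<leftarrow>insertions A (Q # Qs). N s Rs) - (\<Sum>Rs\<leftarrow>mergings A (Q # Qs). N s Rs) =
      of_bool (0 \<le> s) * (of_bool (0 \<le> s + w A) * N (s + w A + w Q) Qs) -
      of_bool (0 \<le> s) * N (s + w A + w Q) Qs +
      of_bool (0 \<le> s) * ((\<Sum>Rs\<leftarrow>insertions A Qs. N (s + w Q) Rs) - (\<Sum>Rs\<leftarrow>mergings A Qs. N (s + w Q) Rs))"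
    using Cons.prems(1)[of Q]
    by (simp add: N o_def sum_list_const_mult right_diff_distrib add.assoc)
  \<comment> \<open>For \<open>0 \<le> w A\<close> the first two terms cancel, as the extra
    condition \<open>0 \<le> s + w A\<close> is implied. For \<open>w A < 0\<close> the merging term
    cancels against the value of the induction hypothesis, and \<open>0 \<le> s + w A\<close>
    implies \<open>0 \<le> s\<close>.\<close>
  also have "\<dots> = N (if 0 \<le> w A then s else s + w A) (Q # Qs)"
    unfolding IH by (auto simp: N algebra_simps)
  finally show ?case unfolding N_def .
qed

section \<open>Cutting a list at the last minimum of its partial sums\<close>

definition strict_above :: "('a \<Rightarrow> real) \<Rightarrow> 'a list \<Rightarrow> bool" where
  "strict_above y v \<longleftrightarrow> (\<forall>s t. v = s @ t \<longrightarrow> s \<noteq> [] \<longrightarrow> 0 < sum_list (map y s))"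

text \<open>Together with \<open>strict_above y v\<close>, this says that the partial sums of
  \<open>u @ v\<close> attain their minimum for the last time after \<open>u\<close>.\<close>

definition end_minimal :: "('a \<Rightarrow> real) \<Rightarrow> 'a list \<Rightarrow> bool" where
  "end_minimal y u \<longleftrightarrow> (\<forall>s t. u = s @ t \<longrightarrow> sum_list (map y u) \<le> sum_list (map y s))"

lemma ex_last_minimum:
  "\<exists>u v. zs = u @ v \<and> end_minimal y u \<and> strict_above y v"
proof (induction zs rule: rev_induct)
  case Nil
  show ?case by (auto simp: end_minimal_def strict_above_def)
next
  case (snoc q zs)
  then obtain u v where uv: "zs = u @ v" "end_minimal y u" "strict_above y v" by blast
  show ?case
  proof (cases "0 < sum_list (map y v) + y q")
    case True
    have "strict_above y (v @ [q])"
      unfolding strict_above_def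
    proof (intro allI impI)
      fix s t assume "v @ [q] = s @ t" "s \<noteq> []"
      then show "0 < sum_list (map y s)"
        using True uv(3) by (cases t rule: rev_cases) (auto simp: strict_above_def)
    qed
    then show ?thesis using uv by (intro exI[of _ u] exI[of _ "v @ [q]"]) auto
  next
    case False
    have "end_minimal y (zs @ [q])"
      unfolding end_minimal_def
    proof (intro allI impI)
      fix s t assume st: "zs @ [q] = s @ t"
      have le: "sum_list (map y (zs @ [q])) \<le> sum_list (map y u)" using False uv by simp
      consider "s = zs @ [q]" | r where "u = s @ r" | r where "s = u @ r" "\<exists>r'. v = r @ r'"
        using st uv by (auto simp: append_eq_append_conv2 append_eq_Cons_conv Cons_eq_append_conv)
      then show "sum_list (map y (zs @ [q])) \<le> sum_list (map y s)"
      proof cases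
        case (2 r)
        then have "sum_list (map y u) \<le> sum_list (map y s)"
          using uv(2) unfolding end_minimal_def by blast
        with le show ?thesis by (rule order_trans)
      next
        case (3 r)
        then have "0 \<le> sum_list (map y r)" using uv(3) by (cases "r = []") (auto simp: strict_above_def less_imp_le)
        then show ?thesis using 3 le by simp
      qed simp
    qed
    then show ?thesis by (intro exI[of _ "zs @ [q]"] exI[of _ "[]"]) (auto simp: strict_above_def)
  qed
qed

text \<open>Two different cuts would enclose a nonempty segment whose sum is positive by the earlier
  cut and at most 0 by the later one.\<close>

lemma last_minimum_unique:
  assumes "u @ v = u' @ v'" "end_minimal y u" "strict_above y v" "end_minimal y u'" "strict_above y v'"
  shows "u = u' \<and> v = v'"
proof -
  have *: "t = []" if "u' = u @ t" "v = t @ v'" "end_minimal y u'" "strict_above y v" for u u' t v v'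
  proof (rule ccontr)
    assume "t \<noteq> []"
    then have "0 < sum_list (map y t)" using that by (auto simp: strict_above_def)
    moreover have "sum_list (map y u') \<le> sum_list (map y u)" using that by (auto simp: end_minimal_def)
    ultimately show False using that by simp
  qed
  from assms(1) show ?thesis
    by (auto simp: append_eq_append_conv2 dest: *[OF _ _ assms(4,3)] *[OF _ _ assms(2,5)])
qed

lemma prefix_nonneg_iff_append:
  "prefix_nonneg b (map y qs) \<longleftrightarrow> (\<forall>s t. qs = s @ t \<longrightarrow> 0 \<le> b + sum_list (map y s))"
proof (induction qs arbitrary: b)
  case (Cons q qs)
  have "(\<forall>s t. q # qs = s @ t \<longrightarrow> P s) \<longleftrightarrow> P [] \<and> (\<forall>s t. qs = s @ t \<longrightarrow> P (q # s))" for P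
    by (fastforce simp: Cons_eq_append_conv)
  then show ?case
    by (simp add: Cons.IH add.assoc)
qed simp

lemma prefix_nonneg_iff_take:
  "prefix_nonneg b (map y qs) \<longleftrightarrow> (\<forall>i\<le>length qs. 0 \<le> b + sum_list (map y (take i qs)))"
  unfolding prefix_nonneg_iff_append
  by (metis append_eq_conv_conj append_take_drop_id le_cases take_all length_append le_add1)

lemma end_minimal_if_prefix_nonneg:
  assumes "prefix_nonneg 0 (map y c)" "sum_list (map y c) = 0"
  shows "end_minimal y c"
  using assms by (auto simp: end_minimal_def prefix_nonneg_iff_append)

lemma prefix_nonneg_if_strict_above: "strict_above y v \<Longrightarrow> prefix_nonneg 0 (map y v)"
  unfolding prefix_nonneg_iff_append strict_above_def by (metis less_le order_refl add_0 list.map(1) sum_list.Nil)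

definition nonneg_orderings :: "('a \<Rightarrow> real) \<Rightarrow> 'a set \<Rightarrow> 'a list set" where
  "nonneg_orderings y W = {ws \<in> permutations_of_set W. prefix_nonneg 0 (map y ws)}"

lemma finite_nonneg_orderings [simp]: "finite (nonneg_orderings y W)"
  by (simp add: nonneg_orderings_def)

text \<open>
  Cut an ordering after the last partial sum 0 before \<open>w\<close>. The part behind the cut runs through the
  set \<open>B\<close>, and is a rotation of an arbitrary ordering of \<open>B\<close> that starts with \<open>w\<close>: the rotation
  is recovered by starting at the last minimum of the partial sums.
\<close>

lemma card_nonneg_orderings_rec:
  assumes W: "finite W" "w \<in> W" and zero: "sum y W = 0"
  shows "card (nonneg_orderings y W) =
    (\<Sum>B | B \<subseteq> W \<and> w \<in> B \<and> sum y B = 0. fact (card B - 1) * card (nonneg_orderings y (W - B)))"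
proof -
  \<comment> \<open>In \<open>G\<close> an ordering is cut into \<open>c @ v @ w # u\<close>, with
    \<open>c\<close> ending at the last zero before \<open>w\<close>; in \<open>H\<close> the rest
    is rotated to \<open>w # e\<close> with \<open>e = u @ v\<close>. Since the total is 0, the
    partial sums along \<open>u\<close> start at minus the sum of \<open>u\<close>, so they are
    nonnegative iff \<open>u\<close> ends at its minimum.\<close>
  define G where "G = {(c, u, v). set (c @ v @ w # u) = W \<and> distinct (c @ v @ w # u) \<and>
    prefix_nonneg 0 (map y c) \<and> sum_list (map y c) = 0 \<and> end_minimal y u \<and> strict_above y v}"
  define H where "H = {(c, e). set (c @ w # e) = W \<and> distinct (c @ w # e) \<and>
    prefix_nonneg 0 (map y c) \<and> sum_list (map y c) = 0}"
  have total: "sum_list (map y zs) = 0" if "set zs = W" "distinct zs" for zs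
    using that zero by (simp add: sum_list_distinct_conv_sum_set)
  have "bij_betw (\<lambda>(c, u, v). c @ v @ w # u) G (nonneg_orderings y W)"
    unfolding bij_betw_def
  proof
    show "inj_on (\<lambda>(c, u, v). c @ v @ w # u) G"
    proof (rule inj_onI)
      fix p p' assume "p \<in> G" "p' \<in> G" "(\<lambda>(c, u, v). c @ v @ w # u) p = (\<lambda>(c, u, v). c @ v @ w # u) p'"
      then obtain c u v c' u' v' where p: "p = (c, u, v)" "p' = (c', u', v')"
        and G: "(c, u, v) \<in> G" "(c', u', v') \<in> G" and eq: "c @ v @ w # u = c' @ v' @ w # u'"
        by (cases p, cases p') auto
      have "w \<notin> set (c @ v)" "w \<notin> set u" using G by (auto simp: G_def)
      then have 1: "c @ v = c' @ v' \<and> u = u'"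
        using eq append_Cons_eq_iff[of w "c @ v" u "c' @ v'" u'] by auto
      have "c = c' \<and> v = v'"
        by (rule last_minimum_unique[of c v c' v' y])
           (use 1 G in \<open>auto simp: G_def end_minimal_if_prefix_nonneg\<close>)
      with 1 show "p = p'" by (simp add: p)
    qed
    show "(\<lambda>(c, u, v). c @ v @ w # u) ` G = nonneg_orderings y W"
    proof (intro equalityI subsetI)
      fix ws assume "ws \<in> (\<lambda>(c, u, v). c @ v @ w # u) ` G"
      then obtain c u v where ws: "ws = c @ v @ w # u" and G: "(c, u, v) \<in> G" by auto
      have sum: "sum_list (map y v) + y w + sum_list (map y u) = 0"
        using total[of ws] G ws by (simp add: G_def add.assoc)
      have "prefix_nonneg (- sum_list (map y u)) (map y u)"
        using G by (simp add: prefix_nonneg_iff_append G_def end_minimal_def)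
      moreover have "- sum_list (map y u) = sum_list (map y v) + y w" using sum by simp
      moreover have v: "prefix_nonneg 0 (map y v)"
        using G by (simp add: G_def prefix_nonneg_if_strict_above)
      moreover have "0 \<le> sum_list (map y v)"
        using v by (auto simp: prefix_nonneg_iff_append)
      ultimately have "prefix_nonneg 0 (map y ws)"
        using G by (simp add: ws prefix_nonneg_append G_def)
      then show "ws \<in> nonneg_orderings y W"
        using G by (auto simp: nonneg_orderings_def permutations_of_set_def ws G_def)
    next
      fix ws assume ws: "ws \<in> nonneg_orderings y W"
      then have perm: "set ws = W" "distinct ws" and nn: "prefix_nonneg 0 (map y ws)"
        by (auto simp: nonneg_orderings_def permutations_of_set_def)
      then obtain s u where su: "ws = s @ w # u" using W split_list by metis
      obtain c v where cv: "s = c @ v" "end_minimal y c" "strict_above y v"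
        using ex_last_minimum by blast
      have nc: "prefix_nonneg 0 (map y c)" using nn by (simp add: su cv prefix_nonneg_append)
      have "sum_list (map y c) \<le> 0" using cv(2) by (auto simp: end_minimal_def dest: spec[of _ "[]"])
      moreover have "0 \<le> sum_list (map y c)" using nc by (auto simp: prefix_nonneg_iff_append)
      ultimately have c0: "sum_list (map y c) = 0" by simp
      have "prefix_nonneg (sum_list (map y v) + y w) (map y u)"
        using nn c0 by (simp add: su cv prefix_nonneg_append)
      moreover have "sum_list (map y v) + y w = - sum_list (map y u)"
        using total[of ws] perm c0 by (simp add: su cv)
      ultimately have "end_minimal y u"
        by (auto simp: prefix_nonneg_iff_append end_minimal_def)
      then have "(c, u, v) \<in> G" using perm nc c0 cv by (auto simp: G_def su)
      then show "ws \<in> (\<lambda>(c, u, v). c @ v @ w # u) ` G" by (force simp: su cv)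
    qed
  qed
  moreover have "bij_betw (\<lambda>(c, u, v). (c, u @ v)) G H"
    unfolding bij_betw_def
  proof
    show "inj_on (\<lambda>(c, u, v). (c, u @ v)) G"
      by (rule inj_onI) (auto simp: G_def dest: last_minimum_unique)
    show "(\<lambda>(c, u, v). (c, u @ v)) ` G = H"
    proof (intro equalityI subsetI)
      fix p assume "p \<in> H"
      then obtain c e where p: "p = (c, e)" "(c, e) \<in> H" by (cases p) auto
      obtain u v where "e = u @ v" "end_minimal y u" "strict_above y v"
        using ex_last_minimum by blast
      then have "(c, u, v) \<in> G" "p = (c, u @ v)" using p by (auto simp: G_def H_def)
      then show "p \<in> (\<lambda>(c, u, v). (c, u @ v)) ` G" by force
    qed (auto simp: G_def H_def)
  qed
  ultimately have "card (nonneg_orderings y W) = card H" by (metis bij_betw_same_card)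
  also have "H = (\<Union>B\<in>{B. B \<subseteq> W \<and> w \<in> B \<and> sum y B = 0}.
      nonneg_orderings y (W - B) \<times> permutations_of_set (B - {w}))" (is "_ = \<Union>(?F ` ?I)")
  proof (intro equalityI subsetI)
    fix p assume "p \<in> H"
    then obtain c e where p: "p = (c, e)" "(c, e) \<in> H" by (cases p) auto
    define B where "B = insert w (set e)"
    have "sum y (set c) = 0"
      using p by (auto simp: H_def sum_list_distinct_conv_sum_set)
    moreover have "W = set c \<union> B" "set c \<inter> B = {}" using p by (auto simp: H_def B_def)
    ultimately have "sum y B = 0"
      using zero sum.union_disjoint[of "set c" B y] by (simp add: B_def)
    moreover have "c \<in> nonneg_orderings y (W - B)" "e \<in> permutations_of_set (B - {w})"
      using p by (auto simp: H_def B_def nonneg_orderings_def permutations_of_set_def)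
    moreover have "B \<in> ?I" using \<open>sum y B = 0\<close> \<open>W = _\<close> by (auto simp: B_def)
    ultimately show "p \<in> \<Union>(?F ` ?I)" using p by blast
  next
    fix p assume "p \<in> \<Union>(?F ` ?I)"
    then obtain B c e where p: "p = (c, e)" and B: "B \<subseteq> W" "w \<in> B" "sum y B = 0"
      and c: "c \<in> nonneg_orderings y (W - B)" and e: "e \<in> permutations_of_set (B - {w})" by auto
    have "sum y (W - B) = 0" using B zero W by (simp add: sum_diff)
    then have "sum_list (map y c) = 0"
      using c by (auto simp: nonneg_orderings_def permutations_of_set_def sum_list_distinct_conv_sum_set)
    then show "p \<in> H"
      using c e B by (auto simp: p H_def nonneg_orderings_def permutations_of_set_def)
  qed
  also have "card \<dots> = (\<Sum>B\<in>?I. card (?F B))"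
  proof (rule card_UN_disjoint)
    show "finite ?I" using W by simp
    show "\<forall>B\<in>?I. finite (?F B)" by simp
    show "\<forall>B\<in>?I. \<forall>B'\<in>?I. B \<noteq> B' \<longrightarrow> ?F B \<inter> ?F B' = {}"
    proof (intro ballI impI, rule ccontr)
      fix B B' assume B: "B \<in> ?I" "B' \<in> ?I" "B \<noteq> B'" "?F B \<inter> ?F B' \<noteq> {}"
      then obtain e where "set e = B - {w}" "set e = B' - {w}"
        by (auto simp: permutations_of_set_def)
      then show False using B by blast
    qed
  qed
  also have "\<dots> = (\<Sum>B\<in>?I. fact (card B - 1) * card (nonneg_orderings y (W - B)))"
    using W by (intro sum.cong)
      (auto simp: card_cartesian_product mult.commute finite_subset card_Diff_singleton)
  finally show ?thesis .
qed

text \<open>For a partition of a finite set, this is the number of permutations whose cycles have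
  the blocks as their supports: a block \<open>B\<close> carries \<open>fact (card B - 1)\<close>
  cyclic orderings.\<close>

definition cyclic_orderings :: "'a set set \<Rightarrow> nat" where
  "cyclic_orderings \<pi> = (\<Prod>B\<in>\<pi>. fact (card B - 1))"

lemma cyclic_orderings_pos: "finite \<pi> \<Longrightarrow> 0 < cyclic_orderings \<pi>"
  by (auto simp: cyclic_orderings_def intro!: prod_pos)

text \<open>The right-hand side counts the permutations of \<open>W\<close> all of whose cycles have
  sum 0, grouped by their cycle partition. Both sides satisfy the recursion of
  \<open>card_nonneg_orderings_rec\<close>: on the right, \<open>B\<close> is the block containing a
  fixed \<open>w\<close>, and the other blocks partition \<open>W - B\<close>.\<close>

lemma card_nonneg_orderings:
  assumes "finite W" "sum y W = 0"
  shows "card (nonneg_orderings y W) =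
    (\<Sum>\<pi> | partition_on W \<pi>. cyclic_orderings \<pi> * of_bool (\<forall>B\<in>\<pi>. sum y B = 0))"
  using assms
proof (induction "card W" arbitrary: W rule: less_induct)
  case less
  show ?case
  proof (cases "W = {}")
    case True
    have "{ws. ws = [] \<and> prefix_nonneg 0 (map y ws)} = {[]}" by auto
    then show ?thesis using True
      by (simp add: nonneg_orderings_def partition_on_empty[abs_def] cyclic_orderings_def)
  next
    case False
    then obtain w where w: "w \<in> W" by blast
    define I where "I = {B. B \<subseteq> W \<and> w \<in> B}"
    have I: "finite I" using less.prems by (simp add: I_def)
    define h where "h \<pi> = cyclic_orderings \<pi> * of_bool (\<forall>B\<in>\<pi>. sum y B = 0)" for \<pi>
    have h: "h (insert B \<pi>) = of_bool (sum y B = 0) * fact (card B - 1) * h \<pi>"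
      if B: "B \<in> I" and \<pi>: "partition_on (W - B) \<pi>" for B \<pi>
    proof -
      have "finite \<pi>" using \<pi> less.prems by (meson finite_Diff finite_elements)
      moreover have "B \<notin> \<pi>" using \<pi> B by (auto simp: partition_on_def I_def)
      ultimately show ?thesis by (auto simp: h_def cyclic_orderings_def)
    qed
    have "card (nonneg_orderings y W) =
        (\<Sum>B\<in>I. of_bool (sum y B = 0) * (fact (card B - 1) * card (nonneg_orderings y (W - B))))"
      unfolding card_nonneg_orderings_rec[OF less.prems(1) w less.prems(2)]
      using less.prems by (intro sum.mono_neutral_cong_left) (auto simp: I_def)
    also have "\<dots> = (\<Sum>B\<in>I. \<Sum>\<pi> | partition_on (W - B) \<pi>. h (insert B \<pi>))"
    proof (rule sum.cong[OF refl])
      fix B assume B: "B \<in> I"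
      show "of_bool (sum y B = 0) * (fact (card B - 1) * card (nonneg_orderings y (W - B))) =
        (\<Sum>\<pi> | partition_on (W - B) \<pi>. h (insert B \<pi>))"
      proof (cases "sum y B = 0")
        case True
        have "W - B \<subset> W" using B w by (auto simp: I_def)
        then have "card (nonneg_orderings y (W - B)) = (\<Sum>\<pi> | partition_on (W - B) \<pi>. h \<pi>)"
          unfolding h_def using less.prems B True
          by (intro less.hyps) (auto simp: psubset_card_mono sum_diff I_def)
        then show ?thesis using True by (simp add: sum_distrib_left h[OF B] mult.assoc)
      qed (simp add: h[OF B])
    qed
    also have "\<dots> = (\<Sum>(B, \<pi>)\<in>(SIGMA B:I. {\<pi>. partition_on (W - B) \<pi>}). h (insert B \<pi>))"
      using I less.prems by (intro sum.Sigma) (auto simp: finitely_many_partition_on)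
    also have "\<dots> = (\<Sum>\<pi> | partition_on W \<pi>. h \<pi>)"
    proof (rule sum.reindex_bij_witness[of _
          "\<lambda>\<pi>. (THE B. B \<in> \<pi> \<and> w \<in> B, \<pi> - {THE B. B \<in> \<pi> \<and> w \<in> B})" "\<lambda>(B, \<pi>). insert B \<pi>"])
      fix p assume "p \<in> (SIGMA B:I. {\<pi>. partition_on (W - B) \<pi>})"
      then obtain B \<pi> where p: "p = (B, \<pi>)" and B: "B \<in> I" and \<pi>: "partition_on (W - B) \<pi>" by auto
      have part: "partition_on W (insert B \<pi>)"
        using B \<pi> partition_on_insert[of B \<pi> W] by (auto simp: I_def partition_on_def disjnt_def)
      have uniq: "B' = B" if "B' \<in> insert B \<pi> \<and> w \<in> B'" for B'
        using part that B by (auto simp: partition_on_def disjoint_def I_def)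
      have the: "(THE B'. B' \<in> insert B \<pi> \<and> w \<in> B') = B"
        by (rule the_equality) (use B uniq in \<open>auto simp: I_def\<close>)
      have "B \<notin> \<pi>" using \<pi> B by (auto simp: partition_on_def I_def)
      then show "(THE B'. B' \<in> (case p of (B, \<pi>) \<Rightarrow> insert B \<pi>) \<and> w \<in> B',
          (case p of (B, \<pi>) \<Rightarrow> insert B \<pi>) - {THE B'. B' \<in> (case p of (B, \<pi>) \<Rightarrow> insert B \<pi>) \<and> w \<in> B'}) = p"
        unfolding p prod.case the by simp
      show "(case p of (B, \<pi>) \<Rightarrow> insert B \<pi>) \<in> {\<pi>. partition_on W \<pi>}"
        using part by (simp add: p)
    next
      fix \<pi> assume "\<pi> \<in> {\<pi>. partition_on W \<pi>}"
      then have \<pi>: "partition_on W \<pi>" by simp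
      then obtain B where B: "B \<in> \<pi>" "w \<in> B" using w by (auto simp: partition_on_def)
      have uniq: "B' = B" if "B' \<in> \<pi> \<and> w \<in> B'" for B'
        using \<pi> that B by (auto simp: partition_on_def disjoint_def)
      have the: "(THE B'. B' \<in> \<pi> \<and> w \<in> B') = B"
        by (rule the_equality) (use B uniq in blast)+
      have 1: "insert B (\<pi> - {B}) = \<pi>" using B by auto
      show "(case (THE B. B \<in> \<pi> \<and> w \<in> B, \<pi> - {THE B. B \<in> \<pi> \<and> w \<in> B}) of (B, \<pi>) \<Rightarrow> insert B \<pi>) = \<pi>"
        unfolding the prod.case by (rule 1)
      have "disjnt B (\<Union>(\<pi> - {B}))"
        using \<pi> B(1) by (auto simp: partition_on_def disjoint_def disjnt_def)
      then have "partition_on (W - B) (\<pi> - {B})" "B \<subseteq> W"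
        using partition_on_insert[of B "\<pi> - {B}" W] \<pi> 1 by auto
      then show "(THE B. B \<in> \<pi> \<and> w \<in> B, \<pi> - {THE B. B \<in> \<pi> \<and> w \<in> B}) \<in> (SIGMA B:I. {\<pi>. partition_on (W - B) \<pi>})"
        unfolding the using B by (auto simp: I_def)
    qed auto
    finally show ?thesis unfolding h_def .
  qed
qed

section \<open>Gale order and Schubert matroids\<close>

lemma sorted_list_of_set_nth_le_iff:
  fixes A :: "'a::linorder set"
  assumes A: "finite A" and i: "i < card A"
  shows "sorted_list_of_set A ! i \<le> j \<longleftrightarrow> i < card (A \<inter> {..j})"
proof -
  define xs where "xs = sorted_list_of_set A"
  define D where "D = {i. i < length xs \<and> xs ! i \<le> j}"
  have xs: "set xs = A" "distinct xs" "sorted xs" "length xs = card A"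
    using A by (simp_all add: xs_def)
  have "bij_betw ((!) xs) D (A \<inter> {..j})"
    unfolding bij_betw_def D_def using xs
    by (auto simp: inj_on_def nth_eq_iff_index_eq set_conv_nth)
  then have card: "card D = card (A \<inter> {..j})" by (rule bij_betw_same_card)
  have "finite D" by (simp add: D_def)
  have down: "i' \<in> D" if "i \<in> D" "i' \<le> i" for i i'
    using that xs(3) by (force simp: D_def dest: sorted_nth_mono)
  show ?thesis
  proof (cases "i \<in> D")
    case True
    then have "{..i} \<subseteq> D" using down by auto
    then have "i < card D" using card_mono[OF \<open>finite D\<close>, of "{..i}"] by simp
    then show ?thesis using True card by (simp add: D_def xs_def)
  next
    case False
    then have "D \<subseteq> {..<i}" using down by (meson lessThan_iff linorder_not_le subsetI)
    then have "card D \<le> i" using card_mono[of "{..<i}" D] by simp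
    then show ?thesis using False i xs(4) card by (auto simp: D_def xs_def)
  qed
qed

text \<open>This counting form of the Gale order is used from here on, because prefix counts become
  partial sums of coordinates at the vertices of the polytope.\<close>

lemma SM_iff:
  assumes "finite S"
  shows "T \<in> SM m S \<longleftrightarrow>
    T \<subseteq> {1..m} \<and> card T = card S \<and> (\<forall>j. card (S \<inter> {..j}) \<le> card (T \<inter> {..j}))"
proof -
  have "(\<forall>i<card S. sorted_list_of_set T ! i \<le> sorted_list_of_set S ! i) \<longleftrightarrow>
      (\<forall>j. card (S \<inter> {..j}) \<le> card (T \<inter> {..j}))" (is "?L \<longleftrightarrow> ?R")
    if T: "T \<subseteq> {1..m}" "card T = card S"
  proof -
    have "finite T" using T by (auto intro: finite_subset)
    note T_iff = sorted_list_of_set_nth_le_iff[OF this] and S_iff = sorted_list_of_set_nth_le_iff[OF assms]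
    show ?thesis
    proof
      assume L: ?L
      show ?R
      proof (intro allI)
        fix j
        show "card (S \<inter> {..j}) \<le> card (T \<inter> {..j})"
        proof (cases "card (S \<inter> {..j})")
          case (Suc i)
          then have "i < card S" using card_mono[of S "S \<inter> {..j}"] assms by simp
          then have "sorted_list_of_set T ! i \<le> j"
            using L S_iff[of i j] Suc by (metis lessI order_trans)
          then show ?thesis using T_iff[of i j] \<open>i < card S\<close> T Suc by simp
        qed simp
      qed
    next
      assume R: ?R
      show ?L
      proof (intro allI impI)
        fix i assume i: "i < card S"
        then have "i < card (S \<inter> {..sorted_list_of_set S ! i})" using S_iff by blast
        also have "\<dots> \<le> card (T \<inter> {..sorted_list_of_set S ! i})" using R by blast
        finally show "sorted_list_of_set T ! i \<le> sorted_list_of_set S ! i"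
          using T_iff i T by simp
      qed
    qed
  qed
  then show ?thesis by (auto simp: SM_def)
qed

lemma self_in_SM: "S \<subseteq> {1..m} \<Longrightarrow> S \<in> SM m S"
  by (simp add: SM_def)

lemma is_matroid_SM:
  assumes S: "S \<subseteq> {1..m}"
  shows "is_matroid {1..m} (SM m S)"
  unfolding is_matroid_def
proof (intro conjI ballI)
  have "finite S" using S by (rule finite_subset) simp
  note iff = SM_iff[OF this]
  show "SM m S \<noteq> {}" using self_in_SM[OF S] by blast
  show "B \<subseteq> {1..m}" if "B \<in> SM m S" for B using that by (simp add: iff)
  fix B B' x assume B: "B \<in> SM m S" and B': "B' \<in> SM m S" and x: "x \<in> B - B'"
  have fin: "finite B" "finite B'" using B B' by (auto simp: iff intro: finite_subset)
  have card: "card B = card S" "card B' = card S" using B B' by (auto simp: iff)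
  have "B' - B \<noteq> {}"
    using x card fin by (metis DiffD1 DiffD2 Diff_eq_empty_iff card_subset_eq)
  \<comment> \<open>The smallest candidate is safe: a prefix that loses \<open>x\<close> without
    gaining \<open>y\<close> still contains all of \<open>B'\<close> up to that position, and
    \<open>B'\<close> satisfies the bounds.\<close>
  then obtain y where y: "y \<in> B' - B" and min: "\<And>z. z \<in> B' - B \<Longrightarrow> y \<le> z"
    using fin by (metis Min_in Min_le finite_Diff)
  have "card (S \<inter> {..j}) \<le> card (insert y (B - {x}) \<inter> {..j})" for j
  proof -
    consider "x \<le> j" "j < y" | "x \<le> j" "y \<le> j" | "j < x" by linarith
    then show ?thesis
    proof cases
      case 1
      have "B' \<inter> {..j} \<subseteq> insert y (B - {x}) \<inter> {..j}"
      proof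
        fix z assume z: "z \<in> B' \<inter> {..j}"
        then have "z \<in> B" using min[of z] 1 by force
        then show "z \<in> insert y (B - {x}) \<inter> {..j}" using z x by auto
      qed
      then have "card (B' \<inter> {..j}) \<le> card (insert y (B - {x}) \<inter> {..j})"
        using fin by (intro card_mono) auto
      then show ?thesis using B' iff by (meson order_trans)
    next
      case 2
      have "insert y (B - {x}) \<inter> {..j} = insert y (B \<inter> {..j} - {x})" using 2 by auto
      then have "card (insert y (B - {x}) \<inter> {..j}) = card (B \<inter> {..j})"
        using 2 x y fin card_Suc_Diff1[of "B \<inter> {..j}" x] by simp
      then show ?thesis using B iff by simp
    next
      case 3
      then have "B \<inter> {..j} \<subseteq> (insert y (B - {x})) \<inter> {..j}" by auto
      then have "card (B \<inter> {..j}) \<le> card (insert y (B - {x}) \<inter> {..j})"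
        using fin by (intro card_mono) auto
      then show ?thesis using B iff by (meson order_trans)
    qed
  qed
  moreover have "card (insert y (B - {x})) = card S"
    using x y fin card card_Suc_Diff1[of B x] by simp
  ultimately have "insert y (B - {x}) \<in> SM m S"
    using B B' y by (auto simp: iff)
  then show "\<exists>y\<in>B' - B. insert y (B - {x}) \<in> SM m S" using y by blast
qed simp

lemma is_matroid_image:
  assumes f: "bij_betw f E E'" and M: "is_matroid E M"
  shows "is_matroid E' ((\<lambda>B. f ` B) ` M)"
  unfolding is_matroid_def
proof (intro conjI ballI)
  have sub: "B \<subseteq> E" if "B \<in> M" for B using M that by (auto simp: is_matroid_def)
  have inj: "inj_on f E" and img: "f ` E = E'" using f by (auto simp: bij_betw_def)
  show "finite E'" using f M by (auto simp: is_matroid_def bij_betw_finite)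
  show "(\<lambda>B. f ` B) ` M \<noteq> {}" using M by (auto simp: is_matroid_def)
  show "B \<subseteq> E'" if "B \<in> (\<lambda>B. f ` B) ` M" for B using that sub img by blast
  fix C C' z assume "C \<in> (\<lambda>B. f ` B) ` M" "C' \<in> (\<lambda>B. f ` B) ` M" "z \<in> C - C'"
  then obtain B B' x where C: "C = f ` B" "C' = f ` B'" "B \<in> M" "B' \<in> M" "z = f x" "x \<in> B - B'"
    by blast
  then obtain y where y: "y \<in> B' - B" "insert y (B - {x}) \<in> M"
    using M unfolding is_matroid_def by blast
  have "y \<in> E" using y sub[OF C(4)] by blast
  then have "f y \<in> C' - C"
    using y C sub[OF C(3)] sub[OF C(4)] by (auto simp: inj_on_image_mem_iff[OF inj])
  moreover have "insert (f y) (C - {z}) = f ` insert y (B - {x})"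
    using C sub[OF C(3)] inj_on_image_set_diff[OF inj, of B "{x}"] by auto
  then have "insert (f y) (C - {z}) \<in> (\<lambda>B. f ` B) ` M" using y(2) by blast
  ultimately show "\<exists>y\<in>C' - C. insert y (C - {z}) \<in> (\<lambda>B. f ` B) ` M" by blast
qed

text \<open>The elements of \<open>U\<close> are lighter than the others, so this is Gale optimality of the greedy basis.\<close>

lemma card_Int_le_if_min_weight:
  fixes u :: "'a \<Rightarrow> real"
  assumes M: "is_matroid E M" and card: "\<And>B. B \<in> M \<Longrightarrow> card B = k"
    and B0: "B0 \<in> M" and min: "\<And>B. B \<in> M \<Longrightarrow> sum u B0 \<le> sum u B"
    and U: "\<And>x y. x \<in> E - U \<Longrightarrow> y \<in> E \<inter> U \<Longrightarrow> u y < u x"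
    and T: "T \<in> M"
  shows "card (T \<inter> U) \<le> card (B0 \<inter> U)"
proof (rule ccontr)
  have fin: "finite B" if "B \<in> M" for B
    using M that unfolding is_matroid_def by (meson finite_subset)
  have sub: "B \<subseteq> E" if "B \<in> M" for B using M that by (auto simp: is_matroid_def)
  have ex: "\<exists>y\<in>B' - B. insert y (B - {x}) \<in> M" if "B \<in> M" "B' \<in> M" "x \<in> B - B'" for B B' x
    using M that unfolding is_matroid_def by blast
  define X where "X = {T \<in> M. card (B0 \<inter> U) < card (T \<inter> U)}"
  assume "\<not> card (T \<inter> U) \<le> card (B0 \<inter> U)"
  then have "T \<in> X" using T by (simp add: X_def)
  \<comment> \<open>Take a counterexample with maximal overlap with \<open>B0\<close>. An element of
    \<open>T - B0\<close> outside of \<open>U\<close> could be exchanged for one of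
    \<open>B0\<close>, giving a counterexample with larger overlap; so \<open>T - B0\<close> lies in
    \<open>U\<close>.\<close>
  obtain T where T: "T \<in> X" and max: "\<And>T'. T' \<in> X \<Longrightarrow> card (T' \<inter> B0) \<le> card (T \<inter> B0)"
    using ex_has_greatest_nat[of "\<lambda>T. T \<in> X" T "\<lambda>T. card (T \<inter> B0)" "Suc (card B0)"] \<open>T \<in> X\<close>
    by (metis Int_lower2 B0 card_mono fin less_Suc_eq_le)
  have TM: "T \<in> M" and TU: "card (B0 \<inter> U) < card (T \<inter> U)" using T by (auto simp: X_def)
  have TB0U: "T - B0 \<subseteq> U"
  proof (rule ccontr)
    assume "\<not> T - B0 \<subseteq> U"
    then obtain x where x: "x \<in> T - B0" "x \<notin> U" by blast
    then obtain y where y: "y \<in> B0 - T" "insert y (T - {x}) \<in> M" using ex[OF TM B0] by blast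
    have "card (T \<inter> U) \<le> card (insert y (T - {x}) \<inter> U)"
      using x fin[OF TM] by (intro card_mono) auto
    then have "insert y (T - {x}) \<in> X" using y TU by (simp add: X_def)
    moreover have "insert y (T - {x}) \<inter> B0 = insert y (T \<inter> B0)" using x y by auto
    then have "card (insert y (T - {x}) \<inter> B0) = Suc (card (T \<inter> B0))" using y fin[OF TM] by simp
    ultimately show False using max by fastforce
  qed
  have "card B0 = card (B0 \<inter> U) + card (B0 - U)" "card T = card (T \<inter> U) + card (T - U)"
    using fin[OF B0] fin[OF TM] by (metis Int_Diff_Un Int_Diff_disjoint card_Un_disjoint finite_Diff finite_Int)+
  \<comment> \<open>Hence some \<open>z\<close> of \<open>B0 - T\<close> is outside of
    \<open>U\<close>, while everything that can replace it comes from \<open>T - B0\<close> and is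
    lighter. The exchange contradicts the minimality of \<open>B0\<close>.\<close>
  then have "card (T - U) < card (B0 - U)" using TU card[OF B0] card[OF TM] by linarith
  then have "\<not> B0 - U \<subseteq> T - U" using card_mono[of "T - U" "B0 - U"] fin[OF TM] by auto
  then obtain z where z: "z \<in> B0 - T" "z \<notin> U" by blast
  then obtain w where w: "w \<in> T - B0" "insert w (B0 - {z}) \<in> M" using ex[OF B0 TM] by blast
  have "u w < u z" using w z TB0U sub B0 TM by (intro U) auto
  moreover have "sum u (insert w (B0 - {z})) = sum u B0 + u w - u z"
    using w z fin[OF B0] by (simp add: sum_diff1)
  ultimately show False using min[OF w(2)] by linarith
qed

text \<open>
  The smallest function above \<open>a\<close> that starts at 0 and increases by at most 1 in each step
  counts the elements of the set \<open>S\<close>.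
\<close>

lemma ex_SM_eq:
  fixes a :: "nat \<Rightarrow> nat"
  assumes a: "\<And>i. i \<le> m \<Longrightarrow> a i \<le> i" "\<And>i. i \<le> m \<Longrightarrow> a i \<le> a m"
  shows "\<exists>S\<subseteq>{1..m}. card S = a m \<and>
    SM m S = {T. T \<subseteq> {1..m} \<and> card T = a m \<and> (\<forall>i\<le>m. a i \<le> card (T \<inter> {..i}))}"
proof -
  \<comment> \<open>At most \<open>i - j\<close> elements lie between positions \<open>j\<close> and
    \<open>i\<close>, so the demand at \<open>i\<close> forces \<open>a i - (i - j)\<close> elements
    up to \<open>j\<close>. Truncated subtraction covers \<open>i \<le> j\<close> as well, where the
    term is \<open>a i\<close> itself.\<close>
  define c where "c j = Max ((\<lambda>i. a i - (i - j)) ` {..m})" for j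
  have c_ge: "a i - (i - j) \<le> c j" if "i \<le> m" for i j
    unfolding c_def using that by (intro Max_ge) auto
  have c_le: "c j \<le> b" if "\<And>i. i \<le> m \<Longrightarrow> a i - (i - j) \<le> b" for j b
    unfolding c_def using that by (subst Max_le_iff) auto
  have c0: "c 0 = 0" using c_le[of 0 0] a(1) by auto
  have cm: "c m = a m" using c_le[of m "a m"] c_ge[of m m] a(2) by (auto intro!: antisym)
  have step: "c j \<le> c (Suc j) \<and> c (Suc j) \<le> Suc (c j)" for j
  proof
    show "c j \<le> c (Suc j)"
      using c_ge[of _ "Suc j"] by (intro c_le) (meson diff_le_mono2 le_SucI order_refl order_trans)
    show "c (Suc j) \<le> Suc (c j)"
    proof (rule c_le)
      fix i assume "i \<le> m"
      then show "a i - (i - Suc j) \<le> Suc (c j)" using c_ge[of i j] by linarith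
    qed
  qed
  define S where "S = {j \<in> {1..m}. c (j - 1) < c j}"
  have "finite S" by (simp add: S_def)
  have S: "card (S \<inter> {..j}) = c j" if "j \<le> m" for j
    using that
  proof (induction j)
    case 0
    have "S \<inter> {..0} = {}" by (auto simp: S_def)
    then show ?case by (simp add: c0)
  next
    case (Suc j)
    have "S \<inter> {..Suc j} = (if c j < c (Suc j) then insert (Suc j) (S \<inter> {..j}) else S \<inter> {..j})"
      using Suc.prems by (auto simp: S_def le_Suc_eq)
    moreover have "Suc j \<notin> S \<inter> {..j}" by simp
    ultimately show ?case using Suc step[of j] \<open>finite S\<close> by auto
  qed
  have Sm: "S \<inter> {..m} = S" by (auto simp: S_def)
  have card: "card S = a m" using S[of m] cm Sm by simp
  have "(\<forall>j. card (S \<inter> {..j}) \<le> card (T \<inter> {..j})) \<longleftrightarrow> (\<forall>i\<le>m. a i \<le> card (T \<inter> {..i}))"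
    if T: "T \<subseteq> {1..m}" "card T = a m" for T
  proof
    assume L: "\<forall>j. card (S \<inter> {..j}) \<le> card (T \<inter> {..j})"
    show "\<forall>i\<le>m. a i \<le> card (T \<inter> {..i})"
    proof (intro allI impI)
      fix i assume "i \<le> m"
      then have "a i \<le> card (S \<inter> {..i})" using c_ge[of i i] S by simp
      then show "a i \<le> card (T \<inter> {..i})" using L by (meson order_trans)
    qed
  next
    assume R: "\<forall>i\<le>m. a i \<le> card (T \<inter> {..i})"
    have finT: "finite T" using T(1) by (rule finite_subset) simp
    have small: "card (S \<inter> {..j}) \<le> card (T \<inter> {..j})" if j: "j \<le> m" for j
      unfolding S[OF j]
    proof (rule c_le)
      fix i assume i: "i \<le> m"
      have "card (T \<inter> {..i}) \<le> card ((T \<inter> {..j}) \<union> {j<..i})"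
        using finT by (intro card_mono) auto
      also have "\<dots> \<le> card (T \<inter> {..j}) + (i - j)"
        using card_Un_le[of "T \<inter> {..j}" "{j<..i}"] by simp
      finally show "a i - (i - j) \<le> card (T \<inter> {..j})" using R i by fastforce
    qed
    show "\<forall>j. card (S \<inter> {..j}) \<le> card (T \<inter> {..j})"
    proof
      fix j
      show "card (S \<inter> {..j}) \<le> card (T \<inter> {..j})"
      proof (cases "j \<le> m")
        case False
        then have "S \<inter> {..j} = S" "T \<inter> {..j} = T" using T by (auto simp: S_def)
        then show ?thesis using card T by simp
      qed (rule small)
    qed
  qed
  then have "SM m S = {T. T \<subseteq> {1..m} \<and> card T = a m \<and> (\<forall>i\<le>m. a i \<le> card (T \<inter> {..i}))}"
    unfolding set_eq_iff SM_iff[OF \<open>finite S\<close>] card mem_Collect_eq by blast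
  moreover have "S \<subseteq> {1..m}" by (auto simp: S_def)
  ultimately show ?thesis using card by blast
qed

text \<open>The weights decrease with the position, so moving elements to the left only adds weight:
  \<open>S\<close> is a lightest basis of its Schubert matroid.\<close>

lemma sum_power_minus_le_SM:
  assumes "T \<in> SM m S" "finite S"
  shows "(\<Sum>s\<in>S. (2::real) ^ (m - s)) \<le> (\<Sum>t\<in>T. 2 ^ (m - t))"
proof -
  have *: "(\<Sum>a\<in>A. (2::real) ^ (m - a)) = (\<Sum>i<card A. 2 ^ (m - sorted_list_of_set A ! i))" if "finite A" for A
  proof (rule sum.reindex_bij_betw[symmetric])
    show "bij_betw ((!) (sorted_list_of_set A)) {..<card A} A"
      using that by (intro bij_betw_nth) auto
  qed
  have "finite T" using assms by (auto simp: SM_def intro: finite_subset)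
  then show ?thesis
    using assms by (auto simp: * SM_def intro!: sum_mono power_increasing)
qed

text \<open>Binary expansions: distinct powers of two as weights make a set recoverable from its
  total weight.\<close>

lemma sum_power_eq_iff:
  assumes "finite A" "finite B" "inj_on g (A \<union> B)"
  shows "(\<Sum>a\<in>A. (2::real) ^ g a) = (\<Sum>b\<in>B. 2 ^ g b) \<longleftrightarrow> A = B"
proof -
  have *: "(\<Sum>a\<in>A. (2::real) ^ g a) = real (set_encode (g ` A))" if "inj_on g A" for A
    using that by (simp add: set_encode_def sum.reindex)
  have "inj_on g A" "inj_on g B" using assms(3) by (auto intro: inj_on_subset)
  then have "(\<Sum>a\<in>A. (2::real) ^ g a) = (\<Sum>b\<in>B. 2 ^ g b) \<longleftrightarrow> g ` A = g ` B"
    using assms by (simp add: * set_encode_eq)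
  also have "\<dots> \<longleftrightarrow> A = B" using assms(3) by (simp add: inj_on_Un_image_eq_iff)
  finally show ?thesis .
qed

section \<open>Integrality of chain polytopes\<close>

definition vertex :: "nat set \<Rightarrow> (nat \<Rightarrow>\<^sub>0 real)" where
  "vertex B = (\<Sum>b\<in>B. Poly_Mapping.single b 1)"

lemma lookup_vertex: "finite B \<Longrightarrow> Poly_Mapping.lookup (vertex B) i = of_bool (i \<in> B)"
  by (simp add: vertex_def lookup_sum lookup_single when_def)

lemma matroid_polytope_eq: "matroid_polytope M = convex hull (vertex ` M)"
  by (simp add: matroid_polytope_def vertex_def[abs_def])

lemma sum_lookup_vertex:
  assumes "finite B" "finite C"
  shows "(\<Sum>c\<in>C. Poly_Mapping.lookup (vertex B) c) = card (B \<inter> C)"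
  using assms by (simp add: lookup_vertex Int_commute)

text \<open>
  All fractional partial sums are moved by the same amount, up and down, until another one
  becomes integral.
\<close>

lemma rounding:
  fixes X :: "nat \<Rightarrow> real" and f :: "nat \<Rightarrow> nat"
  assumes f: "inj_on f {1..m}" and X0: "X 0 = 0"
    and inc: "\<And>j. j < m \<Longrightarrow> X j \<le> X (Suc j) \<and> X (Suc j) \<le> X j + 1"
  shows "(\<Sum>j<m. Poly_Mapping.single (f (Suc j)) (X (Suc j) - X j)) \<in>
    convex hull (vertex ` {T. T \<subseteq> f ` {1..m} \<and>
      (\<forall>j\<le>m. \<lfloor>X j\<rfloor> \<le> int (card (T \<inter> f ` {1..j})) \<and> int (card (T \<inter> f ` {1..j})) \<le> \<lceil>X j\<rceil>)})"
  using X0 inc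
proof (induction "card {j. j \<le> m \<and> X j \<notin> \<int>}" arbitrary: X rule: less_induct)
  case less
  define pt where "pt Y = (\<Sum>j<m. Poly_Mapping.single (f (Suc j)) (Y (Suc j) - Y j))" for Y :: "nat \<Rightarrow> real"
  define V where "V Y = {T. T \<subseteq> f ` {1..m} \<and>
      (\<forall>j\<le>m. \<lfloor>Y j\<rfloor> \<le> int (card (T \<inter> f ` {1..j})) \<and> int (card (T \<inter> f ` {1..j})) \<le> \<lceil>Y j\<rceil>)}"
    for Y :: "nat \<Rightarrow> real"
  define N where "N = {j. j \<le> m \<and> X j \<notin> \<int>}"
  have N: "finite N" by (simp add: N_def)
  show ?case unfolding pt_def[symmetric] V_def[symmetric]
  proof (cases "N = {}")
    case True
    then have int: "X j \<in> \<int>" if "j \<le> m" for j using that by (auto simp: N_def)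
    have jump: "X (Suc j) = X j \<or> X (Suc j) = X j + 1" if "j < m" for j
    proof -
      obtain p q where pq: "X j = of_int p" "X (Suc j) = of_int q"
        using int[of j] int[of "Suc j"] \<open>j < m\<close> by (auto elim!: Ints_cases)
      have "real_of_int p \<le> of_int q" "real_of_int q \<le> of_int (p + 1)"
        using less.prems(2)[OF that] pq by simp_all
      then have "q = p \<or> q = p + 1" unfolding of_int_le_iff by linarith
      then show ?thesis using pq by auto
    qed
    define T where "T = (\<lambda>j. f (Suc j)) ` {j. j < m \<and> X (Suc j) = X j + 1}"
    have inj: "inj_on (\<lambda>j. f (Suc j)) {..<m}"
    proof (rule inj_onI)
      fix j k assume "j \<in> {..<m}" "k \<in> {..<m}" "f (Suc j) = f (Suc k)"
      then show "j = k" using inj_onD[OF f, of "Suc j" "Suc k"] by simp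
    qed
    have "pt X = (\<Sum>j<m. if X (Suc j) = X j + 1 then Poly_Mapping.single (f (Suc j)) 1 else 0)"
      unfolding pt_def
    proof (rule sum.cong)
      fix j assume "j \<in> {..<m}"
      then show "Poly_Mapping.single (f (Suc j)) (X (Suc j) - X j) =
          (if X (Suc j) = X j + 1 then Poly_Mapping.single (f (Suc j)) 1 else 0)"
        using jump[of j] by auto
    qed simp
    also have "\<dots> = (\<Sum>j | j < m \<and> X (Suc j) = X j + 1. Poly_Mapping.single (f (Suc j)) 1)"
      by (simp add: sum.If_cases Int_def)
    also have "\<dots> = vertex T"
      unfolding vertex_def T_def
      by (subst sum.reindex) (auto intro: inj_on_subset[OF inj])
    finally have "pt X = vertex T" .
    moreover have "real (card (T \<inter> f ` {1..j})) = X j" if "j \<le> m" for j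
      using that
    proof (induction j)
      case (Suc j)
      have fin: "finite (T \<inter> f ` {1..j})" by simp
      have "f (Suc j) \<notin> f ` {1..j}"
        using Suc.prems by (subst inj_on_image_mem_iff[OF f]) auto
      moreover have "f (Suc j) \<in> T \<longleftrightarrow> X (Suc j) = X j + 1"
        unfolding T_def using Suc.prems by (subst inj_on_image_mem_iff[OF inj]) auto
      moreover have "f ` {1..Suc j} = insert (f (Suc j)) (f ` {1..j})"
        by (simp add: atLeastAtMostSuc_conv)
      ultimately show ?case
        using Suc jump[of j] by auto
    qed (use less.prems in simp)
    then have "\<lfloor>X j\<rfloor> = card (T \<inter> f ` {1..j})" "\<lceil>X j\<rceil> = card (T \<inter> f ` {1..j})" if "j \<le> m" for j
      using that by (metis floor_of_nat ceiling_of_nat)+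
    then have "T \<in> V X" by (auto simp: V_def T_def)
    ultimately show "pt X \<in> convex hull (vertex ` V X)"
      by (metis hull_inc imageI)
  next
    case False
    \<comment> \<open>The largest amounts by which all fractional partial sums can move up, or down,
      together before one of them reaches an integer.\<close>
    define p where "p = Min ((\<lambda>j. \<lceil>X j\<rceil> - X j) ` N)"
    define q where "q = Min ((\<lambda>j. X j - \<lfloor>X j\<rfloor>) ` N)"
    define Xp where "Xp j = (if X j \<in> \<int> then X j else X j + p)" for j
    define Xq where "Xq j = (if X j \<in> \<int> then X j else X j - q)" for j
    have frac: "\<lfloor>x\<rfloor> < x \<and> x < \<lceil>x\<rceil>" if "x \<notin> \<int>" for x :: real
      using that by (metis Ints_of_int ceiling_correct floor_correct le_less le_of_int_ceiling of_int_floor_le)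
    have p: "p \<le> \<lceil>X j\<rceil> - X j" "q \<le> X j - \<lfloor>X j\<rfloor>" if "j \<in> N" for j
      unfolding p_def q_def using N that by (auto intro: Min_le)
    have "p \<in> (\<lambda>j. \<lceil>X j\<rceil> - X j) ` N" "q \<in> (\<lambda>j. X j - \<lfloor>X j\<rfloor>) ` N"
      unfolding p_def q_def using N False by (auto intro: Min_in)
    then obtain i k where i: "i \<in> N" "p = \<lceil>X i\<rceil> - X i" and k: "k \<in> N" "q = X k - \<lfloor>X k\<rfloor>" by blast
    have pq: "0 < p" "0 < q" using i k frac by (auto simp: N_def)
    have IH: "pt Y \<in> convex hull (vertex ` V X)"
      if Y: "\<And>j. X j \<in> \<int> \<Longrightarrow> Y j = X j" "\<And>j. j \<in> N \<Longrightarrow> \<lfloor>X j\<rfloor> \<le> Y j \<and> Y j \<le> \<lceil>X j\<rceil> \<and> Y j = X j + t"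
        and l: "l \<in> N" "Y l \<in> \<int>" for Y :: "nat \<Rightarrow> real" and t l
    proof -
      have sub: "{j. j \<le> m \<and> Y j \<notin> \<int>} \<subset> N" using Y(1) l by (auto simp: N_def)
      have Y0: "Y 0 = 0" using Y(1)[of 0] less.prems(1) by simp
      have bnd: "\<lfloor>X j\<rfloor> \<le> Y j \<and> Y j \<le> \<lceil>X j\<rceil>" if "j \<le> m" for j
        using Y[of j] that by (cases "X j \<in> \<int>") (auto simp: N_def)
      have Yinc: "Y j \<le> Y (Suc j) \<and> Y (Suc j) \<le> Y j + 1" if j: "j < m" for j
      proof -
        note incj = less.prems(2)[OF j]
        \<comment> \<open>Increments stay in [0, 1]: two fractional sums move together, and next to
          an integral sum the fractional one stays between its floor and ceiling, hence in the same
          unit interval.\<close>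
        consider "X j \<in> \<int>" "X (Suc j) \<in> \<int>" | "j \<in> N" "Suc j \<in> N" | "X j \<in> \<int>" "Suc j \<in> N" | "j \<in> N" "X (Suc j) \<in> \<int>"
          using j by (auto simp: N_def)
        then show ?thesis
        proof cases
          case 3
          then obtain a where a: "X j = of_int a" by (auto elim: Ints_cases)
          have "a \<le> \<lfloor>X (Suc j)\<rfloor>" "\<lceil>X (Suc j)\<rceil> \<le> a + 1"
            using incj a by (auto simp: le_floor_iff ceiling_le_iff)
          then show ?thesis using bnd[of "Suc j"] Y(1)[of j] 3 a j by auto
        next
          case 4
          then obtain a where a: "X (Suc j) = of_int a" by (auto elim: Ints_cases)
          have "\<lceil>X j\<rceil> \<le> a" "a - 1 \<le> \<lfloor>X j\<rfloor>"
            using incj a by (auto simp: le_floor_iff ceiling_le_iff)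
          then show ?thesis using bnd[of j] Y(1)[of "Suc j"] 4 a j by auto
        qed (use Y incj in auto)
      qed
      have "pt Y \<in> convex hull (vertex ` V Y)"
        unfolding pt_def V_def
        using sub Y0 Yinc N by (intro less.hyps) (auto simp: N_def[symmetric] psubset_card_mono)
      moreover have "V Y \<subseteq> V X"
      proof -
        have "\<lfloor>X j\<rfloor> \<le> \<lfloor>Y j\<rfloor>" "\<lceil>Y j\<rceil> \<le> \<lceil>X j\<rceil>" if "j \<le> m" for j
          using bnd[OF that] by (auto simp: le_floor_iff ceiling_le_iff)
        then show ?thesis unfolding V_def by (blast intro: order_trans)
      qed
      ultimately show ?thesis using hull_mono[of "vertex ` V Y" "vertex ` V X" convex] by auto
    qed
    have "pt Xp \<in> convex hull (vertex ` V X)"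
    proof (rule IH[where t = p and l = i])
      show "\<lfloor>X j\<rfloor> \<le> Xp j \<and> Xp j \<le> \<lceil>X j\<rceil> \<and> Xp j = X j + p" if "j \<in> N" for j
        using p[OF that] pq that frac[of "X j"] by (auto simp: Xp_def N_def)
    qed (use i in \<open>auto simp: Xp_def N_def\<close>)
    moreover have "pt Xq \<in> convex hull (vertex ` V X)"
    proof (rule IH[where t = "- q" and l = k])
      show "\<lfloor>X j\<rfloor> \<le> Xq j \<and> Xq j \<le> \<lceil>X j\<rceil> \<and> Xq j = X j + - q" if "j \<in> N" for j
        using p[OF that] pq that frac[of "X j"] by (auto simp: Xq_def N_def)
    qed (use k in \<open>auto simp: Xq_def N_def\<close>)
    \<comment> \<open>The weights are inversely proportional to the shifts \<open>p\<close> and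
      \<open>- q\<close>, which therefore cancel.\<close>
    moreover have "pt X = (q / (p + q)) *\<^sub>R pt Xp + (p / (p + q)) *\<^sub>R pt Xq"
    proof -
      have X: "X j = (q / (p + q)) * Xp j + (p / (p + q)) * Xq j" for j
      proof -
        have "q * Xp j + p * Xq j = X j * (p + q)" by (simp add: Xp_def Xq_def algebra_simps)
        then have "(q * Xp j + p * Xq j) / (p + q) = X j" using pq by (simp add: divide_eq_eq)
        then show ?thesis by (simp add: add_divide_distrib)
      qed
      have "pt X = (\<Sum>j<m. Poly_Mapping.single (f (Suc j)) ((q / (p + q)) * (Xp (Suc j) - Xp j)
          + (p / (p + q)) * (Xq (Suc j) - Xq j)))"
        unfolding pt_def by (subst (1 2) X) (simp add: algebra_simps)
      also have "\<dots> = (q / (p + q)) *\<^sub>R pt Xp + (p / (p + q)) *\<^sub>R pt Xq"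
        unfolding single_add sum.distrib pt_def scaleR_sum_right scaleR_single real_scaleR_def ..
      finally show ?thesis .
    qed
    moreover have "q / (p + q) + p / (p + q) = 1"
      using pq by (simp add: add_divide_distrib[symmetric] add.commute[of q p])
    ultimately show "pt X \<in> convex hull (vertex ` V X)"
      using pq by (metis convexD convex_convex_hull add_nonneg_nonneg divide_nonneg_nonneg less_imp_le)
  qed
qed

definition in_cube :: "nat set \<Rightarrow> (nat \<Rightarrow>\<^sub>0 real) \<Rightarrow> bool" where
  "in_cube E x \<longleftrightarrow> Poly_Mapping.keys x \<subseteq> E \<and>
    (\<forall>e. 0 \<le> Poly_Mapping.lookup x e \<and> Poly_Mapping.lookup x e \<le> 1)"

text \<open>Integrality for constraints on a chain: the enumeration \<open>f\<close> turns the sums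
  over the \<open>C i\<close> into partial sums \<open>X (c i)\<close>. As the bounds are integers,
  they still hold for the floor and ceiling of these sums, so the 0/1 points supplied by
  \<open>rounding\<close> satisfy them too.\<close>

lemma convex_hull_vertices_iff:
  fixes f :: "nat \<Rightarrow> nat" and m :: nat and lo hi :: "'i \<Rightarrow> int"
  assumes f: "bij_betw f {1..m} E" and C: "\<And>i. i \<in> I \<Longrightarrow> c i \<le> m \<and> C i = f ` {1..c i}"
  shows "x \<in> convex hull (vertex ` {T. T \<subseteq> E \<and>
      (\<forall>i\<in>I. lo i \<le> int (card (T \<inter> C i)) \<and> int (card (T \<inter> C i)) \<le> hi i)}) \<longleftrightarrow>
    in_cube E x \<and> (\<forall>i\<in>I. of_int (lo i) \<le> (\<Sum>e\<in>C i. Poly_Mapping.lookup x e) \<and>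
      (\<Sum>e\<in>C i. Poly_Mapping.lookup x e) \<le> of_int (hi i))"
    (is "x \<in> convex hull (vertex ` ?M) \<longleftrightarrow> ?R x")
proof
  have E: "finite E" "E = f ` {1..m}" using f by (auto simp: bij_betw_def)
  have "convex {x. ?R x}"
  proof (rule convexI, rule CollectI)
    fix x y :: "nat \<Rightarrow>\<^sub>0 real" and u v :: real
    assume x: "x \<in> {x. ?R x}" and y: "y \<in> {x. ?R x}" and uv: "0 \<le> u" "0 \<le> v" "u + v = 1"
    have le: "u * a + v * b \<le> c" if "a \<le> c" "b \<le> c" for a b c
      using that uv by (rule convex_bound_le)
    have ge: "c \<le> u * a + v * b" if "c \<le> a" "c \<le> b" for a b c
      using le[of "- a" "- c" "- b"] that by simp
    have sum: "(\<Sum>e\<in>D. Poly_Mapping.lookup (u *\<^sub>R x + v *\<^sub>R y) e) =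
        u * (\<Sum>e\<in>D. Poly_Mapping.lookup x e) + v * (\<Sum>e\<in>D. Poly_Mapping.lookup y e)" for D
      by (simp add: lookup_add sum.distrib sum_distrib_left)
    have "Poly_Mapping.keys (u *\<^sub>R x + v *\<^sub>R y) \<subseteq> Poly_Mapping.keys x \<union> Poly_Mapping.keys y"
      by (auto simp: in_keys_iff lookup_add)
    then have "in_cube E (u *\<^sub>R x + v *\<^sub>R y)"
      using x y unfolding in_cube_def lookup_add lookup_scaleR real_scaleR_def
      by (intro conjI allI le ge) blast+
    then show "?R (u *\<^sub>R x + v *\<^sub>R y)"
      unfolding sum using x y by (intro conjI ballI le ge) blast+
  qed
  moreover have "vertex ` ?M \<subseteq> {x. ?R x}"
  proof (clarify, intro conjI ballI)
    fix T assume T: "T \<subseteq> E" "\<forall>i\<in>I. lo i \<le> int (card (T \<inter> C i)) \<and> int (card (T \<inter> C i)) \<le> hi i"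
    have finT: "finite T" using T(1) E(1) by (rule finite_subset)
    show "in_cube E (vertex T)"
      using T(1) finT by (auto simp: in_cube_def lookup_vertex in_keys_iff)
    fix i assume i: "i \<in> I"
    then have "finite (C i)" using C by simp
    then have *: "(\<Sum>e\<in>C i. Poly_Mapping.lookup (vertex T) e) = of_int (int (card (T \<inter> C i)))"
      using sum_lookup_vertex[OF finT] by simp
    show "of_int (lo i) \<le> (\<Sum>e\<in>C i. Poly_Mapping.lookup (vertex T) e)"
      "(\<Sum>e\<in>C i. Poly_Mapping.lookup (vertex T) e) \<le> of_int (hi i)"
      unfolding * of_int_le_iff using T(2) i by blast+
  qed
  ultimately have "convex hull (vertex ` ?M) \<subseteq> {x. ?R x}" by (intro hull_minimal)
  then show "x \<in> convex hull (vertex ` ?M) \<Longrightarrow> ?R x" by blast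
next
  assume R: "?R x"
  have inj: "inj_on f {1..m}" and E: "E = f ` {1..m}" using f by (auto simp: bij_betw_def)
  define X where "X j = (\<Sum>i\<in>{1..j}. Poly_Mapping.lookup x (f i))" for j
  have X_Suc: "X (Suc j) - X j = Poly_Mapping.lookup x (f (Suc j))" for j
    by (simp add: X_def)
  have X: "X j = (\<Sum>e\<in>f ` {1..j}. Poly_Mapping.lookup x e)" if "j \<le> m" for j
    unfolding X_def using that by (subst sum.reindex) (auto intro: inj_on_subset[OF inj])
  define V where "V = {T. T \<subseteq> f ` {1..m} \<and>
      (\<forall>j\<le>m. \<lfloor>X j\<rfloor> \<le> int (card (T \<inter> f ` {1..j})) \<and> int (card (T \<inter> f ` {1..j})) \<le> \<lceil>X j\<rceil>)}"
  have bounds: "X j \<le> X (Suc j) \<and> X (Suc j) \<le> X j + 1" for j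
    using R X_Suc[of j] unfolding in_cube_def by (smt (verit))
  have "(\<Sum>j<m. Poly_Mapping.single (f (Suc j)) (X (Suc j) - X j)) \<in> convex hull (vertex ` V)"
    unfolding V_def by (rule rounding[OF inj]) (auto simp: X_def[of 0] bounds)
  also have "(\<Sum>j<m. Poly_Mapping.single (f (Suc j)) (X (Suc j) - X j)) =
      (\<Sum>e\<in>E. Poly_Mapping.single e (Poly_Mapping.lookup x e))"
    unfolding X_Suc E
  proof (rule sum.reindex_bij_betw)
    have "bij_betw (\<lambda>j. f (Suc j)) {..<m} (f ` {1..m})"
    proof -
      have "bij_betw Suc {..<m} {1..m}" by (simp add: bij_betw_def image_Suc_lessThan)
      from bij_betw_trans[OF this inj_on_imp_bij_betw[OF inj]] show ?thesis by (simp add: comp_def)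
    qed
    then show "bij_betw (\<lambda>j. f (Suc j)) {..<m} (f ` {1..m})" .
  qed
  also have "\<dots> = x"
  proof (rule poly_mapping_eqI)
    fix i
    have "finite E" using E by simp
    then show "Poly_Mapping.lookup (\<Sum>e\<in>E. Poly_Mapping.single e (Poly_Mapping.lookup x e)) i = Poly_Mapping.lookup x i"
      using R by (auto simp: lookup_sum lookup_single when_def in_cube_def in_keys_iff)
  qed
  finally have "x \<in> convex hull (vertex ` V)" .
  moreover have "V \<subseteq> ?M"
  proof (clarify, intro conjI ballI)
    fix T assume T: "T \<in> V"
    show "T \<subseteq> E" using T by (simp add: V_def E)
    fix i assume i: "i \<in> I"
    then have ci: "c i \<le> m" "C i = f ` {1..c i}" using C by auto
    have "of_int (lo i) \<le> X (c i)" "X (c i) \<le> of_int (hi i)"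
      using R i X[OF ci(1)] ci(2) by auto
    then have "lo i \<le> \<lfloor>X (c i)\<rfloor>" "\<lceil>X (c i)\<rceil> \<le> hi i" by (auto simp: le_floor_iff ceiling_le_iff)
    moreover have "\<lfloor>X (c i)\<rfloor> \<le> int (card (T \<inter> C i))" "int (card (T \<inter> C i)) \<le> \<lceil>X (c i)\<rceil>"
      using T ci by (auto simp: V_def)
    ultimately show "lo i \<le> int (card (T \<inter> C i))" "int (card (T \<inter> C i)) \<le> hi i" by linarith+
  qed
  ultimately show "x \<in> convex hull (vertex ` ?M)"
    using hull_mono[of "vertex ` V" "vertex ` ?M" convex] by blast
qed

section \<open>Linear independence of Schubert matroid polytopes\<close>

lemma Inf_linear_convex_hull:
  fixes l :: "'a::real_vector \<Rightarrow> real"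
  assumes V: "finite V" "V \<noteq> {}" and l: "linear l"
  shows "Inf (l ` (convex hull V)) = Min (l ` V)"
proof (rule cInf_eq_minimum)
  have img: "l ` (convex hull V) = convex hull (l ` V)" using l by (rule convex_hull_linear_image)
  show "Min (l ` V) \<in> l ` (convex hull V)"
    unfolding img using V by (intro hull_inc Min_in) auto
  have "convex hull (l ` V) \<subseteq> {Min (l ` V)..}"
    using V by (intro hull_minimal) auto
  then show "Min (l ` V) \<le> x" if "x \<in> l ` (convex hull V)" for x
    using that img by auto
qed

lemma matroids_finite:
  assumes "M \<in> matroids k m"
  shows "finite M" "M \<noteq> {}" and "B \<in> M \<Longrightarrow> B \<subseteq> {1..m} \<and> finite B \<and> card B = k"
proof -
  have sub: "B \<subseteq> {1..m}" if "B \<in> M" for B using assms that by (auto simp: matroids_def is_matroid_def)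
  show "B \<in> M \<Longrightarrow> B \<subseteq> {1..m} \<and> finite B \<and> card B = k"
    using assms sub by (auto simp: matroids_def intro: finite_subset)
  show "finite M" using sub by (intro finite_subset[of M "Pow {1..m}"]) auto
  show "M \<noteq> {}" using assms by (simp add: matroids_def is_matroid_def)
qed

text \<open>Ensures that the finitely many coordinates in \<open>{1..m}\<close> separate the points
  of these polytopes, as \<open>sum_min_eq_0\<close> demands.\<close>

lemma keys_matroid_polytope:
  assumes "M \<in> matroids k m" "x \<in> matroid_polytope M"
  shows "Poly_Mapping.keys x \<subseteq> {1..m}"
proof -
  have "convex {x :: nat \<Rightarrow>\<^sub>0 real. Poly_Mapping.keys x \<subseteq> {1..m}}"
  proof (rule convexI, rule CollectI)
    fix x y :: "nat \<Rightarrow>\<^sub>0 real" and u v :: real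
    assume "x \<in> {x. Poly_Mapping.keys x \<subseteq> {1..m}}" "y \<in> {x. Poly_Mapping.keys x \<subseteq> {1..m}}"
    moreover have "Poly_Mapping.keys (u *\<^sub>R x + v *\<^sub>R y) \<subseteq> Poly_Mapping.keys x \<union> Poly_Mapping.keys y"
      by (auto simp: in_keys_iff lookup_add)
    ultimately show "Poly_Mapping.keys (u *\<^sub>R x + v *\<^sub>R y) \<subseteq> {1..m}" by blast
  qed
  moreover have "vertex ` M \<subseteq> {x. Poly_Mapping.keys x \<subseteq> {1..m}}"
  proof clarify
    fix B i assume B: "B \<in> M" "i \<in> Poly_Mapping.keys (vertex B)"
    note m = matroids_finite(3)[OF assms(1) B(1)]
    then show "i \<in> {1..m}" using B(2) lookup_vertex[of B i] by (auto simp: in_keys_iff)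
  qed
  ultimately show ?thesis
    using assms(2) hull_minimal[of "vertex ` M" "{x. Poly_Mapping.keys x \<subseteq> {1..m}}" convex]
    unfolding matroid_polytope_eq by blast
qed

lemma finite_schubert_matroids [simp]: "finite (schubert_matroids k m)"
proof (rule finite_subset)
  show "schubert_matroids k m \<subseteq> Pow (Pow {1..m})"
    using matroids_finite(3) unfolding schubert_matroids_def by blast
qed simp

text \<open>
  For an inclusion-minimal \<open>S\<close> with nonzero coefficient choose weights for which the defining set
  of \<open>S\<close> is the lightest basis. A Schubert matroid with the same minimal weight has the same lightest
  basis, hence is contained in \<open>S\<close>.
\<close>

lemma schubert_polytopes_independent:
  fixes c :: "nat set set \<Rightarrow> int"
  assumes zero: "\<And>x. (\<Sum>S\<in>schubert_matroids k m. c S * indicator (matroid_polytope S) x) = 0"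
    and "R \<in> schubert_matroids k m"
  shows "c R = 0"
proof (rule ccontr)
  define Sch where "Sch = schubert_matroids k m"
  have Sch: "finite Sch" by (simp add: Sch_def)
  have mat: "M \<in> matroids k m" if "M \<in> Sch" for M
    using that by (simp add: Sch_def schubert_matroids_def)
  assume "c R \<noteq> 0"
  then have "R \<in> {S \<in> Sch. c S \<noteq> 0}" using assms by (simp add: Sch_def)
  then obtain S where S: "S \<in> Sch" "c S \<noteq> 0"
    and min: "\<And>M. M \<in> Sch \<Longrightarrow> M \<subseteq> S \<Longrightarrow> c M \<noteq> 0 \<Longrightarrow> M = S"
    using finite_has_minimal[of "{S \<in> Sch. c S \<noteq> 0}"] Sch by auto
  obtain S0 f where S0: "S0 \<subseteq> {1..m}" and f: "bij_betw f {1..m} {1..m}" and Sf: "S = (\<lambda>B. f ` B) ` SM m S0"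
    using S by (auto simp: Sch_def schubert_matroids_def isomorphic_on_def)
  have finS0: "finite S0" using S0 by (rule finite_subset) simp
  define p where "p = inv_into {1..m} f"
  have p: "bij_betw p {1..m} {1..m}" unfolding p_def by (rule bij_betw_inv_into[OF f])
  have pf: "p (f a) = a" if "a \<in> {1..m}" for a
    unfolding p_def using that f by (simp add: bij_betw_inv_into_left)
  have fp: "f (p a) = a" if "a \<in> {1..m}" for a
    unfolding p_def using that f by (simp add: bij_betw_inv_into_right)
  define g where "g b = m - p b" for b
  have inj_p: "inj_on p {1..m}" and p_img: "p ` {1..m} = {1..m}" using p by (auto simp: bij_betw_def)
  have p_in: "p b \<in> {1..m}" if "b \<in> {1..m}" for b using p_img that by blast
  have inj_g: "inj_on g {1..m}"
  proof (rule inj_onI)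
    fix a b assume "a \<in> {1..m}" "b \<in> {1..m}" "g a = g b"
    then have "p a = p b" using p_in[of a] p_in[of b] unfolding g_def atLeastAtMost_iff by linarith
    then show "a = b" using inj_onD[OF inj_p] \<open>a \<in> {1..m}\<close> \<open>b \<in> {1..m}\<close> by blast
  qed
  \<comment> \<open>The weight of an element depends only on its position \<open>p b\<close> in the
    standard Schubert matroid and decreases with it; powers of two make the lightest basis
    unique.\<close>
  define u where "u b = (2::real) ^ g b" for b
  define l where "l x = (\<Sum>b\<in>{1..m}. Poly_Mapping.lookup x b * u b)" for x :: "nat \<Rightarrow>\<^sub>0 real"
  have l: "bounded_linear l"
    unfolding l_def by (intro bounded_linear_sum bounded_linear_mult_const bounded_linear_lookup)
  have l_vertex: "l (vertex B) = sum u B" if "B \<subseteq> {1..m}" for B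
  proof -
    have "finite B" using that by (rule finite_subset) simp
    then have "l (vertex B) = (\<Sum>b\<in>{1..m}. if b \<in> B then u b else 0)"
      unfolding l_def by (intro sum.cong) (auto simp: lookup_vertex)
    also have "\<dots> = sum u ({1..m} \<inter> B)" by (simp add: sum.If_cases)
    finally show ?thesis using that by (simp add: Int_absorb1)
  qed
  have Inf: "Inf (l ` matroid_polytope M) = Min (sum u ` M)" if "M \<in> Sch" for M
  proof -
    note M = matroids_finite[OF mat[OF that]]
    have "l ` vertex ` M = sum u ` M"
      unfolding image_image using M(3) l_vertex by (intro image_cong) auto
    then show ?thesis
      unfolding matroid_polytope_eq using M
      by (subst Inf_linear_convex_hull) (auto intro: bounded_linear.linear[OF l])
  qed
  define B0 where "B0 = f ` S0"
  have B0: "B0 \<in> S" unfolding B0_def Sf using self_in_SM[OF S0] by blast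
  have sum_f: "sum u (f ` T) = (\<Sum>t\<in>T. 2 ^ (m - t))" if T: "T \<subseteq> {1..m}" for T
  proof -
    have "inj_on f T" using f T by (auto simp: bij_betw_def intro: inj_on_subset)
    then show ?thesis
      using T by (simp add: sum.reindex u_def g_def) (rule sum.cong, auto simp: pf subset_iff)
  qed
  have min_S: "Min (sum u ` S) = sum u B0"
  proof (rule Min_eqI)
    show "finite (sum u ` S)" "sum u B0 \<in> sum u ` S"
      using matroids_finite[OF mat[OF S(1)]] B0 by auto
    fix w assume "w \<in> sum u ` S"
    then obtain T where "w = sum u (f ` T)" and T: "T \<in> SM m S0" by (auto simp: Sf)
    moreover have "T \<subseteq> {1..m}" using T SM_iff[OF finS0] by blast
    ultimately show "sum u B0 \<le> w"
      using sum_power_minus_le_SM[OF T finS0] by (simp add: B0_def sum_f sum_f[OF S0])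
  qed
  have sub: "M \<subseteq> S" if M: "M \<in> Sch" "Min (sum u ` M) = sum u B0" for M
  proof
    fix T assume T: "T \<in> M"
    note M' = matroids_finite[OF mat[OF M(1)]] and S' = matroids_finite[OF mat[OF S(1)]]
    have "Min (sum u ` M) \<in> sum u ` M" using M' by (intro Min_in) auto
    then obtain B where B: "B \<in> M" "sum u B = sum u B0" using M(2) by auto
    have inj: "inj_on g (B \<union> B0)" using M'(3)[OF B(1)] S'(3)[OF B0] by (intro inj_on_subset[OF inj_g]) auto
    \<comment> \<open>Subsets of the ground set are determined by their weights, so equal minimal
      weight means equal lightest basis.\<close>
    have "B = B0"
      using B(2) M'(3)[OF B(1)] S'(3)[OF B0] sum_power_eq_iff[OF _ _ inj] unfolding u_def by blast
    then have B0M: "B0 \<in> M" using B by simp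
    have B0min: "sum u B0 \<le> sum u B" if "B \<in> M" for B
      using M(2) M' that by (metis Min_le finite_imageI imageI)
    \<comment> \<open>The light elements to which \<open>card_Int_le_if_min_weight\<close> applies
      form a final segment of positions, whereas the Gale order counts initial segments; all bases
      having \<open>k\<close> elements, one count is the complement of the other.\<close>
    have pcard: "card (p ` A \<inter> {..j}) = k - card (A \<inter> {b. j < p b})" if A: "A \<subseteq> {1..m}" "card A = k" for A j
    proof -
      have fin: "finite A" using A(1) by (rule finite_subset) simp
      have "p ` A \<inter> {..j} = p ` (A - A \<inter> {b. j < p b})" by auto
      also have "card \<dots> = card (A - A \<inter> {b. j < p b})"
        using A(1) by (intro card_image inj_on_subset[OF inj_p]) auto
      also have "\<dots> = k - card (A \<inter> {b. j < p b})" using A fin by (subst card_Diff_subset) auto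
      finally show ?thesis .
    qed
    have pB0: "p ` B0 = S0" using S0 by (auto simp: B0_def image_image pf subset_iff)
    have TE: "T \<subseteq> {1..m}" "card T = k" using M'(3)[OF T] by auto
    have B0E: "B0 \<subseteq> {1..m}" "card B0 = k" using S'(3)[OF B0] by auto
    have "card (S0 \<inter> {..j}) \<le> card (p ` T \<inter> {..j})" for j
    proof -
      have "card (T \<inter> {b. j < p b}) \<le> card (B0 \<inter> {b. j < p b})"
      proof (rule card_Int_le_if_min_weight[OF _ _ B0M B0min _ T])
        show "is_matroid {1..m} M" using mat[OF M(1)] by (simp add: matroids_def)
        show "card B = k" if "B \<in> M" for B using M'(3)[OF that] by simp
        fix x y assume "x \<in> {1..m} - {b. j < p b}" "y \<in> {1..m} \<inter> {b. j < p b}"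
        then have "g y < g x" using p_in[of x] p_in[of y] by (auto simp: g_def)
        then show "u y < u x" by (simp add: u_def)
      qed
      then show ?thesis using pcard[OF TE] pcard[OF B0E] pB0 by simp
    qed
    moreover have "p ` T \<subseteq> {1..m}" using TE p_in by blast
    moreover have "card (p ` T) = card S0"
    proof -
      have "card (p ` T) = k" "card (p ` B0) = k"
        using TE B0E by (auto simp: card_image inj_on_subset[OF inj_p])
      then show ?thesis by (simp add: pB0)
    qed
    ultimately have "p ` T \<in> SM m S0" using SM_iff[OF finS0] by simp
    moreover have "f ` p ` T = T" using TE fp by (force simp: image_image)
    ultimately show "T \<in> S" unfolding Sf by (metis imageI)
  qed
  have "(\<Sum>M | M \<in> Sch \<and> matroid_polytope M \<noteq> {} \<and> Inf (l ` matroid_polytope M) = sum u B0. c M) = 0"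
  proof (rule sum_min_eq_0[where L = "(\<lambda>i x. Poly_Mapping.lookup x i) ` {1..m}", OF _ Sch])
    show "compact (matroid_polytope M) \<and> convex (matroid_polytope M)" if "M \<in> Sch" for M
      unfolding matroid_polytope_eq
      using matroids_finite[OF mat[OF that]] by (auto intro!: finite_imp_compact_convex_hull)
    show "bounded_linear h" if "h \<in> (\<lambda>i x. Poly_Mapping.lookup x i) ` {1..m}" for h :: "_ \<Rightarrow> real"
      using that bounded_linear_lookup by auto
    show "x = y" if M: "M \<in> Sch" "N \<in> Sch" "x \<in> matroid_polytope M" "y \<in> matroid_polytope N"
      and eq: "\<And>h :: (nat \<Rightarrow>\<^sub>0 real) \<Rightarrow> real. h \<in> (\<lambda>i x. Poly_Mapping.lookup x i) ` {1..m} \<Longrightarrow> h x = h y" for M N x y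
    proof (rule poly_mapping_eqI)
      fix i
      show "Poly_Mapping.lookup x i = Poly_Mapping.lookup y i"
      proof (cases "i \<in> {1..m}")
        case True
        then show ?thesis by (rule eq[OF imageI])
      next
        case False
        then show ?thesis
          using keys_matroid_polytope[OF mat] M by (metis in_keys_iff subsetD)
      qed
    qed
    show "(\<Sum>M\<in>Sch. c M * indicator (matroid_polytope M) x) = 0" for x
      using zero by (simp add: Sch_def)
  qed (use l in auto)
  also have "{M. M \<in> Sch \<and> matroid_polytope M \<noteq> {} \<and> Inf (l ` matroid_polytope M) = sum u B0} =
      {M \<in> Sch. Min (sum u ` M) = sum u B0}"
  proof -
    have "matroid_polytope M \<noteq> {}" if "M \<in> Sch" for M
      using matroids_finite(2)[OF mat[OF that]] by (simp add: matroid_polytope_eq)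
    then show ?thesis by (auto simp: Inf)
  qed
  \<comment> \<open>Every other matroid in this sum is properly contained in \<open>S\<close>, so
    its coefficient is 0 by the choice of \<open>S\<close>.\<close>
  also have "sum c \<dots> = sum c {S}"
    using Sch S min min_S sub by (intro sum.mono_neutral_right) auto
  finally show False using S by simp
qed

section \<open>Matroids of chains of blocks\<close>

text \<open>A relabeling under which the prefix unions become initial segments. It exhibits chain
  matroids as relabeled Schubert matroids and makes \<open>convex_hull_vertices_iff\<close>
  applicable.\<close>

lemma ex_enumeration:
  assumes "sorted_wrt disjnt Qs" "\<And>Q. Q \<in> set Qs \<Longrightarrow> finite (Q :: 'a::linorder set)"
  shows "\<exists>f. bij_betw f {1..card (\<Union>(set Qs))} (\<Union>(set Qs)) \<and>
    (\<forall>i\<le>length Qs. \<Union>(set (take i Qs)) = f ` {1..card (\<Union>(set (take i Qs)))})"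
proof -
  define enum where "enum Rs = concat (map sorted_list_of_set Rs)" for Rs :: "'a set list"
  have set_enum: "set (enum Rs) = \<Union>(set Rs)" if "set Rs \<subseteq> set Qs" for Rs
  proof -
    have "set (sorted_list_of_set Q) = Q" if "Q \<in> set Rs" for Q
      using that \<open>set Rs \<subseteq> set Qs\<close> assms(2) by auto
    then show ?thesis by (simp add: enum_def)
  qed
  have distinct: "distinct (enum Rs)" if "sorted_wrt disjnt Rs" "set Rs \<subseteq> set Qs" for Rs
    using that
  proof (induction Rs)
    case (Cons R Rs)
    then have "set (enum Rs) = \<Union>(set Rs)" using set_enum[of Rs] by simp
    then show ?case using Cons assms(2)[of R] by (auto simp: enum_def disjnt_def)
  qed (simp add: enum_def)
  define xs where "xs = enum Qs"
  have xs: "distinct xs" "set xs = \<Union>(set Qs)" using assms set_enum[of Qs] distinct[of Qs] by (auto simp: xs_def)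
  define f where "f j = xs ! (j - 1)" for j
  have f_img: "f ` {1..k} = set (take k xs)" if "k \<le> length xs" for k
  proof -
    have "{1..k} = Suc ` {0..<k}"
      by (simp add: atLeastLessThanSuc_atLeastAtMost image_Suc_atLeastLessThan)
    then have "f ` {1..k} = (!) xs ` {0..<k}" unfolding f_def by (simp only: image_image diff_Suc_1)
    also have "\<dots> = set (take k xs)" using that by (rule nth_image)
    finally show ?thesis .
  qed
  have len: "length xs = card (\<Union>(set Qs))" using xs distinct_card by metis
  have "bij_betw f {1..card (\<Union>(set Qs))} (\<Union>(set Qs))"
  proof -
    have "card (f ` {1..length xs}) = card {1..length xs}" using xs f_img[of "length xs"] len by simp
    then have "inj_on f {1..length xs}" by (intro eq_card_imp_inj_on) auto
    then show ?thesis using f_img[of "length xs"] xs len by (simp add: bij_betw_def)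
  qed
  moreover have "\<forall>i\<le>length Qs. \<Union>(set (take i Qs)) = f ` {1..card (\<Union>(set (take i Qs)))}"
  proof (intro allI impI)
    fix i
    have xs_split: "xs = enum (take i Qs) @ enum (drop i Qs)"
      unfolding xs_def enum_def by (metis append_take_drop_id concat_append map_append)
    have s: "set (enum (take i Qs)) = \<Union>(set (take i Qs))"
      by (rule set_enum) (rule set_take_subset)
    have d: "distinct (enum (take i Qs))" using xs(1) xs_split by simp
    define k where "k = length (enum (take i Qs))"
    have k: "k = card (\<Union>(set (take i Qs)))"
      unfolding k_def using distinct_card[OF d] s by simp
    have "take k xs = enum (take i Qs)" by (simp add: xs_split k_def)
    moreover have "k \<le> length xs" by (simp add: xs_split k_def)
    ultimately show "\<Union>(set (take i Qs)) = f ` {1..card (\<Union>(set (take i Qs)))}"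
      using f_img[of k] s k by simp
  qed
  ultimately show ?thesis by (intro exI conjI)
qed

text \<open>On the ground set \<open>{1..2 * n}\<close>, pairs as blocks give the relabeled Catalan
  matroids and a single block gives the uniform matroid; other block sizes arise when blocks are
  merged. The factors 2 avoid halves.\<close>

definition chain_matroid :: "nat set list \<Rightarrow> nat set set" where
  "chain_matroid Qs = {T. T \<subseteq> \<Union>(set Qs) \<and> 2 * card T = card (\<Union>(set Qs)) \<and>
    (\<forall>i\<le>length Qs. card (\<Union>(set (take i Qs))) \<le> 2 * card (T \<inter> \<Union>(set (take i Qs))))}"

text \<open>Parity of the blocks makes half of each prefix size an integer, which the integrality
  argument needs.\<close>

definition even_chain :: "nat \<Rightarrow> nat set list \<Rightarrow> bool" where
  "even_chain m Qs \<longleftrightarrow> sorted_wrt disjnt Qs \<and> \<Union>(set Qs) = {1..m} \<and> (\<forall>Q\<in>set Qs. even (card Q))"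

lemma prefix_Union_subset: "\<Union>(set (take i Qs)) \<subseteq> \<Union>(set Qs)"
  by (auto dest: in_set_takeD)

lemma even_chain_finite:
  assumes "even_chain m Qs"
  shows "Q \<in> set Qs \<Longrightarrow> finite Q" "finite (\<Union>(set (take i Qs)))"
proof -
  show *: "finite Q" if "Q \<in> set Qs" for Q
    using that assms finite_subset[of Q "{1..m}"] unfolding even_chain_def by blast
  show "finite (\<Union>(set (take i Qs)))" using * by (auto dest: in_set_takeD)
qed

lemma sum_Union_list:
  assumes "sorted_wrt disjnt Qs" "\<And>Q. Q \<in> set Qs \<Longrightarrow> finite Q"
  shows "sum g (\<Union>(set Qs)) = (\<Sum>Q\<leftarrow>Qs. sum g Q)"
  using assms
proof (induction Qs)
  case (Cons Q Qs)
  have "sum g (Q \<union> \<Union>(set Qs)) = sum g Q + sum g (\<Union>(set Qs))"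
    using Cons.prems by (intro sum.union_disjoint) (auto simp: disjnt_def)
  then show ?case using Cons by simp
qed simp

lemma sum_prefix_Union:
  assumes "even_chain m Qs"
  shows "sum g (\<Union>(set (take i Qs))) = (\<Sum>Q\<leftarrow>take i Qs. sum g Q)"
proof (rule sum_Union_list)
  show "sorted_wrt disjnt (take i Qs)" using assms by (simp add: even_chain_def sorted_wrt_take)
  show "finite Q" if "Q \<in> set (take i Qs)" for Q
    using even_chain_finite[OF assms] that by (meson in_set_takeD)
qed

lemma sum_list_even: "(\<And>x. x \<in> set xs \<Longrightarrow> even (f x)) \<Longrightarrow> even (\<Sum>x\<leftarrow>xs. f x :: nat)"
  by (induction xs) auto

lemma even_card_prefix_Union:
  assumes "even_chain m Qs"
  shows "even (card (\<Union>(set (take i Qs))))"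
proof -
  have "card (\<Union>(set (take i Qs))) = (\<Sum>Q\<leftarrow>take i Qs. card Q)"
    using sum_prefix_Union[OF assms, of "\<lambda>_. 1::nat" i] by simp
  also have "even \<dots>"
    using assms in_set_takeD[of _ i Qs] unfolding even_chain_def by (intro sum_list_even) blast
  finally show ?thesis .
qed

lemma chain_matroid_eq_image:
  assumes f: "bij_betw f {1..m} {1..m}" and Qs: "\<Union>(set Qs) = {1..m}"
    and prefix: "\<forall>i\<le>length Qs. \<Union>(set (take i Qs)) = f ` {1..card (\<Union>(set (take i Qs)))}"
  shows "chain_matroid Qs = (\<lambda>B. f ` B) ` {T. T \<subseteq> {1..m} \<and> 2 * card T = m \<and>
    (\<forall>i\<le>length Qs. card (\<Union>(set (take i Qs))) \<le> 2 * card (T \<inter> {..card (\<Union>(set (take i Qs)))}))}"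
proof -
  have inj: "inj_on f {1..m}" and img: "f ` {1..m} = {1..m}" using f by (auto simp: bij_betw_def)
  have iff: "f ` T \<in> chain_matroid Qs \<longleftrightarrow> 2 * card T = m \<and>
    (\<forall>i\<le>length Qs. card (\<Union>(set (take i Qs))) \<le> 2 * card (T \<inter> {..card (\<Union>(set (take i Qs)))}))"
    if T: "T \<subseteq> {1..m}" for T
  proof -
    have "card (f ` T) = card T" using T by (intro card_image inj_on_subset[OF inj])
    moreover have "card (f ` T \<inter> \<Union>(set (take i Qs))) = card (T \<inter> {..card (\<Union>(set (take i Qs)))})"
      if i: "i \<le> length Qs" for i
    proof -
      define k where "k = card (\<Union>(set (take i Qs)))"
      have U: "\<Union>(set (take i Qs)) = f ` {1..k}" using prefix i by (simp add: k_def)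
      have "\<Union>(set (take i Qs)) \<subseteq> {1..m}" using prefix_Union_subset[of i Qs] unfolding Qs .
      then have "k \<le> m" unfolding k_def using card_mono[of "{1..m}"] by force
      have "f ` T \<inter> f ` {1..k} = f ` (T \<inter> {1..k})"
        using T \<open>k \<le> m\<close> by (intro inj_on_image_Int[OF inj, symmetric]) auto
      moreover have "T \<inter> {1..k} = T \<inter> {..k}" using T by auto
      moreover have "card (f ` (T \<inter> {1..k})) = card (T \<inter> {1..k})"
        using T by (intro card_image inj_on_subset[OF inj]) auto
      ultimately have "card (f ` T \<inter> \<Union>(set (take i Qs))) = card (T \<inter> {..k})"
        by (simp only: U)
      then show ?thesis unfolding k_def .
    qed
    ultimately show ?thesis
      using T img by (auto simp: chain_matroid_def Qs)
  qed
  show ?thesis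
  proof (intro equalityI subsetI)
    fix C assume C: "C \<in> chain_matroid Qs"
    then have "C \<subseteq> f ` {1..m}" using img by (simp add: chain_matroid_def Qs)
    then obtain T where "T \<subseteq> {1..m}" "C = f ` T" by (auto simp: subset_image_iff)
    then show "C \<in> (\<lambda>B. f ` B) ` {T. T \<subseteq> {1..m} \<and> 2 * card T = m \<and>
      (\<forall>i\<le>length Qs. card (\<Union>(set (take i Qs))) \<le> 2 * card (T \<inter> {..card (\<Union>(set (take i Qs)))}))}"
      using C iff by blast
  qed (use iff in blast)
qed

lemma chain_matroid_schubert:
  assumes Qs: "even_chain (2 * n) Qs"
  shows "chain_matroid Qs \<in> schubert_matroids n (2 * n)"
proof -
  define m where "m = 2 * n"
  have U: "\<Union>(set Qs) = {1..m}" "sorted_wrt disjnt Qs" using Qs by (auto simp: even_chain_def m_def)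
  note fin = even_chain_finite[OF Qs]
  define k where "k i = card (\<Union>(set (take i Qs)))" for i
  have k: "k i \<le> m" "even (k i)" for i
  proof -
    have "\<Union>(set (take i Qs)) \<subseteq> {1..m}" using prefix_Union_subset[of i Qs] unfolding U .
    then show "k i \<le> m" unfolding k_def using card_mono[of "{1..m}"] by force
    show "even (k i)" unfolding k_def by (rule even_card_prefix_Union[OF Qs])
  qed
  obtain f where f: "bij_betw f {1..m} {1..m}"
    and prefix: "\<forall>i\<le>length Qs. \<Union>(set (take i Qs)) = f ` {1..card (\<Union>(set (take i Qs)))}"
    using ex_enumeration[OF U(2) fin(1)] unfolding U by auto
  \<comment> \<open>The value 0 expresses that a position which is not a prefix size makes no
    demand; \<open>ex_SM_eq\<close> completes such partial data to a Schubert matroid.\<close>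
  define a where "a j = (if \<exists>i\<le>length Qs. j = k i then j div 2 else 0)" for j
  have km: "k (length Qs) = m" by (simp add: k_def U)
  then have am: "a m = n" by (auto simp: a_def m_def)
  have a_le: "a i \<le> i" "a i \<le> n" if "i \<le> m" for i
    using that by (auto simp: a_def m_def)
  obtain S where S: "S \<subseteq> {1..m}" "card S = n"
    and SM: "SM m S = {T. T \<subseteq> {1..m} \<and> card T = n \<and> (\<forall>i\<le>m. a i \<le> card (T \<inter> {..i}))}"
    using ex_SM_eq[of m a, unfolded am] a_le by blast
  have "(\<forall>i\<le>m. a i \<le> card (T \<inter> {..i})) \<longleftrightarrow> (\<forall>i\<le>length Qs. k i \<le> 2 * card (T \<inter> {..k i}))" for T
  proof
    assume L: "\<forall>i\<le>m. a i \<le> card (T \<inter> {..i})"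
    show "\<forall>i\<le>length Qs. k i \<le> 2 * card (T \<inter> {..k i})"
    proof (intro allI impI)
      fix i assume "i \<le> length Qs"
      then have "a (k i) = k i div 2" by (auto simp: a_def)
      then have "k i div 2 \<le> card (T \<inter> {..k i})" using L k(1)[of i] by metis
      then show "k i \<le> 2 * card (T \<inter> {..k i})" using k(2)[of i] by (auto elim!: evenE)
    qed
  qed (auto simp: a_def)
  then have "chain_matroid Qs = (\<lambda>B. f ` B) ` SM m S"
    unfolding chain_matroid_eq_image[OF f U(1) prefix] SM k_def[symmetric] by (simp add: m_def)
  then have iso: "isomorphic_on {1..m} (SM m S) (chain_matroid Qs)"
    using f by (auto simp: isomorphic_on_def)
  have "is_matroid {1..m} (chain_matroid Qs)"
    unfolding \<open>chain_matroid Qs = _\<close> by (rule is_matroid_image[OF f is_matroid_SM[OF S(1)]])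
  then have "chain_matroid Qs \<in> matroids n m"
    by (auto simp: matroids_def chain_matroid_def U m_def)
  then show ?thesis using iso S by (auto simp: schubert_matroids_def m_def)
qed

text \<open>The prefix count of the defining set does not grow from \<open>2 * i\<close> to
  \<open>2 * i + 1\<close>, so the even positions carry all constraints. The inequalities are
  doubled to match \<open>chain_matroid_eq_image\<close>.\<close>

lemma catalan_matroid_eq:
  "catalan_matroid n = {T. T \<subseteq> {1..2 * n} \<and> 2 * card T = 2 * n \<and> (\<forall>i\<le>n. 2 * i \<le> 2 * card (T \<inter> {..2 * i}))}"
proof -
  define S where "S = (\<lambda>i. 2 * i) ` {1..n}"
  have "finite S" by (simp add: S_def)
  have cardS: "card S = n" by (simp add: S_def card_image inj_on_def)
  have S: "card (S \<inter> {..j}) = min n (j div 2)" for j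
  proof -
    have "S \<inter> {..j} = (\<lambda>i. 2 * i) ` {1..min n (j div 2)}" by (auto simp: S_def)
    then show ?thesis by (simp add: card_image inj_on_def)
  qed
  have "(\<forall>j. min n (j div 2) \<le> card (T \<inter> {..j})) \<longleftrightarrow> (\<forall>i\<le>n. i \<le> card (T \<inter> {..2 * i}))"
    if T: "finite T" for T
  proof
    assume L: "\<forall>j. min n (j div 2) \<le> card (T \<inter> {..j})"
    show "\<forall>i\<le>n. i \<le> card (T \<inter> {..2 * i})"
    proof (intro allI impI)
      fix i assume "i \<le> n"
      then show "i \<le> card (T \<inter> {..2 * i})" using spec[OF L, of "2 * i"] by simp
    qed
  next
    assume R: "\<forall>i\<le>n. i \<le> card (T \<inter> {..2 * i})"
    show "\<forall>j. min n (j div 2) \<le> card (T \<inter> {..j})"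
    proof
      fix j
      have "min n (j div 2) \<le> card (T \<inter> {..2 * min n (j div 2)})" using R by simp
      also have "\<dots> \<le> card (T \<inter> {..j})" using T by (intro card_mono) auto
      finally show "min n (j div 2) \<le> card (T \<inter> {..j})" .
    qed
  qed
  then show ?thesis
    unfolding catalan_matroid_def S_def[symmetric] set_eq_iff SM_iff[OF \<open>finite S\<close>] S cardS mem_Collect_eq
    using finite_subset[OF _ finite_atLeastAtMost] by (metis (no_types, lifting) mult_le_cancel1 mult_cancel1 zero_less_numeral zero_neq_numeral)
qed

lemma isomorphic_chain_matroid:
  assumes ws: "even_chain (2 * n) ws" and two: "\<And>A. A \<in> set ws \<Longrightarrow> card A = 2"
  shows "isomorphic_on {1..2 * n} (catalan_matroid n) (chain_matroid ws)"
proof -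
  have U: "\<Union>(set ws) = {1..2 * n}" "sorted_wrt disjnt ws" using ws by (auto simp: even_chain_def)
  have card: "card (\<Union>(set (take i ws))) = 2 * i" if "i \<le> length ws" for i
  proof -
    have "card (\<Union>(set (take i ws))) = (\<Sum>Q\<leftarrow>take i ws. card Q)"
      using sum_prefix_Union[OF ws, of "\<lambda>_. 1::nat" i] by simp
    also have "\<dots> = (\<Sum>Q\<leftarrow>take i ws. 2)" using two by (intro arg_cong[of _ _ sum_list] map_cong) (auto dest: in_set_takeD)
    finally show ?thesis using that by (simp add: sum_list_triv)
  qed
  have len: "length ws = n" using card[of "length ws"] U by simp
  obtain f where f: "bij_betw f {1..2 * n} {1..2 * n}"
    and prefix: "\<forall>i\<le>length ws. \<Union>(set (take i ws)) = f ` {1..card (\<Union>(set (take i ws)))}"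
    using ex_enumeration[OF U(2) even_chain_finite(1)[OF ws]] unfolding U by auto
  have "chain_matroid ws = (\<lambda>B. f ` B) ` catalan_matroid n"
    unfolding chain_matroid_eq_image[OF f U(1) prefix] catalan_matroid_eq
    by (rule arg_cong[where f = "(`) ((`) f)"]) (use card len in auto)
  then show ?thesis using f by (auto simp: isomorphic_on_def)
qed

section \<open>Descriptions of the polytopes by inequalities\<close>

definition excess :: "(nat \<Rightarrow>\<^sub>0 real) \<Rightarrow> nat set \<Rightarrow> real" where
  "excess x Q = (\<Sum>e\<in>Q. Poly_Mapping.lookup x e - 1 / 2)"

lemma excess_eq: "excess x Q = (\<Sum>e\<in>Q. Poly_Mapping.lookup x e) - card Q / 2"
  by (simp add: excess_def sum_subtractf)

lemma polytope_chain_matroid: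
  assumes Qs: "even_chain m Qs"
  shows "x \<in> matroid_polytope (chain_matroid Qs) \<longleftrightarrow>
    in_cube {1..m} x \<and> excess x {1..m} = 0 \<and> prefix_nonneg 0 (map (excess x) Qs)"
proof -
  have U: "\<Union>(set Qs) = {1..m}" "sorted_wrt disjnt Qs" using Qs by (auto simp: even_chain_def)
  note fin = even_chain_finite[OF Qs]
  define C where "C i = \<Union>(set (take i Qs))" for i
  define k where "k i = card (C i)" for i
  have k: "even (k i)" for i unfolding k_def C_def by (rule even_card_prefix_Union[OF Qs])
  have CU: "C i \<subseteq> {1..m}" for i unfolding C_def using prefix_Union_subset[of i Qs] unfolding U .
  have km: "k i \<le> m" for i unfolding k_def using card_mono[OF _ CU[of i]] by simp
  have C_len: "C (length Qs) = {1..m}" by (simp add: C_def U)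
  obtain f where f: "bij_betw f {1..m} {1..m}" and prefix: "\<forall>i\<le>length Qs. C i = f ` {1..k i}"
    using ex_enumeration[OF U(2) fin(1)] unfolding U k_def C_def by auto
  define lo where "lo i = int (k i div 2)" for i
  \<comment> \<open>Only the last prefix has a proper upper bound, which fixes the rank; the other
    values are the trivial bounds by the prefix sizes.\<close>
  define hi where "hi i = (if i = length Qs then int (k i div 2) else int (k i))" for i
  have half: "real (k i div 2) = k i / 2" for i using k[of i] by (simp add: real_of_nat_div)
  have lo: "real_of_int (lo i) = k i / 2" for i by (simp add: lo_def half)
  have hi: "real_of_int (hi i) = (if i = length Qs then k i / 2 else k i)" for i
    by (simp add: hi_def half)
  have "chain_matroid Qs = {T. T \<subseteq> {1..m} \<and>
      (\<forall>i\<in>{..length Qs}. lo i \<le> int (card (T \<inter> C i)) \<and> int (card (T \<inter> C i)) \<le> hi i)}"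
  proof (rule set_eqI)
    fix T
    have lo_iff: "lo i \<le> int (card (T \<inter> C i)) \<longleftrightarrow> k i \<le> 2 * card (T \<inter> C i)" for i
      unfolding lo_def using k[of i] by presburger
    have card_le: "card (T \<inter> C i) \<le> k i" for i
      unfolding k_def using fin(2) by (intro card_mono) (auto simp: C_def)
    have "(\<forall>i\<le>length Qs. int (card (T \<inter> C i)) \<le> hi i) \<longleftrightarrow> 2 * card T \<le> m" if T: "T \<subseteq> {1..m}"
    proof -
      have "(\<forall>i\<le>length Qs. int (card (T \<inter> C i)) \<le> hi i) \<longleftrightarrow> int (card (T \<inter> C (length Qs))) \<le> hi (length Qs)"
        using card_le by (auto simp: hi_def)
      also have "T \<inter> C (length Qs) = T" using T C_len by auto
      also have "int (card T) \<le> hi (length Qs) \<longleftrightarrow> 2 * card T \<le> m"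
        using k[of "length Qs"] by (simp add: hi_def k_def C_len) presburger
      finally show ?thesis .
    qed
    moreover have "m \<le> 2 * card T" if "T \<subseteq> {1..m}" "\<forall>i\<le>length Qs. k i \<le> 2 * card (T \<inter> C i)"
      using that spec[OF that(2), of "length Qs"] C_len by (simp add: k_def Int_absorb2)
    ultimately show "T \<in> chain_matroid Qs \<longleftrightarrow> T \<in> {T. T \<subseteq> {1..m} \<and>
      (\<forall>i\<in>{..length Qs}. lo i \<le> int (card (T \<inter> C i)) \<and> int (card (T \<inter> C i)) \<le> hi i)}"
      unfolding chain_matroid_def U C_def[symmetric] k_def[symmetric] mem_Collect_eq lo_iff
      by (auto intro: antisym)
  qed
  then have "x \<in> matroid_polytope (chain_matroid Qs) \<longleftrightarrow> in_cube {1..m} x \<and>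
      (\<forall>i\<in>{..length Qs}. of_int (lo i) \<le> (\<Sum>e\<in>C i. Poly_Mapping.lookup x e) \<and>
        (\<Sum>e\<in>C i. Poly_Mapping.lookup x e) \<le> of_int (hi i))"
    unfolding matroid_polytope_eq
    using convex_hull_vertices_iff[OF f, of "{..length Qs}" k C x lo hi] km prefix by simp
  also have "\<dots> \<longleftrightarrow> in_cube {1..m} x \<and> excess x {1..m} = 0 \<and> (\<forall>i\<le>length Qs. 0 \<le> excess x (C i))"
  proof (intro conj_cong refl)
    assume x: "in_cube {1..m} x"
    have le: "(\<Sum>e\<in>C i. Poly_Mapping.lookup x e) \<le> k i" for i
      using sum_bounded_above[of "C i" "Poly_Mapping.lookup x" 1] x by (simp add: in_cube_def k_def)
    have 0: "excess x {1..m} = (\<Sum>e\<in>C (length Qs). Poly_Mapping.lookup x e) - k (length Qs) / 2"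
      unfolding C_len[symmetric] excess_eq k_def ..
    show "(\<forall>i\<in>{..length Qs}. of_int (lo i) \<le> (\<Sum>e\<in>C i. Poly_Mapping.lookup x e) \<and>
        (\<Sum>e\<in>C i. Poly_Mapping.lookup x e) \<le> of_int (hi i)) \<longleftrightarrow>
      excess x {1..m} = 0 \<and> (\<forall>i\<le>length Qs. 0 \<le> excess x (C i))"
      (is "?L \<longleftrightarrow> ?R")
    proof
      assume L: ?L
      have "excess x {1..m} = 0"
        using bspec[OF L, of "length Qs"] unfolding lo hi 0 by simp
      moreover have "0 \<le> excess x (C i)" if "i \<le> length Qs" for i
        using bspec[OF L, of i] that unfolding lo excess_eq k_def[symmetric] by simp
      ultimately show ?R by blast
    next
      assume R: ?R
      show ?L
      proof (intro ballI conjI)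
        fix i assume "i \<in> {..length Qs}"
        then show "of_int (lo i) \<le> (\<Sum>e\<in>C i. Poly_Mapping.lookup x e)"
          using R unfolding lo excess_eq k_def[symmetric] by simp
        show "(\<Sum>e\<in>C i. Poly_Mapping.lookup x e) \<le> of_int (hi i)"
          using R le[of i] unfolding hi 0 by simp
      qed
    qed
  qed
  also have "(\<forall>i\<le>length Qs. 0 \<le> excess x (C i)) \<longleftrightarrow> prefix_nonneg 0 (map (excess x) Qs)"
    unfolding prefix_nonneg_iff_take C_def excess_def sum_prefix_Union[OF Qs] add_0 ..
  finally show ?thesis .
qed

text \<open>For a partition of the ground set into blocks of even size this is the direct sum of the
  \<open>U_{j,2j}\<close> on the blocks, by \<open>direct_sum_uniform\<close>; the counting form is
  the one that leads to inequalities.\<close>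

definition half_uniform :: "nat set set \<Rightarrow> nat set set" where
  "half_uniform P = {T. T \<subseteq> \<Union>P \<and> (\<forall>A\<in>P. 2 * card (T \<inter> A) = card A)}"

text \<open>Trades conditions on disjoint blocks for conditions on a chain. It is applied twice
  below, to counts in a set \<open>T\<close> and to coordinates of a point.\<close>

lemma prefix_sums_zero_iff:
  fixes h :: "'b \<Rightarrow> 'a::group_add"
  shows "(\<forall>i\<le>length zs. sum_list (map h (take i zs)) = 0) \<longleftrightarrow> (\<forall>z\<in>set zs. h z = 0)"
proof
  assume L: "\<forall>i\<le>length zs. sum_list (map h (take i zs)) = 0"
  show "\<forall>z\<in>set zs. h z = 0"
  proof
    fix z assume "z \<in> set zs"
    then obtain i where i: "i < length zs" "z = zs ! i" by (auto simp: in_set_conv_nth)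
    then have "sum_list (map h (take (Suc i) zs)) = sum_list (map h (take i zs)) + h z"
      by (simp add: take_Suc_conv_app_nth)
    then show "h z = 0" using L i by simp
  qed
next
  assume "\<forall>z\<in>set zs. h z = 0"
  then have "map h (take i zs) = map (\<lambda>_. 0) (take i zs)" for i by (auto dest: in_set_takeD)
  then show "\<forall>i\<le>length zs. sum_list (map h (take i zs)) = 0" by (simp del: map_eq_conv)
qed

lemma even_chain_if_partition:
  assumes P: "partition_on {1..m} P" "\<And>A. A \<in> P \<Longrightarrow> even (card A)"
    and Qs: "set Qs = P" "distinct Qs"
  shows "even_chain m Qs"
proof -
  have "sorted_wrt disjnt Qs"
    unfolding sorted_wrt_iff_nth_less
  proof (intro allI impI)
    fix i j assume ij: "i < j" "j < length Qs"
    then have "Qs ! i \<noteq> Qs ! j" using Qs by (simp add: nth_eq_iff_index_eq)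
    moreover have "Qs ! i \<in> P" "Qs ! j \<in> P" using ij Qs(1) nth_mem[of i Qs] nth_mem[of j Qs] by auto
    ultimately show "disjnt (Qs ! i) (Qs ! j)" using P(1) by (auto simp: partition_on_def disjnt_def disjoint_def)
  qed
  then show ?thesis using P Qs(1) by (auto simp: even_chain_def partition_on_def)
qed

lemma ex_chain_of_partition:
  assumes P: "partition_on {1..m} P" "\<And>A. A \<in> P \<Longrightarrow> even (card A)"
  obtains Qs where "set Qs = P" "even_chain m Qs"
proof -
  have "finite P" using P(1) by (rule finite_elements[rotated]) simp
  then obtain Qs where Qs: "set Qs = P" "distinct Qs" using finite_distinct_list by blast
  show thesis by (rule that[OF Qs(1)]) (rule even_chain_if_partition[OF P Qs])
qed

text \<open>Once the blocks are listed, their equations are equivalent to equations on the prefix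
  unions, a chain with equal lower and upper bounds \<open>lo\<close>.\<close>

lemma polytope_half_uniform:
  assumes P: "partition_on {1..m} P" "\<And>A. A \<in> P \<Longrightarrow> even (card A)"
  shows "x \<in> matroid_polytope (half_uniform P) \<longleftrightarrow> in_cube {1..m} x \<and> (\<forall>A\<in>P. excess x A = 0)"
proof -
  obtain Qs where QsP: "set Qs = P" and Qs: "even_chain m Qs"
    using ex_chain_of_partition[of m P] assms by blast
  have U: "\<Union>(set Qs) = {1..m}" "sorted_wrt disjnt Qs" using Qs by (auto simp: even_chain_def)
  note fin = even_chain_finite[OF Qs]
  define C where "C i = \<Union>(set (take i Qs))" for i
  define k where "k i = card (C i)" for i
  have k: "even (k i)" for i unfolding k_def C_def by (rule even_card_prefix_Union[OF Qs])
  have CU: "C i \<subseteq> {1..m}" for i unfolding C_def using prefix_Union_subset[of i Qs] unfolding U .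
  have km: "k i \<le> m" for i unfolding k_def using card_mono[OF _ CU[of i]] by simp
  obtain f where f: "bij_betw f {1..m} {1..m}" and prefix: "\<forall>i\<le>length Qs. C i = f ` {1..k i}"
    using ex_enumeration[OF U(2) fin(1)] unfolding U k_def C_def by auto
  define lo where "lo i = int (k i div 2)" for i
  have half: "real (k i div 2) = k i / 2" for i using k[of i] by (simp add: real_of_nat_div)
  have lo: "real_of_int (lo i) = k i / 2" for i by (simp add: lo_def half)
  have "half_uniform P = {T. T \<subseteq> {1..m} \<and>
      (\<forall>i\<in>{..length Qs}. lo i \<le> int (card (T \<inter> C i)) \<and> int (card (T \<inter> C i)) \<le> lo i)}"
  proof (rule set_eqI)
    fix T
    \<comment> \<open>Twice the excess of the 0/1 point of \<open>T\<close>; as a sum over elements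
      it is additive along the prefix unions.\<close>
    define h :: "nat set \<Rightarrow> int" where "h A = (\<Sum>e\<in>A. 2 * of_bool (e \<in> T) - 1)" for A
    have h: "h A = 2 * int (card (T \<inter> A)) - int (card A)" if "finite A" for A
      using that by (simp add: h_def sum_subtractf sum_distrib_left[symmetric] Int_commute)
    have finC: "finite (C i)" for i unfolding C_def by (rule fin)
    have "(\<forall>A\<in>P. 2 * card (T \<inter> A) = card A) \<longleftrightarrow> (\<forall>A\<in>P. h A = 0)"
      using fin(1) QsP by (intro ball_cong refl) (auto simp: h)
    also have "\<dots> \<longleftrightarrow> (\<forall>i\<le>length Qs. h (C i) = 0)"
      unfolding QsP[symmetric] prefix_sums_zero_iff[symmetric] C_def h_def sum_prefix_Union[OF Qs] ..
    also have "\<dots> \<longleftrightarrow> (\<forall>i\<in>{..length Qs}. lo i \<le> int (card (T \<inter> C i)) \<and> int (card (T \<inter> C i)) \<le> lo i)"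
    proof -
      have "h (C i) = 0 \<longleftrightarrow> lo i \<le> int (card (T \<inter> C i)) \<and> int (card (T \<inter> C i)) \<le> lo i" for i
        unfolding h[OF finC] lo_def k_def[symmetric] using k[of i] by presburger
      then show ?thesis by auto
    qed
    finally show "T \<in> half_uniform P \<longleftrightarrow> T \<in> {T. T \<subseteq> {1..m} \<and>
      (\<forall>i\<in>{..length Qs}. lo i \<le> int (card (T \<inter> C i)) \<and> int (card (T \<inter> C i)) \<le> lo i)}"
      using U QsP by (simp add: half_uniform_def)
  qed
  then have "x \<in> matroid_polytope (half_uniform P) \<longleftrightarrow> in_cube {1..m} x \<and>
      (\<forall>i\<in>{..length Qs}. of_int (lo i) \<le> (\<Sum>e\<in>C i. Poly_Mapping.lookup x e) \<and>
        (\<Sum>e\<in>C i. Poly_Mapping.lookup x e) \<le> of_int (lo i))"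
    unfolding matroid_polytope_eq
    using convex_hull_vertices_iff[OF f, of "{..length Qs}" k C x lo lo] km prefix by simp
  also have "\<dots> \<longleftrightarrow> in_cube {1..m} x \<and> (\<forall>i\<le>length Qs. excess x (C i) = 0)"
    unfolding lo excess_eq k_def[symmetric] by (auto intro: antisym)
  also have "(\<forall>i\<le>length Qs. excess x (C i) = 0) \<longleftrightarrow> (\<forall>A\<in>P. excess x A = 0)"
    unfolding QsP[symmetric] prefix_sums_zero_iff[symmetric] C_def excess_def sum_prefix_Union[OF Qs] ..
  finally show ?thesis .
qed

section \<open>Schubert expansions\<close>

text \<open>Stated for functions rather than for matroids, to be closed under integer combinations
  and to cover systems that mix equations and inequalities.\<close>

definition schubert_expandable :: "nat \<Rightarrow> nat \<Rightarrow> ((nat \<Rightarrow>\<^sub>0 real) \<Rightarrow> int) \<Rightarrow> bool" where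
  "schubert_expandable k m g \<longleftrightarrow> (\<exists>c. \<forall>x. g x = (\<Sum>S\<in>schubert_matroids k m. c S * indicator (matroid_polytope S) x))"

lemma sum_of_bool_eq_mult:
  assumes "finite A" "a \<in> A"
  shows "(\<Sum>x\<in>A. of_bool (x = a) * g x) = (g a :: int)"
proof -
  have "(\<Sum>x\<in>A. of_bool (x = a) * g x) = (\<Sum>x\<in>A. if x = a then g x else 0)"
    by (intro sum.cong) auto
  then show ?thesis using assms by simp
qed

lemma schubert_expandable_indicator:
  assumes "S \<in> schubert_matroids k m"
  shows "schubert_expandable k m (indicator (matroid_polytope S))"
  unfolding schubert_expandable_def
  by (rule exI[of _ "\<lambda>R. of_bool (R = S)"]) (simp only: sum_of_bool_eq_mult[OF finite_schubert_matroids assms] simp_thms)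

lemma schubert_expandable_add:
  assumes "schubert_expandable k m g" "schubert_expandable k m h"
  shows "schubert_expandable k m (\<lambda>x. g x + h x)"
proof -
  obtain c d where "\<And>x. g x = (\<Sum>S\<in>schubert_matroids k m. c S * indicator (matroid_polytope S) x)"
    "\<And>x. h x = (\<Sum>S\<in>schubert_matroids k m. d S * indicator (matroid_polytope S) x)"
    using assms by (auto simp: schubert_expandable_def)
  then show ?thesis unfolding schubert_expandable_def
    by (intro exI[of _ "\<lambda>S. c S + d S"]) (simp add: sum.distrib distrib_right)
qed

lemma schubert_expandable_uminus:
  assumes "schubert_expandable k m g"
  shows "schubert_expandable k m (\<lambda>x. - g x)"
proof -
  obtain c where "\<And>x. g x = (\<Sum>S\<in>schubert_matroids k m. c S * indicator (matroid_polytope S) x)"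
    using assms by (auto simp: schubert_expandable_def)
  then show ?thesis unfolding schubert_expandable_def
    by (intro exI[of _ "\<lambda>S. - c S"]) (simp add: sum_negf)
qed

lemma schubert_expandable_sum_list:
  assumes "\<And>z. z \<in> set zs \<Longrightarrow> schubert_expandable k m (h z)"
  shows "schubert_expandable k m (\<lambda>x. \<Sum>z\<leftarrow>zs. h z x)"
  using assms
proof (induction zs)
  case Nil
  show ?case unfolding schubert_expandable_def by (rule exI[of _ "\<lambda>_. 0"]) simp
qed (simp add: schubert_expandable_add)

section \<open>Trading equations for inequalities\<close>

lemma insertions_disjnt:
  assumes "sorted_wrt disjnt (A # Qs)" "Rs \<in> set (insertions A Qs)"
  shows "sorted_wrt disjnt Rs \<and> set Rs = insert A (set Qs)"
  using assms
proof (induction Qs arbitrary: Rs)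
  case (Cons Q Qs)
  from Cons.prems(2) consider "Rs = A # Q # Qs" | Rs' where "Rs = Q # Rs'" "Rs' \<in> set (insertions A Qs)" by auto
  then show ?case
  proof cases
    case (2 Rs')
    then have IH: "sorted_wrt disjnt Rs' \<and> set Rs' = insert A (set Qs)"
      using Cons.IH[of Rs'] Cons.prems(1) by simp
    have "disjnt Q R" if "R \<in> set Rs'" for R
      using that IH Cons.prems(1) disjnt_sym[of A Q] by auto
    then show ?thesis using IH 2(1) by auto
  qed (use Cons.prems in auto)
qed simp

lemma mergings_disjnt:
  assumes "sorted_wrt disjnt (A # Qs)" "Rs \<in> set (mergings A Qs)"
  shows "sorted_wrt disjnt Rs \<and> \<Union>(set Rs) = A \<union> \<Union>(set Qs) \<and> set Rs \<subseteq> set Qs \<union> (\<union>) A ` set Qs"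
  using assms
proof (induction Qs arbitrary: Rs)
  case (Cons Q Qs)
  from Cons.prems(2) consider "Rs = (A \<union> Q) # Qs" | Rs' where "Rs = Q # Rs'" "Rs' \<in> set (mergings A Qs)" by auto
  then show ?case
  proof cases
    case 1
    then show ?thesis using Cons.prems(1) by (auto simp: disjnt_Un1)
  next
    case (2 Rs')
    then have IH: "sorted_wrt disjnt Rs'" "\<Union>(set Rs') = A \<union> \<Union>(set Qs)" "set Rs' \<subseteq> set Qs \<union> (\<union>) A ` set Qs"
      using Cons.IH[of Rs'] Cons.prems(1) by simp_all
    have "disjnt Q R" if "R \<in> set Rs'" for R
      using that IH(3) Cons.prems(1) disjnt_sym[of A Q] by (auto simp: disjnt_Un2)
    then show ?thesis using 2 IH by auto
  qed
qed simp

lemma excess_Un: "finite A \<Longrightarrow> finite Q \<Longrightarrow> disjnt A Q \<Longrightarrow> excess x (A \<union> Q) = excess x A + excess x Q"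
  unfolding excess_def disjnt_def by (rule sum.union_disjoint)

text \<open>The blocks in \<open>As\<close> are subject to equations, those in \<open>Qs\<close> to
  prefix inequalities. Without \<open>As\<close> this is the polytope of a Schubert matroid; the
  induction moves one block at a time from \<open>As\<close> into \<open>Qs\<close> by
  \<open>insertions_minus_mergings\<close>. The case of empty \<open>Qs\<close> gives the direct
  sums.\<close>

lemma schubert_expandable_chain:
  assumes "even_chain (2 * n) (As @ Qs)"
  shows "schubert_expandable n (2 * n) (\<lambda>x. of_bool (in_cube {1..2 * n} x \<and> excess x {1..2 * n} = 0 \<and>
    (\<forall>A\<in>set As. excess x A = 0) \<and> prefix_nonneg 0 (map (excess x) Qs)))"
  using assms
proof (induction As arbitrary: Qs)
  case Nil
  then have "even_chain (2 * n) Qs" by simp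
  then have "(\<lambda>x. of_bool (in_cube {1..2 * n} x \<and> excess x {1..2 * n} = 0 \<and>
    (\<forall>A\<in>set []. excess x A = 0) \<and> prefix_nonneg 0 (map (excess x) Qs))) =
    (indicator (matroid_polytope (chain_matroid Qs)) :: _ \<Rightarrow> int)"
    by (intro ext) (simp add: indicator_def polytope_chain_matroid)
  then show ?case
    using schubert_expandable_indicator[OF chain_matroid_schubert[OF \<open>even_chain (2 * n) Qs\<close>]] by simp
next
  case (Cons A As)
  define h where "h Rs x = (of_bool (in_cube {1..2 * n} x \<and> excess x {1..2 * n} = 0 \<and>
    (\<forall>A\<in>set As. excess x A = 0) \<and> prefix_nonneg 0 (map (excess x) Rs)) :: int)" for Rs x
  have chain: "sorted_wrt disjnt As" "sorted_wrt disjnt (A # Qs)" "\<Union>(set As) \<union> A \<union> \<Union>(set Qs) = {1..2 * n}"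
    "\<And>B. B \<in> set As \<Longrightarrow> disjnt B A \<and> (\<forall>Q\<in>set Qs. disjnt B Q)"
    using Cons.prems by (auto simp: even_chain_def sorted_wrt_append intro: disjnt_sym)
  have even: "even (card B)" if "B \<in> set As \<or> B = A \<or> B \<in> set Qs" for B
    using Cons.prems that by (auto simp: even_chain_def)
  have fin: "finite B" if "B \<in> set As \<or> B = A \<or> B \<in> set Qs" for B
    using even_chain_finite(1)[OF Cons.prems] that by auto
  have "schubert_expandable n (2 * n) (h Rs)" if "Rs \<in> set (insertions A Qs)" for Rs
    unfolding h_def
  proof (rule Cons.IH)
    note Rs = insertions_disjnt[OF chain(2) that]
    show "even_chain (2 * n) (As @ Rs)"
      using chain Rs even by (auto simp: even_chain_def sorted_wrt_append)
  qed
  moreover have "schubert_expandable n (2 * n) (h Rs)" if "Rs \<in> set (mergings A Qs)" for Rs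
    unfolding h_def
  proof (rule Cons.IH)
    note Rs = mergings_disjnt[OF chain(2) that]
    have "even (card (A \<union> Q))" if "Q \<in> set Qs" for Q
      using that chain(2) even fin card_Un_disjnt[of A Q] by simp
    then have "even (card R)" if "R \<in> set Rs" for R using that Rs even by auto
    moreover have "disjnt B R" if "B \<in> set As" "R \<in> set Rs" for B R
      using that Rs chain(4)[OF that(1)] by (auto simp: disjnt_Un2)
    moreover have "\<Union>(set (As @ Rs)) = {1..2 * n}" using Rs chain(3) by auto
    ultimately show "even_chain (2 * n) (As @ Rs)"
      using chain(1) Rs even by (auto simp: even_chain_def sorted_wrt_append)
  qed
  ultimately have "schubert_expandable n (2 * n)
      (\<lambda>x. (\<Sum>Rs\<leftarrow>insertions A Qs. h Rs x) + - (\<Sum>Rs\<leftarrow>mergings A Qs. h Rs x))"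
    by (intro schubert_expandable_add schubert_expandable_uminus schubert_expandable_sum_list) auto
  also have "(\<lambda>x. (\<Sum>Rs\<leftarrow>insertions A Qs. h Rs x) + - (\<Sum>Rs\<leftarrow>mergings A Qs. h Rs x)) =
    (\<lambda>x. of_bool (in_cube {1..2 * n} x \<and> excess x {1..2 * n} = 0 \<and>
    (\<forall>A\<in>set (A # As). excess x A = 0) \<and> prefix_nonneg 0 (map (excess x) Qs)))"
  proof
    fix x
    define w where "w = excess x"
    define G where "G \<longleftrightarrow> in_cube {1..2 * n} x \<and> w {1..2 * n} = 0 \<and> (\<forall>A\<in>set As. w A = 0)"
    have h: "h Rs x = of_bool G * of_bool (prefix_nonneg 0 (map w Rs))" for Rs
      by (auto simp: h_def G_def w_def)
    have "(\<Sum>Rs\<leftarrow>insertions A Qs. h Rs x) + - (\<Sum>Rs\<leftarrow>mergings A Qs. h Rs x) =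
      of_bool G * ((\<Sum>Rs\<leftarrow>insertions A Qs. of_bool (prefix_nonneg 0 (map w Rs))) -
        (\<Sum>Rs\<leftarrow>mergings A Qs. of_bool (prefix_nonneg 0 (map w Rs))))"
      unfolding h sum_list_const_mult by (simp add: right_diff_distrib)
    also have "\<dots> = of_bool (G \<and> w A = 0 \<and> prefix_nonneg 0 (map w Qs))"
    proof (cases G)
      case True
      have "w {1..2 * n} = (\<Sum>B\<leftarrow>As @ A # Qs. w B)"
      proof -
        have U: "\<Union>(set (As @ A # Qs)) = {1..2 * n}" using chain(3) by auto
        have "sorted_wrt disjnt (As @ A # Qs)"
          using Cons.prems chain(4) by (simp add: even_chain_def sorted_wrt_append)
        then show ?thesis
          unfolding w_def excess_def U[symmetric] by (rule sum_Union_list) (use fin in auto)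
      qed
      moreover have "(\<Sum>B\<leftarrow>As. w B) = 0"
        using True by (simp add: G_def cong: map_cong)
      ultimately have total: "w A + sum_list (map w Qs) = 0" using True by (simp add: G_def)
      have "w (A \<union> Q) = w A + w Q" if "Q \<in> set Qs" for Q
        unfolding w_def using that chain(2) fin by (intro excess_Un) auto
      then have "(\<Sum>Rs\<leftarrow>insertions A Qs. of_bool (prefix_nonneg 0 (map w Rs))) -
        (\<Sum>Rs\<leftarrow>mergings A Qs. of_bool (prefix_nonneg 0 (map w Rs))) =
        (of_bool (prefix_nonneg (if 0 \<le> w A then 0 else 0 + w A) (map w Qs)) :: int)"
        using total by (intro insertions_minus_mergings) auto
      \<comment> \<open>If \<open>w A < 0\<close>, the partial sums start below 0; if
        \<open>w A > 0\<close>, they start at 0 and end at \<open>- w A\<close>. Only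
        \<open>w A = 0\<close> survives.\<close>
      also have "prefix_nonneg (if 0 \<le> w A then 0 else 0 + w A) (map w Qs) \<longleftrightarrow>
        w A = 0 \<and> prefix_nonneg 0 (map w Qs)"
      proof -
        have "0 \<le> b \<and> 0 \<le> b + sum_list (map w Qs)" if "prefix_nonneg b (map w Qs)" for b
          using that prefix_nonneg_iff_append[of b w Qs] by (metis add_0_right append_Nil append_Nil2 list.map(1) sum_list.Nil)
        from this[of 0] this[of "w A"] total show ?thesis by (cases "w A" "0::real" rule: linorder_cases) auto
      qed
      finally show ?thesis using True by simp
    qed simp
    finally show "(\<Sum>Rs\<leftarrow>insertions A Qs. h Rs x) + - (\<Sum>Rs\<leftarrow>mergings A Qs. h Rs x) =
      of_bool (in_cube {1..2 * n} x \<and> excess x {1..2 * n} = 0 \<and>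
      (\<forall>A\<in>set (A # As). excess x A = 0) \<and> prefix_nonneg 0 (map (excess x) Qs))"
      by (auto simp: G_def w_def)
  qed
  finally show ?case .
qed

lemma schubert_expandable_half_uniform:
  assumes P: "partition_on {1..2 * n} P" "\<And>A. A \<in> P \<Longrightarrow> even (card A)"
  shows "schubert_expandable n (2 * n) (indicator (matroid_polytope (half_uniform P)))"
proof -
  obtain Qs where Qs: "set Qs = P" "even_chain (2 * n) Qs"
    using ex_chain_of_partition[of "2 * n" P] assms by blast
  have "excess x {1..2 * n} = (\<Sum>A\<leftarrow>Qs. excess x A)" for x
    unfolding excess_def using sum_Union_list[of Qs] Qs(2) even_chain_finite(1)[OF Qs(2)]
    by (auto simp: even_chain_def)
  then have "excess x {1..2 * n} = 0" if "\<forall>A\<in>P. excess x A = 0" for x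
    using that unfolding Qs(1)[symmetric] by (simp cong: map_cong)
  then have "(\<lambda>x. of_bool (in_cube {1..2 * n} x \<and> excess x {1..2 * n} = 0 \<and>
    (\<forall>A\<in>set Qs. excess x A = 0) \<and> prefix_nonneg 0 (map (excess x) []))) =
    (indicator (matroid_polytope (half_uniform P)) :: _ \<Rightarrow> int)"
    by (intro ext) (auto simp: indicator_def polytope_half_uniform[OF P] Qs(1))
  then show ?thesis using schubert_expandable_chain[of n Qs "[]"] Qs(2) by simp
qed

section \<open>Uniqueness and linearity of the coordinates\<close>

text \<open>Resolves the definite description: by \<open>schubert_polytopes_independent\<close> any
  integer expansion is the expansion.\<close>

lemma lookup_schubert_coords:
  assumes c: "\<And>x. (indicator (matroid_polytope M) x :: int) =
      (\<Sum>S\<in>schubert_matroids k m. c S * indicator (matroid_polytope S) x)"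
    and R: "R \<in> schubert_matroids k m"
  shows "Poly_Mapping.lookup (schubert_coords k m M) R = c R"
proof -
  define d where "d = (\<Sum>S\<in>schubert_matroids k m. Poly_Mapping.single S (c S))"
  have d: "Poly_Mapping.lookup d S = (if S \<in> schubert_matroids k m then c S else 0)" for S
    by (simp add: d_def lookup_sum lookup_single when_def)
  have "schubert_coords k m M = d"
    unfolding schubert_coords_def
  proof (rule the_equality)
    show "Poly_Mapping.keys d \<subseteq> schubert_matroids k m \<and>
      (\<forall>x. (indicator (matroid_polytope M) x :: int) =
        (\<Sum>S\<in>schubert_matroids k m. Poly_Mapping.lookup d S * indicator (matroid_polytope S) x))"
      by (auto simp: c d in_keys_iff split: if_splits)
  next
    fix e assume e: "Poly_Mapping.keys e \<subseteq> schubert_matroids k m \<and>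
      (\<forall>x. (indicator (matroid_polytope M) x :: int) =
        (\<Sum>S\<in>schubert_matroids k m. Poly_Mapping.lookup e S * indicator (matroid_polytope S) x))"
    have "Poly_Mapping.lookup e S - c S = 0" if "S \<in> schubert_matroids k m" for S
    proof (rule schubert_polytopes_independent[OF _ that])
      fix x
      show "(\<Sum>S\<in>schubert_matroids k m. (Poly_Mapping.lookup e S - c S) * indicator (matroid_polytope S) x) = 0"
        using e c[of x] by (simp add: left_diff_distrib sum_subtractf)
    qed
    then show "e = d"
      using e by (intro poly_mapping_eqI) (auto simp: d in_keys_iff)
  qed
  then show ?thesis using R by (simp add: d)
qed

lemma coord_vector_eq:
  assumes c: "\<And>x. (indicator (matroid_polytope M) x :: int) =
      (\<Sum>S\<in>schubert_matroids k m. c S * indicator (matroid_polytope S) x)"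
  shows "coord_vector k m M = (\<Sum>S\<in>schubert_matroids k m. Poly_Mapping.single (iso_class m S) (of_int (c S)))"
  unfolding coord_vector_def using lookup_schubert_coords[OF c] by (intro sum.cong) auto

lemma coord_vector_schubert:
  assumes S: "S \<in> schubert_matroids k m"
  shows "coord_vector k m S = Poly_Mapping.single (iso_class m S) 1"
proof -
  have "coord_vector k m S =
      (\<Sum>R\<in>schubert_matroids k m. Poly_Mapping.single (iso_class m R) (of_int (of_bool (R = S))))"
    by (rule coord_vector_eq) (simp only: sum_of_bool_eq_mult[OF finite_schubert_matroids S])
  also have "\<dots> = (\<Sum>R\<in>schubert_matroids k m. if R = S then Poly_Mapping.single (iso_class m S) 1 else 0)"
    by (intro sum.cong) auto
  finally show ?thesis using S by simp
qed

lemma sum_single: "(\<Sum>i\<in>I. Poly_Mapping.single k (f i)) = Poly_Mapping.single k (sum f I)"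
  by (rule poly_mapping_eqI) (simp add: lookup_sum lookup_single when_def)

lemma sum_sum_mult_swap:
  fixes e :: "'i \<Rightarrow> 'a::comm_semiring_0"
  shows "(\<Sum>s\<in>A. (\<Sum>i\<in>L. e i * c i s) * g s) = (\<Sum>i\<in>L. e i * (\<Sum>s\<in>A. c i s * g s))"
  by (simp add: sum_distrib_left sum_distrib_right mult.assoc sum.swap[of _ A])

lemma sum_scaleR_coord_vector:
  assumes "\<And>i x. i \<in> L \<Longrightarrow> (indicator (matroid_polytope (M i)) x :: int) =
      (\<Sum>S\<in>schubert_matroids k m. c i S * indicator (matroid_polytope S) x)"
  shows "(\<Sum>i\<in>L. of_int (e i) *\<^sub>R coord_vector k m (M i)) =
    (\<Sum>S\<in>schubert_matroids k m. Poly_Mapping.single (iso_class m S) (of_int (\<Sum>i\<in>L. e i * c i S)))"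
proof -
  have "(\<Sum>i\<in>L. of_int (e i) *\<^sub>R coord_vector k m (M i)) =
      (\<Sum>i\<in>L. \<Sum>S\<in>schubert_matroids k m. Poly_Mapping.single (iso_class m S) (of_int (e i * c i S)))"
    by (intro sum.cong refl) (simp add: coord_vector_eq[OF assms] scaleR_sum_right scaleR_single)
  also have "\<dots> = (\<Sum>S\<in>schubert_matroids k m. Poly_Mapping.single (iso_class m S) (of_int (\<Sum>i\<in>L. e i * c i S)))"
    by (subst sum.swap) (simp add: sum_single)
  finally show ?thesis .
qed

text \<open>Substituting the expansions turns the relation into one between Schubert polytopes, so
  both sides have the same coefficient at each Schubert matroid, and hence the same image under the
  projection to isomorphism classes.\<close>

lemma sum_coord_vector_eq:
  fixes a :: "'i \<Rightarrow> int" and b :: "'j \<Rightarrow> int"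
  assumes M: "\<And>i. i \<in> I \<Longrightarrow> schubert_expandable k m (indicator (matroid_polytope (M i)))"
    and N: "\<And>j. j \<in> J \<Longrightarrow> schubert_expandable k m (indicator (matroid_polytope (N j)))"
    and eq: "\<And>x. (\<Sum>i\<in>I. a i * indicator (matroid_polytope (M i)) x) = (\<Sum>j\<in>J. b j * indicator (matroid_polytope (N j)) x)"
  shows "(\<Sum>i\<in>I. of_int (a i) *\<^sub>R coord_vector k m (M i)) = (\<Sum>j\<in>J. of_int (b j) *\<^sub>R coord_vector k m (N j))"
proof -
  define Sch where "Sch = schubert_matroids k m"
  obtain c where c: "\<And>i x. i \<in> I \<Longrightarrow> (indicator (matroid_polytope (M i)) x :: int) = (\<Sum>S\<in>Sch. c i S * indicator (matroid_polytope S) x)"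
    using M unfolding schubert_expandable_def Sch_def by metis
  obtain d where d: "\<And>j x. j \<in> J \<Longrightarrow> (indicator (matroid_polytope (N j)) x :: int) = (\<Sum>S\<in>Sch. d j S * indicator (matroid_polytope S) x)"
    using N unfolding schubert_expandable_def Sch_def by metis
  have coeff: "(\<Sum>i\<in>I. a i * c i S) - (\<Sum>j\<in>J. b j * d j S) = 0" if "S \<in> Sch" for S
    unfolding Sch_def
  proof (rule schubert_polytopes_independent)
    fix x
    show "(\<Sum>S\<in>schubert_matroids k m. ((\<Sum>i\<in>I. a i * c i S) - (\<Sum>j\<in>J. b j * d j S)) * indicator (matroid_polytope S) x) = 0"
      unfolding left_diff_distrib sum_subtractf Sch_def[symmetric] sum_sum_mult_swap
      using eq[of x] by (simp flip: c d)
  qed (use that in \<open>simp add: Sch_def\<close>)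
  have "(\<Sum>i\<in>I. of_int (a i) *\<^sub>R coord_vector k m (M i)) =
      (\<Sum>S\<in>Sch. Poly_Mapping.single (iso_class m S) (of_int (\<Sum>i\<in>I. a i * c i S)))"
    unfolding Sch_def by (rule sum_scaleR_coord_vector) (use c in \<open>simp add: Sch_def\<close>)
  also have "\<dots> = (\<Sum>S\<in>Sch. Poly_Mapping.single (iso_class m S) (of_int (\<Sum>j\<in>J. b j * d j S)))"
    using coeff by (intro sum.cong) auto
  also have "\<dots> = (\<Sum>j\<in>J. of_int (b j) *\<^sub>R coord_vector k m (N j))"
    unfolding Sch_def by (rule sum_scaleR_coord_vector[symmetric]) (use d in \<open>simp add: Sch_def\<close>)
  finally show ?thesis .
qed

section \<open>The Catalan matroid as an average of direct sums\<close>

lemma half_uniform_matroid: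
  assumes P: "partition_on {1..2 * n} P" and even: "\<And>A. A \<in> P \<Longrightarrow> even (card A)"
  shows "half_uniform P \<in> matroids n (2 * n)"
proof -
  have U: "\<Union>P = {1..2 * n}" and disj: "\<And>A B. A \<in> P \<Longrightarrow> B \<in> P \<Longrightarrow> A \<noteq> B \<Longrightarrow> A \<inter> B = {}"
    using P by (auto simp: partition_on_def disjoint_def)
  have finP: "finite P" using P by (rule finite_elements[rotated]) simp
  have finA: "finite A" if "A \<in> P" for A
    using that U finite_subset[of A "{1..2 * n}"] by blast
  have card: "card T = n" if T: "T \<in> half_uniform P" for T
  proof -
    have "T = (\<Union>A\<in>P. T \<inter> A)" using T by (auto simp: half_uniform_def)
    moreover have "card (\<Union>A\<in>P. T \<inter> A) = (\<Sum>A\<in>P. card (T \<inter> A))"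
    proof (rule card_UN_disjoint[OF finP])
      show "\<forall>A\<in>P. \<forall>B\<in>P. A \<noteq> B \<longrightarrow> (T \<inter> A) \<inter> (T \<inter> B) = {}" using disj by blast
    qed (use finA in blast)
    ultimately have "card T = (\<Sum>A\<in>P. card (T \<inter> A))" by simp
    then have "2 * card T = (\<Sum>A\<in>P. card A)"
      using T by (simp add: sum_distrib_left half_uniform_def)
    also have "\<dots> = card (\<Union>P)" using finA disj by (subst card_Union_disjoint) (auto simp: pairwise_def disjnt_def)
    finally show ?thesis using U by simp
  qed
  have fin: "finite T" if "T \<in> half_uniform P" for T
    using that U finite_subset[of T "{1..2 * n}"] by (simp add: half_uniform_def)
  have ne: "half_uniform P \<noteq> {}"
  proof -
    have "\<exists>S\<subseteq>A. card S = card A div 2" if "A \<in> P" for A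
      using obtain_subset_with_card_n[of "card A div 2" A] by (metis div_le_dividend)
    then obtain S where S: "\<And>A. A \<in> P \<Longrightarrow> S A \<subseteq> A \<and> card (S A) = card A div 2" by metis
    have "(\<Union>B\<in>P. S B) \<inter> A = S A" if "A \<in> P" for A
      using S disj that by blast
    then have "(\<Union>B\<in>P. S B) \<in> half_uniform P"
      using S even by (auto simp: half_uniform_def)
    then show ?thesis by blast
  qed
  have "\<exists>y\<in>B' - B. insert y (B - {x}) \<in> half_uniform P"
    if B: "B \<in> half_uniform P" "B' \<in> half_uniform P" and x: "x \<in> B - B'" for B B' x
  proof -
    \<comment> \<open>The exchange takes place inside the block of \<open>x\<close>: both bases have
      equally many elements there, so \<open>B'\<close> offers a replacement from the same
      block.\<close>
    obtain A where A: "A \<in> P" "x \<in> A" using x B by (auto simp: half_uniform_def)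
    have "2 * card (B \<inter> A) = card A" "2 * card (B' \<inter> A) = card A"
      using A B by (auto simp: half_uniform_def)
    then have "card (B \<inter> A) = card (B' \<inter> A)" by linarith
    moreover have "\<not> B \<inter> A \<subseteq> B' \<inter> A" using x A by blast
    ultimately have "\<not> B' \<inter> A \<subseteq> B \<inter> A"
      using card_subset_eq[of "B \<inter> A" "B' \<inter> A"] finA[OF A(1)] by auto
    then obtain y where y: "y \<in> B'" "y \<in> A" "y \<notin> B" by blast
    have "2 * card (insert y (B - {x}) \<inter> C) = card C" if C: "C \<in> P" for C
    proof (cases "C = A")
      case True
      have "insert y (B - {x}) \<inter> A = insert y (B \<inter> A - {x})" using y by auto
      then have "card (insert y (B - {x}) \<inter> A) = card (B \<inter> A)"
        using y x A(2) fin[OF B(1)] card_Suc_Diff1[of "B \<inter> A" x] by simp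
      then show ?thesis using True B(1) A by (auto simp: half_uniform_def)
    next
      case False
      then have "insert y (B - {x}) \<inter> C = B \<inter> C" using disj[OF C A(1)] y(2) A(2) by auto
      then show ?thesis using B(1) C by (auto simp: half_uniform_def)
    qed
    moreover have "insert y (B - {x}) \<subseteq> \<Union>P" using B y A by (auto simp: half_uniform_def)
    ultimately have "insert y (B - {x}) \<in> half_uniform P" by (simp add: half_uniform_def)
    then show ?thesis using y by blast
  qed
  moreover have "T \<subseteq> {1..2 * n}" if "T \<in> half_uniform P" for T
    using that U by (simp add: half_uniform_def)
  ultimately have "is_matroid {1..2 * n} (half_uniform P)"
    unfolding is_matroid_def using ne by blast
  then show ?thesis using card by (auto simp: matroids_def)
qed

lemma direct_sum_uniform:
  assumes P: "partition_on E P" "finite E" and r: "\<forall>A\<in>P. card A = 2 * r A"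
  shows "direct_sum P (\<lambda>A. uniform A (r A)) = half_uniform P"
proof (rule set_eqI)
  fix T
  have disj: "A \<inter> B = {}" if "A \<in> P" "B \<in> P" "A \<noteq> B" for A B
    using P that by (auto simp: partition_on_def disjoint_def)
  show "T \<in> direct_sum P (\<lambda>A. uniform A (r A)) \<longleftrightarrow> T \<in> half_uniform P"
  proof
    assume "T \<in> direct_sum P (\<lambda>A. uniform A (r A))"
    then obtain B where T: "T = (\<Union>A\<in>P. B A)" and B: "\<And>A. A \<in> P \<Longrightarrow> B A \<subseteq> A \<and> card (B A) = r A"
      by (auto simp: direct_sum_def uniform_def)
    have "T \<inter> A = B A" if "A \<in> P" for A unfolding T using B disj that by blast
    then show "T \<in> half_uniform P" using B r T by (auto simp: half_uniform_def)
  next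
    assume T: "T \<in> half_uniform P"
    then have "T = (\<Union>A\<in>P. T \<inter> A)" "\<forall>A\<in>P. T \<inter> A \<in> uniform A (r A)"
      using r by (auto simp: half_uniform_def uniform_def)
    then show "T \<in> direct_sum P (\<lambda>A. uniform A (r A))"
      unfolding direct_sum_def by (intro CollectI exI[of _ "\<lambda>A. T \<inter> A"]) auto
  qed
qed

lemma balanced_uniform_sums_eq:
  "balanced_uniform_sums n = half_uniform ` {P. partition_on {1..2 * n} P \<and> (\<forall>A\<in>P. even (card A))}"
proof (intro equalityI subsetI)
  fix M assume "M \<in> balanced_uniform_sums n"
  then obtain P r where "M = direct_sum P (\<lambda>A. uniform A (r A))" "partition_on {1..2 * n} P" "\<forall>A\<in>P. card A = 2 * r A"
    unfolding balanced_uniform_sums_def by blast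
  then show "M \<in> half_uniform ` {P. partition_on {1..2 * n} P \<and> (\<forall>A\<in>P. even (card A))}"
    by (auto simp: direct_sum_uniform)
next
  fix M assume "M \<in> half_uniform ` {P. partition_on {1..2 * n} P \<and> (\<forall>A\<in>P. even (card A))}"
  then obtain P where P: "M = half_uniform P" "partition_on {1..2 * n} P" "\<forall>A\<in>P. even (card A)" by blast
  then have "M = direct_sum P (\<lambda>A. uniform A (card A div 2))"
    by (subst direct_sum_uniform[of "{1..2 * n}"]) auto
  then show "M \<in> balanced_uniform_sums n"
    unfolding balanced_uniform_sums_def using P by (intro CollectI exI[of _ P] exI[of _ "\<lambda>A. card A div 2"]) auto
qed

section \<open>Pairings of the ground set and isomorphism classes\<close>

lemma ex_pairing:
  assumes "finite A" "even (card A)"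
  shows "\<exists>W. partition_on A W \<and> (\<forall>p\<in>W. card p = 2)"
  using assms
proof (induction "card A" arbitrary: A rule: less_induct)
  case less
  show ?case
  proof (cases "A = {}")
    case True
    then show ?thesis by (intro exI[of _ "{}"]) (simp add: partition_on_empty)
  next
    case False
    then have "2 \<le> card A" using less.prems by (metis One_nat_def Suc_leI card_0_eq dvd_1_left even_Suc le_less less_2_cases_iff not_less_eq_eq numeral_2_eq_2 odd_one)
    then obtain p where p: "p \<subseteq> A" "card p = 2" using obtain_subset_with_card_n by metis
    have "card (A - p) < card A" "even (card (A - p))"
      using p less.prems \<open>2 \<le> card A\<close> by (auto simp: card_Diff_subset finite_subset)
    then obtain W where W: "partition_on (A - p) W" "\<forall>p\<in>W. card p = 2"
      using less.hyps[of "A - p"] less.prems by auto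
    have "disjnt p (\<Union>W)" using W(1) by (auto simp: partition_on_def disjnt_def)
    then have "partition_on A (insert p W)" using W(1) p partition_on_insert[of p W A] by auto
    then show ?thesis using W p by (intro exI[of _ "insert p W"]) auto
  qed
qed

lemma card_Union_pairs:
  assumes "disjoint B" "\<And>A. A \<in> B \<Longrightarrow> card A = 2"
  shows "card (\<Union>B) = 2 * card B"
proof -
  have "finite A" if "A \<in> B" for A using assms(2)[OF that] by (metis card.infinite zero_neq_numeral)
  then have "card (\<Union>B) = (\<Sum>A\<in>B. card A)" using assms(1) by (intro card_Union_disjoint)
  then show ?thesis using assms(2) by simp
qed

lemma partition_on_Union_image:
  assumes W: "partition_on E W" and \<pi>: "partition_on W \<pi>"
  shows "partition_on E (Union ` \<pi>)"
proof (rule partition_onI)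
  show "\<Union>(Union ` \<pi>) = E" using assms by (auto simp: partition_on_def)
  show "{} \<notin> Union ` \<pi>"
  proof
    assume "{} \<in> Union ` \<pi>"
    then obtain B where B: "B \<in> \<pi>" "\<Union>B = {}" by auto
    then obtain A where "A \<in> B" using \<pi> by (metis all_not_in_conv partition_onD3)
    then have "A = {}" "A \<in> W" using B \<pi> by (auto simp: partition_on_def)
    then show False using W by (simp add: partition_on_def)
  qed
  fix p q assume "p \<in> Union ` \<pi>" "q \<in> Union ` \<pi>" "p \<noteq> q"
  then obtain B C where BC: "p = \<Union>B" "q = \<Union>C" "B \<in> \<pi>" "C \<in> \<pi>" "B \<noteq> C" by auto
  have "A \<inter> A' = {}" if "A \<in> B" "A' \<in> C" for A A'
  proof -
    have "A \<in> W" "A' \<in> W" using that BC \<pi> by (auto simp: partition_on_def)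
    moreover have "A \<noteq> A'" using that BC \<pi> by (auto simp: partition_on_def disjoint_def)
    ultimately show ?thesis using W by (auto simp: partition_on_def disjoint_def)
  qed
  then show "disjnt p q" unfolding BC disjnt_def by blast
qed

lemma excess_Union:
  assumes W: "partition_on {1..m} W" and B: "B \<subseteq> W"
  shows "excess x (\<Union>B) = sum (excess x) B"
proof -
  have "finite A" if "A \<in> B" for A
    using W B that finite_subset[of A "{1..m}"] by (auto simp: partition_on_def)
  moreover have "A \<inter> A' = {}" if "A \<in> B" "A' \<in> B" "A \<noteq> A'" for A A'
    using disjointD[OF partition_onD2[OF W], of A A'] B that by blast
  ultimately show ?thesis unfolding excess_def by (subst sum.Union_disjoint) auto
qed

lemma isomorphic_on_sym: "isomorphic_on E M N \<Longrightarrow> (\<And>B. B \<in> M \<Longrightarrow> B \<subseteq> E) \<Longrightarrow> isomorphic_on E N M"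
proof -
  assume "isomorphic_on E M N" and sub: "\<And>B. B \<in> M \<Longrightarrow> B \<subseteq> E"
  then obtain f where f: "bij_betw f E E" "N = (\<lambda>B. f ` B) ` M" by (auto simp: isomorphic_on_def)
  have "inv_into E f ` f ` B = B" if "B \<in> M" for B
    using sub[OF that] f(1) by (simp add: bij_betw_def inv_into_image_cancel)
  then have "M = (\<lambda>B. inv_into E f ` B) ` N" unfolding f(2) image_image by simp
  then show ?thesis using bij_betw_inv_into[OF f(1)] by (auto simp: isomorphic_on_def)
qed

lemma isomorphic_on_trans: "isomorphic_on E L M \<Longrightarrow> isomorphic_on E M N \<Longrightarrow> isomorphic_on E L N"
proof -
  assume "isomorphic_on E L M" "isomorphic_on E M N"
  then obtain f g where fg: "bij_betw f E E" "bij_betw g E E"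
    and "M = (\<lambda>B. f ` B) ` L" "N = (\<lambda>B. g ` B) ` M"
    by (auto simp: isomorphic_on_def)
  then have "N = (\<lambda>B. (g \<circ> f) ` B) ` L" by (simp add: image_image)
  then show ?thesis unfolding isomorphic_on_def using bij_betw_trans[OF fg] by blast
qed

lemma iso_class_eq:
  assumes "isomorphic_on {1..m} M N" "\<And>B. B \<in> M \<Longrightarrow> B \<subseteq> {1..m}"
  shows "iso_class m M = iso_class m N"
proof -
  have "isomorphic_on {1..m} M L \<longleftrightarrow> isomorphic_on {1..m} N L" for L
    using isomorphic_on_trans[OF assms(1), of L] isomorphic_on_trans[OF isomorphic_on_sym[OF assms], of L]
    by (rule iffI[rotated])
  then show ?thesis by (simp add: iso_class_def)
qed

lemma catalan_matroid_schubert: "catalan_matroid n \<in> schubert_matroids n (2 * n)"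
proof -
  define S where "S = (\<lambda>i. 2 * i) ` {1..n}"
  have S: "S \<subseteq> {1..2 * n}" by (auto simp: S_def)
  have C: "catalan_matroid n = SM (2 * n) S" by (simp add: catalan_matroid_def S_def)
  have "card S = n" by (simp add: S_def card_image inj_on_def)
  then have "SM (2 * n) S \<in> matroids n (2 * n)"
    using is_matroid_SM[OF S] by (auto simp: matroids_def SM_def)
  moreover have "isomorphic_on {1..2 * n} (SM (2 * n) S) (SM (2 * n) S)"
    unfolding isomorphic_on_def by (intro exI[of _ id]) auto
  ultimately show ?thesis unfolding C schubert_matroids_def using S by blast
qed

text \<open>At each point \<open>x\<close>, \<open>card_nonneg_orderings\<close> for
  \<open>excess x\<close> on the pairs equates the number of chain polytopes containing
  \<open>x\<close> with the weighted number of direct sum polytopes containing it.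
  \<open>sum_coord_vector_eq\<close> carries this over to coordinates. The chain matroids are
  Schubert matroids isomorphic to C_n, so all of them contribute the same unit vector.\<close>

lemma catalan_coord_vector:
  assumes W: "partition_on {1..2 * n} W" and two: "\<And>A. A \<in> W \<Longrightarrow> card A = 2"
  shows "fact n *\<^sub>R coord_vector n (2 * n) (catalan_matroid n) =
    (\<Sum>\<pi> | partition_on W \<pi>. real (cyclic_orderings \<pi>) *\<^sub>R coord_vector n (2 * n) (half_uniform (Union ` \<pi>)))"
    (is "_ = ?rhs")
    and "(\<Sum>\<pi> | partition_on W \<pi>. real (cyclic_orderings \<pi>)) = fact n"
proof -
  define C where "C = catalan_matroid n"
  have finW: "finite W" using W by (rule finite_elements[rotated]) simp
  have cardU: "card (\<Union>B) = 2 * card B" if "B \<subseteq> W" for B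
    using that two pairwise_subset[OF partition_onD2[OF W] that] by (intro card_Union_pairs) auto
  have cardW: "card W = n" using cardU[of W] W by (simp add: partition_on_def)
  have part: "partition_on {1..2 * n} (Union ` \<pi>)" "\<And>A. A \<in> Union ` \<pi> \<Longrightarrow> even (card A)"
    if \<pi>: "partition_on W \<pi>" for \<pi>
  proof -
    show "partition_on {1..2 * n} (Union ` \<pi>)" by (rule partition_on_Union_image[OF W \<pi>])
    fix A assume "A \<in> Union ` \<pi>"
    then obtain B where "A = \<Union>B" "B \<in> \<pi>" by blast
    moreover have "B \<subseteq> W" using \<pi> \<open>B \<in> \<pi>\<close> by (auto simp: partition_on_def)
    ultimately show "even (card A)" using cardU by simp
  qed
  have chain: "even_chain (2 * n) ws" if "ws \<in> permutations_of_set W" for ws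
    using that by (intro even_chain_if_partition[OF W]) (auto simp: two permutations_of_set_def)
  have iso: "coord_vector n (2 * n) (chain_matroid ws) = coord_vector n (2 * n) C"
    if ws: "ws \<in> permutations_of_set W" for ws
  proof -
    have "isomorphic_on {1..2 * n} C (chain_matroid ws)"
      unfolding C_def using ws two by (intro isomorphic_chain_matroid chain) (auto simp: permutations_of_set_def)
    then have "iso_class (2 * n) C = iso_class (2 * n) (chain_matroid ws)"
      by (rule iso_class_eq) (simp add: C_def catalan_matroid_eq)
    then show ?thesis
      using coord_vector_schubert[OF catalan_matroid_schubert, of n]
        coord_vector_schubert[OF chain_matroid_schubert[OF chain[OF ws]]] by (simp add: C_def)
  qed
  have "(\<Sum>ws\<in>permutations_of_set W. of_int 1 *\<^sub>R coord_vector n (2 * n) (chain_matroid ws)) =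
    (\<Sum>\<pi> | partition_on W \<pi>. of_int (int (cyclic_orderings \<pi>)) *\<^sub>R coord_vector n (2 * n) (half_uniform (Union ` \<pi>)))"
  proof (rule sum_coord_vector_eq)
    show "schubert_expandable n (2 * n) (indicator (matroid_polytope (chain_matroid ws)))"
      if "ws \<in> permutations_of_set W" for ws
      by (rule schubert_expandable_indicator[OF chain_matroid_schubert[OF chain[OF that]]])
    show "schubert_expandable n (2 * n) (indicator (matroid_polytope (half_uniform (Union ` \<pi>))))"
      if "\<pi> \<in> {\<pi>. partition_on W \<pi>}" for \<pi>
      using that part by (intro schubert_expandable_half_uniform) auto
    fix x
    define y where "y = excess x"
    define G where "G \<longleftrightarrow> in_cube {1..2 * n} x \<and> sum y W = 0"
    have yW: "y {1..2 * n} = sum y W"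
      unfolding y_def using excess_Union[OF W subset_refl] W by (simp add: partition_on_def)
    have l: "indicator (matroid_polytope (chain_matroid ws)) x = (of_bool (G \<and> prefix_nonneg 0 (map y ws)) :: int)"
      if "ws \<in> permutations_of_set W" for ws
      using polytope_chain_matroid[OF chain[OF that], of x] yW by (simp add: indicator_def G_def y_def)
    have r: "indicator (matroid_polytope (half_uniform (Union ` \<pi>))) x = (of_bool (G \<and> (\<forall>B\<in>\<pi>. sum y B = 0)) :: int)"
      if \<pi>: "partition_on W \<pi>" for \<pi>
    proof -
      have sub: "B \<subseteq> W" if "B \<in> \<pi>" for B using \<pi> that by (auto simp: partition_on_def)
      have "sum y W = (\<Sum>B\<in>\<pi>. sum y B)"
      proof -
        have "sum y (\<Union>\<pi>) = (\<Sum>B\<in>\<pi>. sum y B)"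
          using \<pi> finW sub by (subst sum.Union_disjoint) (auto simp: partition_on_def disjoint_def intro: finite_subset)
        then show ?thesis using \<pi> by (simp add: partition_on_def)
      qed
      then have "sum y W = 0" if "\<forall>B\<in>\<pi>. sum y B = 0" using that by simp
      moreover have "y (\<Union>B) = sum y B" if "B \<in> \<pi>" for B
        unfolding y_def by (rule excess_Union[OF W sub[OF that]])
      ultimately show ?thesis
        using polytope_half_uniform[OF part[OF \<pi>], of x] by (auto simp: indicator_def G_def simp flip: y_def)
    qed
    have "(\<Sum>ws\<in>permutations_of_set W. 1 * indicator (matroid_polytope (chain_matroid ws)) x) =
        (\<Sum>ws\<in>permutations_of_set W. of_bool G * of_bool (prefix_nonneg 0 (map y ws)) :: int)"
      by (intro sum.cong refl) (auto simp: l)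
    also have "\<dots> = of_bool G * int (card (nonneg_orderings y W))"
      unfolding nonneg_orderings_def
      by (simp add: sum_distrib_left[symmetric] Int_def sum.If_cases of_bool_def[abs_def])
    also have "\<dots> = of_bool G * (\<Sum>\<pi> | partition_on W \<pi>. int (cyclic_orderings \<pi>) * of_bool (\<forall>B\<in>\<pi>. sum y B = 0))"
      using card_nonneg_orderings[OF finW, of y] by (cases G) (auto simp: G_def)
    also have "\<dots> = (\<Sum>\<pi> | partition_on W \<pi>. int (cyclic_orderings \<pi>) * indicator (matroid_polytope (half_uniform (Union ` \<pi>))) x)"
      unfolding sum_distrib_left by (intro sum.cong refl) (auto simp: r)
    finally show "(\<Sum>ws\<in>permutations_of_set W. 1 * indicator (matroid_polytope (chain_matroid ws)) x) =
      (\<Sum>\<pi> | partition_on W \<pi>. int (cyclic_orderings \<pi>) * indicator (matroid_polytope (half_uniform (Union ` \<pi>))) x)" .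
  qed
  also have "(\<Sum>ws\<in>permutations_of_set W. of_int 1 *\<^sub>R coord_vector n (2 * n) (chain_matroid ws)) =
      fact n *\<^sub>R coord_vector n (2 * n) C"
    using finW by (simp add: iso cardW sum_constant_scaleR del: sum_constant)
  finally show "fact n *\<^sub>R coord_vector n (2 * n) (catalan_matroid n) = ?rhs"
    by (simp add: C_def)
  \<comment> \<open>For \<open>y = 0\<close> every ordering and every partition counts, so the same
    identity yields the total weight.\<close>
  have "prefix_nonneg 0 (map (\<lambda>_. 0) ws)" for ws :: "nat set list" by (induction ws) simp_all
  then have "nonneg_orderings (\<lambda>_. 0) W = permutations_of_set W"
    by (auto simp: nonneg_orderings_def)
  then have "(\<Sum>\<pi> | partition_on W \<pi>. cyclic_orderings \<pi>) = fact n"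
    using card_nonneg_orderings[OF finW, of "\<lambda>_. 0"] finW cardW by simp
  then show "(\<Sum>\<pi> | partition_on W \<pi>. real (cyclic_orderings \<pi>)) = fact n"
    by (metis of_nat_fact of_nat_sum)
qed

text \<open>A fixed pairing reaches only the partitions whose blocks are unions of its pairs. Here
  it is adapted to \<open>M\<close> by pairing up the elements inside each block, so the weights
  \<open>\<mu>\<close> depend on \<open>M\<close>.\<close>

lemma catalan_convex_combination:
  assumes M: "M \<in> balanced_uniform_sums n"
  shows "\<exists>\<mu>. (\<forall>z\<in>coord_vector n (2 * n) ` balanced_uniform_sums n. 0 \<le> \<mu> z) \<and>
    0 < \<mu> (coord_vector n (2 * n) M) \<and> sum \<mu> (coord_vector n (2 * n) ` balanced_uniform_sums n) = 1 \<and>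
    coord_vector n (2 * n) (catalan_matroid n) = (\<Sum>z\<in>coord_vector n (2 * n) ` balanced_uniform_sums n. \<mu> z *\<^sub>R z)"
proof -
  define p where "p = coord_vector n (2 * n)"
  define Z where "Z = p ` balanced_uniform_sums n"
  have finZ: "finite Z"
    unfolding Z_def balanced_uniform_sums_eq
    by (intro finite_imageI finite_subset[OF _ finitely_many_partition_on[of "{1..2 * n}"]]) auto
  obtain P where P: "M = half_uniform P" "partition_on {1..2 * n} P" "\<forall>A\<in>P. even (card A)"
    using M unfolding balanced_uniform_sums_eq by blast
  have disj: "A \<inter> B = {}" if "A \<in> P" "B \<in> P" "A \<noteq> B" for A B
    using disjointD[OF partition_onD2[OF P(2)]] that by blast
  have "finite A" if "A \<in> P" for A
    using that P(2) finite_subset[of A "{1..2 * n}"] by (auto simp: partition_on_def)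
  then have "\<forall>A\<in>P. \<exists>V. partition_on A V \<and> (\<forall>p\<in>V. card p = 2)" using P(3) ex_pairing by blast
  then obtain V where V: "\<And>A. A \<in> P \<Longrightarrow> partition_on A (V A)" "\<And>A q. A \<in> P \<Longrightarrow> q \<in> V A \<Longrightarrow> card q = 2"
    by metis
  have UV: "\<Union>(V A) = A" if "A \<in> P" for A using V(1)[OF that] by (simp add: partition_on_def)
  have ne: "q \<noteq> {}" if "A \<in> P" "q \<in> V A" for A q using V(2)[OF that] by auto
  have sub: "q \<subseteq> A" if "A \<in> P" "q \<in> V A" for A q using UV[OF that(1)] that(2) by blast
  define W where "W = \<Union>(V ` P)"
  have W: "partition_on {1..2 * n} W"
  proof (rule partition_onI)
    have "\<Union>W = (\<Union>A\<in>P. \<Union>(V A))" by (auto simp: W_def)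
    also have "\<dots> = \<Union>P" using UV by simp
    finally show "\<Union>W = {1..2 * n}" using P(2) by (simp add: partition_on_def)
    show "{} \<notin> W" using ne by (auto simp: W_def)
    fix q q' assume "q \<in> W" "q' \<in> W" "q \<noteq> q'"
    then obtain A A' where A: "A \<in> P" "q \<in> V A" "A' \<in> P" "q' \<in> V A'" by (auto simp: W_def)
    show "disjnt q q'"
    proof (cases "A = A'")
      case True
      then show ?thesis
        using disjointD[OF partition_onD2[OF V(1)[OF A(1)]], of q q'] A \<open>q \<noteq> q'\<close> by (simp add: disjnt_def)
    next
      case False
      then show ?thesis using disj[OF A(1,3)] sub A by (auto simp: disjnt_def)
    qed
  qed
  have two: "card q = 2" if "q \<in> W" for q using that V(2) by (auto simp: W_def)
  have \<pi>: "partition_on W (V ` P)"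
  proof (rule partition_onI)
    show "\<Union>(V ` P) = W" by (simp add: W_def)
    show "{} \<notin> V ` P"
    proof
      assume "{} \<in> V ` P"
      then obtain A where "A \<in> P" "V A = {}" by auto
      then have "A = {}" using UV[of A] by simp
      then show False using P(2) \<open>A \<in> P\<close> by (simp add: partition_on_def)
    qed
    fix v v' assume "v \<in> V ` P" "v' \<in> V ` P" "v \<noteq> v'"
    then obtain A A' where A: "v = V A" "v' = V A'" "A \<in> P" "A' \<in> P" "A \<noteq> A'" by auto
    have "q \<notin> V A'" if "q \<in> V A" for q
      using disj[OF A(3,4,5)] sub[OF A(3) that] sub[OF A(4), of q] ne[OF A(3) that] by blast
    then show "disjnt v v'" using A by (auto simp: disjnt_def)
  qed
  have UP: "Union ` V ` P = P" using UV by (force simp: image_image)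
  define F where "F = {\<pi>. partition_on W \<pi>}"
  have finW: "finite W" using W by (rule finite_elements[rotated]) simp
  then have finF: "finite F" unfolding F_def by (rule finitely_many_partition_on)
  define q where "q \<pi> = p (half_uniform (Union ` \<pi>))" for \<pi>
  \<comment> \<open>Different partitions may have the same coordinate vector, so the weights are
    collected for each vector.\<close>
  define \<mu> where "\<mu> z = (\<Sum>\<pi> | \<pi> \<in> F \<and> q \<pi> = z. real (cyclic_orderings \<pi>)) / fact n" for z
  have eq: "fact n *\<^sub>R p (catalan_matroid n) = (\<Sum>\<pi>\<in>F. real (cyclic_orderings \<pi>) *\<^sub>R q \<pi>)"
    unfolding F_def p_def q_def by (rule catalan_coord_vector(1)[OF W two])
  have total: "(\<Sum>\<pi>\<in>F. real (cyclic_orderings \<pi>)) = fact n"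
    unfolding F_def by (rule catalan_coord_vector(2)[OF W two])
  have qZ: "q ` F \<subseteq> Z"
  proof clarify
    fix \<pi> assume "\<pi> \<in> F"
    then have \<pi>: "partition_on W \<pi>" by (simp add: F_def)
    have "even (card (\<Union>B))" if "B \<in> \<pi>" for B
    proof -
      have B: "B \<subseteq> W" using \<pi> that by (auto simp: partition_on_def)
      then have "card (\<Union>B) = 2 * card B"
        using two pairwise_subset[OF partition_onD2[OF W] B] by (intro card_Union_pairs) auto
      then show ?thesis by simp
    qed
    then show "q \<pi> \<in> Z"
      unfolding q_def Z_def balanced_uniform_sums_eq
      using partition_on_Union_image[OF W \<pi>] by (intro imageI CollectI) auto
  qed
  have "0 < \<mu> (p M)"
  proof -
    have "V ` P \<in> F" "q (V ` P) = p M" using \<pi> by (simp_all add: F_def q_def UP P(1))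
    moreover have "0 < cyclic_orderings (V ` P)"
      by (rule cyclic_orderings_pos) (rule finite_elements[OF finW \<pi>])
    ultimately have "0 < (\<Sum>\<pi> | \<pi> \<in> F \<and> q \<pi> = p M. real (cyclic_orderings \<pi>))"
      using finF by (intro sum_pos2[of _ "V ` P"]) auto
    then show ?thesis by (simp add: \<mu>_def)
  qed
  moreover have "0 \<le> \<mu> z" for z by (auto simp: \<mu>_def intro!: divide_nonneg_pos sum_nonneg)
  moreover have "sum \<mu> Z = 1"
    unfolding \<mu>_def sum_divide_distrib[symmetric] sum.group[OF finF finZ qZ, of "\<lambda>\<pi>. real (cyclic_orderings \<pi>)"]
    by (simp add: total)
  moreover have "p (catalan_matroid n) = (\<Sum>z\<in>Z. \<mu> z *\<^sub>R z)"
  proof -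
    have "(\<Sum>z\<in>Z. \<mu> z *\<^sub>R z) = (\<Sum>z\<in>Z. \<Sum>\<pi> | \<pi> \<in> F \<and> q \<pi> = z. (real (cyclic_orderings \<pi>) / fact n) *\<^sub>R q \<pi>)"
      unfolding \<mu>_def sum_divide_distrib scaleR_sum_left by (intro sum.cong) auto
    also have "\<dots> = (\<Sum>\<pi>\<in>F. (real (cyclic_orderings \<pi>) / fact n) *\<^sub>R q \<pi>)"
      by (rule sum.group[OF finF finZ qZ])
    also have "\<dots> = (1 / fact n) *\<^sub>R (\<Sum>\<pi>\<in>F. real (cyclic_orderings \<pi>) *\<^sub>R q \<pi>)"
      by (simp add: scaleR_sum_right)
    also have "\<dots> = p (catalan_matroid n)" unfolding eq[symmetric] by simp
    finally show ?thesis ..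
  qed
  ultimately show ?thesis unfolding Z_def p_def by blast
qed

text \<open>Both matroids are Schubert matroids, so their vectors are unit vectors, equal only if
  the matroids are isomorphic. Every relabeling of the uniform matroid contains all
  \<open>n\<close>-subsets, but \<open>{n + 1..2 * n}\<close> misses the elements 1 and 2 if
  \<open>n \<ge> 2\<close> and so is no basis of C_n. For \<open>n = 1\<close> the two matroids
  coincide.\<close>

lemma uniform_coord_vector_neq:
  assumes n: "n \<ge> 2"
  shows "half_uniform {{1..2 * n}} \<in> balanced_uniform_sums n"
    and "coord_vector n (2 * n) (half_uniform {{1..2 * n}}) \<noteq> coord_vector n (2 * n) (catalan_matroid n)"
proof -
  define U where "U = half_uniform {{1..2 * n}}"
  have U: "U = {T. T \<subseteq> {1..2 * n} \<and> card T = n}"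
    unfolding U_def half_uniform_def by (auto simp: Int_absorb2)
  have "partition_on {1..2 * n} {{1..2 * n}}" using n by (intro partition_on_space) auto
  then show "half_uniform {{1..2 * n}} \<in> balanced_uniform_sums n"
    unfolding balanced_uniform_sums_eq by auto
  have chain: "even_chain (2 * n) [{1..2 * n}]" by (simp add: even_chain_def)
  have "chain_matroid [{1..2 * n}] = U"
  proof -
    have "(\<forall>i\<le>Suc 0. card (\<Union>(set (take i [{1..2 * n}]))) \<le> 2 * card (T \<inter> \<Union>(set (take i [{1..2 * n}])))) \<longleftrightarrow>
        2 * n \<le> 2 * card (T \<inter> {1..2 * n})" for T
      by (auto simp: le_Suc_eq)
    then show ?thesis unfolding chain_matroid_def U by (auto simp: Int_absorb2)
  qed
  then have "U \<in> schubert_matroids n (2 * n)" using chain_matroid_schubert[OF chain] by simp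
  then have pU: "coord_vector n (2 * n) U = Poly_Mapping.single (iso_class (2 * n) U) 1"
    by (rule coord_vector_schubert)
  have pC: "coord_vector n (2 * n) (catalan_matroid n) = Poly_Mapping.single (iso_class (2 * n) (catalan_matroid n)) 1"
    by (rule coord_vector_schubert[OF catalan_matroid_schubert])
  show "coord_vector n (2 * n) (half_uniform {{1..2 * n}}) \<noteq> coord_vector n (2 * n) (catalan_matroid n)"
  proof
    assume "coord_vector n (2 * n) (half_uniform {{1..2 * n}}) = coord_vector n (2 * n) (catalan_matroid n)"
    then have "Poly_Mapping.lookup (Poly_Mapping.single (iso_class (2 * n) U) (1::real)) (iso_class (2 * n) U) =
        Poly_Mapping.lookup (Poly_Mapping.single (iso_class (2 * n) (catalan_matroid n)) 1) (iso_class (2 * n) U)"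
      unfolding U_def[symmetric] pU pC by simp
    then have "iso_class (2 * n) U = iso_class (2 * n) (catalan_matroid n)"
      by (simp add: lookup_single when_def split: if_splits)
    moreover have "catalan_matroid n \<in> iso_class (2 * n) (catalan_matroid n)"
      unfolding iso_class_def isomorphic_on_def by (intro CollectI exI[of _ id]) auto
    ultimately have "isomorphic_on {1..2 * n} U (catalan_matroid n)"
      unfolding iso_class_def by blast
    then obtain f where f: "bij_betw f {1..2 * n} {1..2 * n}" "catalan_matroid n = (\<lambda>B. f ` B) ` U"
      by (auto simp: isomorphic_on_def)
    define T where "T = {n + 1..2 * n}"
    define g where "g = inv_into {1..2 * n} f"
    have g: "bij_betw g {1..2 * n} {1..2 * n}" unfolding g_def by (rule bij_betw_inv_into[OF f(1)])
    have T: "T \<subseteq> {1..2 * n}" "card T = n" by (auto simp: T_def)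
    have "card (g ` T) = n"
      using T g by (subst card_image) (auto simp: bij_betw_def intro: inj_on_subset)
    moreover have "g ` T \<subseteq> {1..2 * n}" using T g by (auto simp: bij_betw_def)
    ultimately have "g ` T \<in> U" by (simp add: U)
    moreover have "f ` g ` T = T"
      unfolding g_def using T f(1) by (simp add: bij_betw_def image_inv_into_cancel)
    ultimately have "T \<in> catalan_matroid n" unfolding f(2) by (metis imageI)
    then have "2 * 1 \<le> 2 * card (T \<inter> {..2 * 1})"
      using n unfolding catalan_matroid_eq by (metis (mono_tags, lifting) mem_Collect_eq one_le_numeral order_trans)
    moreover have "T \<inter> {..2 * 1} = {}" using n by (auto simp: T_def)
    ultimately show False by simp
  qed
qed

theorem theorem1p2:
  fixes n :: nat
  assumes "n \<ge> 2"
  shows "\<not> extremal n (2 * n) (catalan_matroid n) \<and>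
    coord_vector n (2 * n) (catalan_matroid n) \<in>
      rel_interior (convex hull (coord_vector n (2 * n) ` balanced_uniform_sums n))"
proof
  define p where "p = coord_vector n (2 * n)"
  define Z where "Z = p ` balanced_uniform_sums n"
  define x where "x = p (catalan_matroid n)"
  have finZ: "finite Z"
    unfolding Z_def balanced_uniform_sums_eq
    by (intro finite_imageI finite_subset[OF _ finitely_many_partition_on[of "{1..2 * n}"]]) auto
  have comb: "\<exists>\<mu>. (\<forall>z\<in>Z. 0 \<le> \<mu> z) \<and> 0 < \<mu> w \<and> sum \<mu> Z = 1 \<and> x = (\<Sum>z\<in>Z. \<mu> z *\<^sub>R z)" if "w \<in> Z" for w
    using that catalan_convex_combination unfolding Z_def p_def x_def by blast
  define u where "u = p (half_uniform {{1..2 * n}})"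
  have u: "u \<in> Z" "u \<noteq> x"
    unfolding u_def x_def Z_def p_def using uniform_coord_vector_neq[OF assms] by auto
  show "\<not> extremal n (2 * n) (catalan_matroid n)"
  proof
    assume "extremal n (2 * n) (catalan_matroid n)"
    then have ext: "x extreme_point_of unlabeled_polytope n (2 * n)"
      by (simp add: extremal_def x_def p_def)
    have "Z \<subseteq> p ` matroids n (2 * n)"
      unfolding Z_def balanced_uniform_sums_eq using half_uniform_matroid by blast
    then have hull: "convex hull Z \<subseteq> unlabeled_polytope n (2 * n)"
      unfolding unlabeled_polytope_def p_def by (rule hull_mono)
    obtain \<mu> where \<mu>: "\<forall>z\<in>Z. 0 \<le> \<mu> z" "0 < \<mu> u" "sum \<mu> Z = 1" "x = (\<Sum>z\<in>Z. \<mu> z *\<^sub>R z)"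
      using comb[OF u(1)] by blast
    define Y where "Y = Z - {u}"
    have Y: "finite Y" "Z = insert u Y" "u \<notin> Y" using finZ u by (auto simp: Y_def)
    have sumY: "sum \<mu> Y = 1 - \<mu> u" using \<mu>(3) Y by simp
    have xY: "x = \<mu> u *\<^sub>R u + (\<Sum>z\<in>Y. \<mu> z *\<^sub>R z)" using \<mu>(4) Y by simp
    have nonneg: "0 \<le> \<mu> z" if "z \<in> Y" for z using \<mu>(1) Y that by simp
    have "\<mu> u \<noteq> 1"
    proof
      assume 1: "\<mu> u = 1"
      then have "\<mu> z = 0" if "z \<in> Y" for z
        using sumY Y(1) nonneg that by (simp add: sum_nonneg_eq_0_iff)
      then have "x = u" using xY 1 by simp
      then show False using u(2) by simp
    qed
    moreover have "0 \<le> 1 - \<mu> u" unfolding sumY[symmetric] by (rule sum_nonneg) (rule nonneg)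
    ultimately have \<mu>u: "\<mu> u < 1" by simp
    \<comment> \<open>The normalized rest of the convex combination after splitting off
      \<open>u\<close>. The weight of \<open>u\<close> is positive and below 1, since weight 1 would
      give \<open>x = u\<close>; so \<open>x\<close> lies strictly between \<open>u\<close> and
      \<open>v\<close>.\<close>
    define v where "v = (\<Sum>z\<in>Y. (\<mu> z / (1 - \<mu> u)) *\<^sub>R z)"
    have "v \<in> convex hull Z"
      unfolding v_def
    proof (rule convex_sum[OF Y(1) convex_convex_hull])
      show "(\<Sum>z\<in>Y. \<mu> z / (1 - \<mu> u)) = 1" using sumY \<mu>u by (simp flip: sum_divide_distrib)
      show "0 \<le> \<mu> z / (1 - \<mu> u)" if "z \<in> Y" for z using nonneg[OF that] \<mu>u by simp
      show "z \<in> convex hull Z" if "z \<in> Y" for z using that Y by (simp add: hull_inc)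
    qed
    then have v: "v \<in> unlabeled_polytope n (2 * n)" using hull by blast
    have u': "u \<in> unlabeled_polytope n (2 * n)" using hull hull_inc[OF u(1), of convex] by (rule subsetD)
    have "(1 - \<mu> u) *\<^sub>R v = (\<Sum>z\<in>Y. \<mu> z *\<^sub>R z)"
      using \<mu>u by (simp add: v_def scaleR_sum_right)
    then have x: "x = (1 - (1 - \<mu> u)) *\<^sub>R u + (1 - \<mu> u) *\<^sub>R v" using xY by simp
    have "u \<noteq> v"
    proof
      assume "u = v"
      then have "x = u" using x by (simp flip: scaleR_add_left)
      then show False using u(2) by simp
    qed
    then have "x \<in> open_segment u v"
      unfolding in_segment using \<mu>(2) \<mu>u by (intro conjI exI[of _ "1 - \<mu> u"] x) simp_all
    then show False using ext u' v unfolding extreme_point_of_def by blast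
  qed
  have "\<forall>w\<in>Z. \<exists>\<mu>. (\<forall>z\<in>Z. 0 \<le> \<mu> z) \<and> 0 < \<mu> w \<and> sum \<mu> Z = 1 \<and> x = (\<Sum>z\<in>Z. \<mu> z *\<^sub>R z)"
    using comb by blast
  from bchoice[OF this] obtain \<mu> where
    \<mu>: "\<forall>w\<in>Z. (\<forall>z\<in>Z. 0 \<le> \<mu> w z) \<and> 0 < \<mu> w w \<and> sum (\<mu> w) Z = 1 \<and> x = (\<Sum>z\<in>Z. \<mu> w z *\<^sub>R z)" ..
  \<comment> \<open>Each \<open>\<mu> w\<close> is positive at \<open>w\<close> and nonnegative
    elsewhere, so their average is positive on all of \<open>Z\<close> and still represents
    \<open>x\<close>.\<close>
  define \<nu> where "\<nu> z = (\<Sum>w\<in>Z. \<mu> w z) / card Z" for z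
  have cardZ: "0 < real (card Z)" using finZ u(1) by (auto simp: card_gt_0_iff)
  have "(\<Sum>z\<in>Z. \<nu> z *\<^sub>R z) \<in> rel_interior (convex hull Z)"
  proof (rule rel_interior_convex_hull_if_pos[OF finZ])
    show "0 < \<nu> z" if z: "z \<in> Z" for z
      unfolding \<nu>_def using \<mu> z cardZ finZ by (intro divide_pos_pos sum_pos2[of _ z]) auto
    have "sum \<nu> Z = (\<Sum>w\<in>Z. sum (\<mu> w) Z) / card Z"
      unfolding \<nu>_def sum_divide_distrib[symmetric] by (subst sum.swap) simp
    also have "\<dots> = 1" using \<mu> cardZ by simp
    finally show "sum \<nu> Z = 1" .
  qed
  also have "(\<Sum>z\<in>Z. \<nu> z *\<^sub>R z) = (1 / card Z) *\<^sub>R (\<Sum>z\<in>Z. \<Sum>w\<in>Z. \<mu> w z *\<^sub>R z)"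
    by (simp add: \<nu>_def scaleR_sum_right scaleR_sum_left sum_divide_distrib)
  also have "\<dots> = (1 / card Z) *\<^sub>R (\<Sum>w\<in>Z. x)"
  proof -
    have "(\<Sum>z\<in>Z. \<mu> w z *\<^sub>R z) = x" if "w \<in> Z" for w
      using bspec[OF \<mu> that] by (elim conjE) (rule sym)
    then show ?thesis by (subst sum.swap) (simp cong: sum.cong)
  qed
  also have "\<dots> = x" using cardZ by (simp add: sum_constant_scaleR del: sum_constant)
  finally show "coord_vector n (2 * n) (catalan_matroid n) \<in>
      rel_interior (convex hull (coord_vector n (2 * n) ` balanced_uniform_sums n))"
    unfolding x_def Z_def p_def .
qed

end
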